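(* For $l=0,1,2,\dots$, $-l\le m\le l$, $0\le n\le l$, the functions $$f^+_{l,m,n}(Y)=\sqrt{\tfrac{(2l+1)(l-n)!}{(l+n)!}}\;r^{-1}(r^2-t^2)^{n/2}P_l^{(n)}(t/r)\,Y_l^m(\theta,\varphi),$$ $$f^-_{l,m,n}(Y)=\sqrt{\tfrac{(2l+1)(l-n)!}{(l+n)!}}\;r^{-1}(r^2-t^2)^{-n/2}P_l^{(n)}(t/r)\,Y_l^m(\theta,\varphi)$$ are two families of solutions of $\square_{3,1}\phi=0$ on $\mathbb M^+$. They satisfy the orthogonality relations $$\langle f^+_{l,m,n},f^\pm_{l',-m',n'}\rangle=-\langle f^-_{l,m,n},f^\pm_{l',-m',n'}\rangle=(-1)^m\frac2{\pi i}\,\delta_{l,l'}\delta_{m,m'}\delta_{n,n'}(1-\delta_{n,0})$$ with respect to the bilinear pairing $$\langle\phi_1,\phi_2\rangle=\frac1{2\pi^2i}\int_{Y\in\tilde H}(\widetilde{\deg}\phi_1)(Y)\,\phi_2(Y)\,\frac{dS}{\|Y\|}.$$ Also, the two families are related by the involutions $\phi(Y)\mapsto N(Y)^{-1}\phi(Y/N(Y))$ and $\phi(Y)\mapsto\frac{(-1)^l}{N(Y)}\phi(Y^{-1})$.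
   Context: Minkowski space is the space of matrices $$\mathbb M=\left\{Y=\begin{pmatrix}-it-ix^3&-ix^1-x^2\\-ix^1+x^2&-it+ix^3\end{pmatrix}: t,x^1,x^2,x^3\in\mathbb R\right\},$$ with $N(Y)=\det Y=r^2-t^2$, $r=\sqrt{(x^1)^2+(x^2)^2+(x^3)^2}$, $\|Y\|^2=t^2+r^2$; $Y^{-1}$ is the matrix inverse. $\mathbb M^+=\{Y\in\mathbb M: N(Y)>0\}$, $\tilde H=\{Y\in\mathbb M:N(Y)=1\}$, $dS$ is the Euclidean surface measure on $\tilde H$. $\square_{3,1}=\partial_{x^1}^2+\partial_{x^2}^2+\partial_{x^3}^2-\partial_t^2$; $\widetilde{\deg}=1+t\partial_t+\sum_{i=1}^3x^i\partial_{x^i}$. Spherical coordinates: $x^1=r\sin\theta\cos\varphi$, $x^2=r\sin\theta\sin\varphi$, $x^3=r\cos\theta$. For integers $l\ge0$, $-l\le m\le l$: $P_l^{(m)}(x)=\frac{(-1)^{l+m}}{2^ll!}(1-x^2)^{m/2}\frac{d^{l+m}}{dx^{l+m}}(1-x^2)^l$ and $Y_l^m(\theta,\varphi)=(-i)^m\sqrt{\frac{(l-m)!}{(l+m)!}}\,P_l^{(m)}(\cos\theta)e^{-im\varphi}$. "Related by the involutions" means that each involution exchanges $f^+_{l,m,n}$ and $f^-_{l,m,n}$ (for the second one, with $l$ the index of the function it is applied to). *)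

theory Defs
  imports "HOL-Analysis.Analysis"
begin

type_synonym cmat = "complex^2^2"

definition mink :: "real \<Rightarrow> real \<Rightarrow> real \<Rightarrow> real \<Rightarrow> cmat" where
  "mink t a b c = vector
     [vector [- \<i> * of_real t - \<i> * of_real c, - \<i> * of_real a - of_real b],
      vector [- \<i> * of_real a + of_real b, - \<i> * of_real t + \<i> * of_real c]]"

definition Mink :: "cmat set" where
  "Mink = {Y. \<exists>t a b c. Y = mink t a b c}"

text \<open>Coordinate functions; they are only meaningful on \<open>Mink\<close>.\<close>

definition tc :: "cmat \<Rightarrow> real" where "tc Y = - (Im (Y$1$1) + Im (Y$2$2)) / 2"
definition x1 :: "cmat \<Rightarrow> real" where "x1 Y = - Im (Y$1$2)"
definition x2 :: "cmat \<Rightarrow> real" where "x2 Y = - Re (Y$1$2)"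
definition x3 :: "cmat \<Rightarrow> real" where "x3 Y = (Im (Y$2$2) - Im (Y$1$1)) / 2"

lemma coords_mink [simp]:
  "tc (mink t a b c) = t" "x1 (mink t a b c) = a" "x2 (mink t a b c) = b" "x3 (mink t a b c) = c"
  by (simp_all add: mink_def tc_def x1_def x2_def x3_def)

lemma mink_coords: "Y \<in> Mink \<Longrightarrow> mink (tc Y) (x1 Y) (x2 Y) (x3 Y) = Y"
  by (auto simp: Mink_def)

definition rad :: "cmat \<Rightarrow> real" where
  "rad Y = sqrt ((x1 Y)\<^sup>2 + (x2 Y)\<^sup>2 + (x3 Y)\<^sup>2)"

text \<open>The determinant of a matrix in \<open>Mink\<close> is real, see \<open>det_mink\<close>.\<close>

definition N :: "cmat \<Rightarrow> real" where "N Y = Re (det Y)"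

lemma det_mink: "det (mink t a b c) = of_real (a\<^sup>2 + b\<^sup>2 + c\<^sup>2 - t\<^sup>2)"
  by (simp add: det_2 mink_def complex_eq_iff power2_eq_square algebra_simps)

lemma N_eq: "Y \<in> Mink \<Longrightarrow> N Y = (rad Y)\<^sup>2 - (tc Y)\<^sup>2"
  by (auto simp: Mink_def N_def det_mink rad_def simp del: of_real_add of_real_diff of_real_power)

text \<open>The inner product of \<open>Mink\<close> for which \<open>t, x1, x2, x3\<close> are orthonormal coordinates.
  The norm that the type \<open>complex^2^2\<close> carries is larger than \<open>mnorm\<close> by the
  factor \<open>sqrt 2\<close> on \<open>Mink\<close>.\<close>

definition minner :: "cmat \<Rightarrow> cmat \<Rightarrow> real" where
  "minner Y Z = tc Y * tc Z + x1 Y * x1 Z + x2 Y * x2 Z + x3 Y * x3 Z"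

definition mnorm :: "cmat \<Rightarrow> real" where
  "mnorm Y = sqrt ((tc Y)\<^sup>2 + (rad Y)\<^sup>2)"

lemma mnorm_eq: "mnorm Y = sqrt (minner Y Y)"
  by (simp add: mnorm_def minner_def rad_def power2_eq_square algebra_simps)

definition Mplus :: "cmat set" where "Mplus = {Y \<in> Mink. N Y > 0}"

definition Htilde :: "cmat set" where "Htilde = {Y \<in> Mink. N Y = 1}"

definition e_t :: cmat where "e_t = mink 1 0 0 0"
definition e_1 :: cmat where "e_1 = mink 0 1 0 0"
definition e_2 :: cmat where "e_2 = mink 0 0 1 0"
definition e_3 :: cmat where "e_3 = mink 0 0 0 1"

definition pd :: "cmat \<Rightarrow> (cmat \<Rightarrow> complex) \<Rightarrow> cmat \<Rightarrow> complex" where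
  "pd E f Y = vector_derivative (\<lambda>s::real. f (Y + s *\<^sub>R E)) (at 0)"

definition box31 :: "(cmat \<Rightarrow> complex) \<Rightarrow> cmat \<Rightarrow> complex" where
  "box31 f Y = pd e_1 (pd e_1 f) Y + pd e_2 (pd e_2 f) Y + pd e_3 (pd e_3 f) Y
     - pd e_t (pd e_t f) Y"

definition degt :: "(cmat \<Rightarrow> complex) \<Rightarrow> cmat \<Rightarrow> complex" where
  "degt f Y = f Y + of_real (tc Y) * pd e_t f Y + of_real (x1 Y) * pd e_1 f Y
     + of_real (x2 Y) * pd e_2 f Y + of_real (x3 Y) * pd e_3 f Y"

text \<open>\<open>Ck_on k S f\<close>: \<open>f\<close> is of class \<open>C^k\<close> on the relatively open subset \<open>S\<close> of \<open>Mink\<close>.\<close>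

primrec Ck_on :: "nat \<Rightarrow> cmat set \<Rightarrow> (cmat \<Rightarrow> complex) \<Rightarrow> bool" where
  "Ck_on 0 S f \<longleftrightarrow> continuous_on S f"
| "Ck_on (Suc k) S f \<longleftrightarrow> continuous_on S f \<and>
     (\<forall>E \<in> {e_t, e_1, e_2, e_3}.
        (\<forall>Y\<in>S. (\<lambda>s::real. f (Y + s *\<^sub>R E)) differentiable (at 0)) \<and> Ck_on k S (pd E f))"

definition solves_wave_on :: "cmat set \<Rightarrow> (cmat \<Rightarrow> complex) \<Rightarrow> bool" where
  "solves_wave_on S f \<longleftrightarrow> Ck_on 2 S f \<and> (\<forall>Y\<in>S. box31 f Y = 0)"

text \<open>\<open>(1 - x^2)^(m/2)\<close> is written as an integer power of the square root, because
  \<open>0 powr 0 = 0\<close>. For \<open>m < 0\<close> and \<open>x = 1\<close> or \<open>x = -1\<close> the formula below yields \<open>0\<close>, which is the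
  limit of the function there: the derivative has a factor \<open>(1 - x^2)^(-m)\<close>.\<close>

definition legP :: "nat \<Rightarrow> int \<Rightarrow> real \<Rightarrow> real" where
  "legP l m x = (-1) ^ nat (int l + m) / (2 ^ l * fact l) * (sqrt (1 - x\<^sup>2)) powi m *
     (deriv ^^ nat (int l + m)) (\<lambda>u. (1 - u\<^sup>2) ^ l) x"

definition Ylm :: "nat \<Rightarrow> int \<Rightarrow> real \<Rightarrow> real \<Rightarrow> complex" where
  "Ylm l m th ph = (- \<i>) powi m *
     of_real (sqrt (fact (nat (int l - m)) / fact (nat (int l + m)))) *
     of_real (legP l m (cos th)) * exp (- \<i> * of_int m * of_real ph)"

definition theta :: "cmat \<Rightarrow> real" where "theta Y = arccos (x3 Y / rad Y)"

definition phi :: "cmat \<Rightarrow> real" where "phi Y = Arg (Complex (x1 Y) (x2 Y))"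

lemma spherical_coords:
  assumes "rad Y \<noteq> 0"
  shows "x1 Y = rad Y * sin (theta Y) * cos (phi Y)"
    and "x2 Y = rad Y * sin (theta Y) * sin (phi Y)"
    and "x3 Y = rad Y * cos (theta Y)"
proof -
  have r: "rad Y > 0" using assms by (simp add: rad_def order_less_le)
  have r2: "(rad Y)\<^sup>2 = (x1 Y)\<^sup>2 + (x2 Y)\<^sup>2 + (x3 Y)\<^sup>2" by (simp add: rad_def)
  have "\<bar>x3 Y\<bar> \<le> rad Y"
    by (metis abs_le_square_iff abs_of_pos r r2 le_add_same_cancel2 sum_power2_ge_zero)
  then have b: "-1 \<le> x3 Y / rad Y" "x3 Y / rad Y \<le> 1" using r by (auto simp: field_simps abs_le_iff)
  have c: "cos (theta Y) = x3 Y / rad Y" using b by (simp add: theta_def)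
  then show "x3 Y = rad Y * cos (theta Y)" using r by simp
  have s: "sin (theta Y) = sqrt (1 - (x3 Y / rad Y)\<^sup>2)"
    using b by (simp add: theta_def sin_arccos)
  have "rad Y * sin (theta Y) = sqrt ((rad Y)\<^sup>2 * (1 - (x3 Y / rad Y)\<^sup>2))"
    using r by (simp add: s real_sqrt_mult)
  also have "(rad Y)\<^sup>2 * (1 - (x3 Y / rad Y)\<^sup>2) = (x1 Y)\<^sup>2 + (x2 Y)\<^sup>2"
    using r r2[symmetric] by (simp add: right_diff_distrib power_divide)
  finally have m: "rad Y * sin (theta Y) = cmod (Complex (x1 Y) (x2 Y))" by (simp add: complex_norm)
  have "Complex (x1 Y) (x2 Y) = cmod (Complex (x1 Y) (x2 Y)) * exp (\<i> * of_real (phi Y))"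
    by (metis phi_def Arg_eq mult_zero_left norm_zero of_real_0)
  then have e: "Complex (x1 Y) (x2 Y) = of_real (cmod (Complex (x1 Y) (x2 Y))) * cis (phi Y)"
    by (simp add: cis_conv_exp)
  from arg_cong[OF e, of Re] show "x1 Y = rad Y * sin (theta Y) * cos (phi Y)" unfolding m by simp
  from arg_cong[OF e, of Im] show "x2 Y = rad Y * sin (theta Y) * sin (phi Y)" unfolding m by simp
qed

definition f_coeff :: "nat \<Rightarrow> nat \<Rightarrow> real" where
  "f_coeff l n = sqrt (real (2 * l + 1) * fact (l - n) / fact (l + n))"

definition f_plus :: "nat \<Rightarrow> int \<Rightarrow> nat \<Rightarrow> cmat \<Rightarrow> complex" where
  "f_plus l m n Y = of_real (f_coeff l n * inverse (rad Y) *
       ((rad Y)\<^sup>2 - (tc Y)\<^sup>2) powr (real n / 2) * legP l (int n) (tc Y / rad Y)) *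
     Ylm l m (theta Y) (phi Y)"

definition f_minus :: "nat \<Rightarrow> int \<Rightarrow> nat \<Rightarrow> cmat \<Rightarrow> complex" where
  "f_minus l m n Y = of_real (f_coeff l n * inverse (rad Y) *
       ((rad Y)\<^sup>2 - (tc Y)\<^sup>2) powr (- (real n / 2)) * legP l (int n) (tc Y / rad Y)) *
     Ylm l m (theta Y) (phi Y)"

text \<open>The Euclidean surface measure of a surface in \<open>Mink\<close> parametrised by \<open>p\<close> on \<open>U\<close>: the
  image of the measure with density the square root of the Gram determinant of the tangent
  vectors.\<close>

definition gram :: "(real^'k \<Rightarrow> cmat) \<Rightarrow> real^'k \<Rightarrow> real^'k^'k" where
  "gram p u = (\<chi> i j. minner (frechet_derivative p (at u) (axis i 1))
                             (frechet_derivative p (at u) (axis j 1)))"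

definition surface_measure :: "(real^'k) set \<Rightarrow> (real^'k \<Rightarrow> cmat) \<Rightarrow> cmat measure" where
  "surface_measure U p =
     distr (density (restrict_space lborel U) (\<lambda>u. ennreal (sqrt (det (gram p u))))) borel p"

definition H_param :: "real^3 \<Rightarrow> cmat" where
  "H_param u = mink (sinh (u$1)) (cosh (u$1) * sin (u$2) * cos (u$3))
     (cosh (u$1) * sin (u$2) * sin (u$3)) (cosh (u$1) * cos (u$2))"

definition H_dom :: "(real^3) set" where
  "H_dom = {u. 0 < u$2 \<and> u$2 < pi \<and> - pi < u$3 \<and> u$3 < pi}"

text \<open>The parametrisation is injective and covers all of \<open>Htilde\<close> except for the slit
  \<open>x2 = 0, x1 \<le> 0\<close>, which has dimension two and therefore surface measure zero.\<close>

lemma H_param_image: "H_param ` H_dom = Htilde - {Y. x2 Y = 0 \<and> x1 Y \<le> 0}"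
proof (intro equalityI subsetI)
  fix Y assume "Y \<in> H_param ` H_dom"
  then obtain u where u: "u \<in> H_dom" and Y: "Y = H_param u" by blast
  have s: "sin (u$2) > 0" using u by (simp add: H_dom_def sin_gt_zero)
  have sq: "sin (u$2) * sin (u$2) = 1 - cos (u$2) * cos (u$2)"
    "sin (u$3) * sin (u$3) = 1 - cos (u$3) * cos (u$3)"
    "cosh (u$1) * cosh (u$1) = 1 + sinh (u$1) * sinh (u$1)"
    using sin_squared_eq[of "u$2"] sin_squared_eq[of "u$3"] cosh_square_eq[of "u$1"]
    by (simp_all add: power2_eq_square)
  have "(cosh (u$1) * sin (u$2) * cos (u$3))\<^sup>2 + (cosh (u$1) * sin (u$2) * sin (u$3))\<^sup>2
      + (cosh (u$1) * cos (u$2))\<^sup>2 - (sinh (u$1))\<^sup>2 = 1"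
    using sq by algebra
  then have N1: "N Y = 1" unfolding Y H_param_def N_def det_mink by (metis Re_complex_of_real)
  have "Y \<in> Mink" by (auto simp: Y H_param_def Mink_def)
  moreover have "\<not> (x2 Y = 0 \<and> x1 Y \<le> 0)"
  proof
    assume a: "x2 Y = 0 \<and> x1 Y \<le> 0"
    then have "sin (u$3) = 0" using s by (simp add: Y H_param_def)
    then have "u$3 = 0" using u sin_gt_zero[of "u$3"] sin_gt_zero[of "- (u$3)"]
      by (auto simp: H_dom_def) (metis linorder_neqE_linordered_idom neg_0_less_iff_less
          minus_less_iff order_less_irrefl)
    then show False using a s cosh_real_pos[of "u$1"] by (simp add: Y H_param_def mult_le_0_iff)
  qed
  ultimately show "Y \<in> Htilde - {Y. x2 Y = 0 \<and> x1 Y \<le> 0}" using N1 by (simp add: Htilde_def)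
next
  fix Y assume Y: "Y \<in> Htilde - {Y. x2 Y = 0 \<and> x1 Y \<le> 0}"
  then have YM: "Y \<in> Mink" and n1: "(rad Y)\<^sup>2 = 1 + (tc Y)\<^sup>2"
    using N_eq[of Y] by (auto simp: Htilde_def)
  have r0: "rad Y \<ge> 0" by (simp add: rad_def)
  have r: "rad Y > 0" using n1 r0 by (metis add_pos_nonneg less_eq_real_def less_numeral_extra(1)
        zero_eq_power2 zero_le_power2 order_less_irrefl)
  have rc: "rad Y = cosh (arsinh (tc Y))"
    using n1 r0 by (simp add: cosh_arsinh_real add.commute real_sqrt_unique)
  note sc = spherical_coords[OF r[THEN less_imp_neq, symmetric]]
  have b: "0 \<le> theta Y" "theta Y \<le> pi"
  proof -
    have "\<bar>x3 Y\<bar> \<le> rad Y"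
      by (simp add: rad_def real_le_rsqrt)
    then have "-1 \<le> x3 Y / rad Y" "x3 Y / rad Y \<le> 1" using r by (auto simp: field_simps abs_le_iff)
    then show "0 \<le> theta Y" "theta Y \<le> pi" by (simp_all add: theta_def arccos_lbound arccos_ubound)
  qed
  have s: "sin (theta Y) \<noteq> 0" using Y sc by auto
  then have "theta Y \<noteq> 0" "theta Y \<noteq> pi" by auto
  moreover have "phi Y \<noteq> pi"
  proof
    assume p: "phi Y = pi"
    have "sin (theta Y) \<ge> 0" using b by (simp add: sin_ge_zero)
    then show False using Y sc r p by (simp add: mult_nonneg_nonneg)
  qed
  moreover have "- pi < phi Y" "phi Y \<le> pi" using Arg_bounded by (simp_all add: phi_def mpi_less_Arg Arg_le_pi)
  ultimately have d: "vector [arsinh (tc Y), theta Y, phi Y] \<in> H_dom"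
    using b by (simp add: H_dom_def)
  have "H_param (vector [arsinh (tc Y), theta Y, phi Y]) = Y"
    using mink_coords[OF YM] sc rc by (simp add: H_param_def sinh_arsinh_real)
  then show "Y \<in> H_param ` H_dom" using d by (metis imageI)
qed

lemma H_param_inj: "inj_on H_param H_dom"
proof (rule inj_onI)
  fix u v assume u: "u \<in> H_dom" and v: "v \<in> H_dom" and e: "H_param u = H_param v"
  have "sinh (u$1) = sinh (v$1)" using arg_cong[OF e, of tc] by (simp add: H_param_def)
  then have 1: "u$1 = v$1" by (metis arsinh_sinh_real)
  have "cos (u$2) = cos (v$2)" using arg_cong[OF e, of x3] 1 by (simp add: H_param_def)
  then have 2: "u$2 = v$2" using u v cos_inj_pi by (simp add: H_dom_def)
  have s: "sin (v$2) \<noteq> 0" using v sin_gt_zero[of "v$2"] by (simp add: H_dom_def)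
  have "cos (u$3) = cos (v$3)" "sin (u$3) = sin (v$3)"
    using arg_cong[OF e, of x1] arg_cong[OF e, of x2] 1 2 s by (simp_all add: H_param_def)
  then have "cis (u$3) = cis (v$3)" by (simp add: complex_eq_iff)
  then have 3: "u$3 = v$3" using u v by (metis (mono_tags, lifting) Arg_cis H_dom_def greaterThanAtMost_iff less_imp_le mem_Collect_eq)
  show "u = v" using 1 2 3 by (simp add: vec_eq_iff forall_3)
qed

definition dS :: "cmat measure" where "dS = surface_measure H_dom H_param"

definition pair_integrand :: "(cmat \<Rightarrow> complex) \<Rightarrow> (cmat \<Rightarrow> complex) \<Rightarrow> cmat \<Rightarrow> complex" where
  "pair_integrand f g Y = degt f Y * g Y / of_real (mnorm Y)"

definition pairing :: "(cmat \<Rightarrow> complex) \<Rightarrow> (cmat \<Rightarrow> complex) \<Rightarrow> complex" where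
  "pairing f g = 1 / (2 * of_real (pi\<^sup>2) * \<i>) * (LINT Y:Htilde|dS. pair_integrand f g Y)"

text \<open>Absolute convergence of the integral in \<open>pairing\<close>; without it the library integral is \<open>0\<close>.\<close>

definition pairing_converges :: "(cmat \<Rightarrow> complex) \<Rightarrow> (cmat \<Rightarrow> complex) \<Rightarrow> bool" where
  "pairing_converges f g \<longleftrightarrow> set_integrable dS Htilde (pair_integrand f g)"

definition invol1 :: "(cmat \<Rightarrow> complex) \<Rightarrow> cmat \<Rightarrow> complex" where
  "invol1 f Y = inverse (of_real (N Y)) * f (inverse (N Y) *\<^sub>R Y)"

definition invol2 :: "nat \<Rightarrow> (cmat \<Rightarrow> complex) \<Rightarrow> cmat \<Rightarrow> complex" where
  "invol2 l f Y = (-1) ^ l / of_real (N Y) * f (matrix_inv Y)"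

end

theory Submission
  imports Defs "HOL-Computational_Algebra.Polynomial"
begin

text \<open>Let \<open>w = 1 - x\<^sup>2\<close> and let \<open>y\<^sub>j\<close> be the derivative of order \<open>l + j\<close> of \<open>w ^ l\<close>, for \<open>- l \<le> j\<close>. Every Legendre
function in the statement is a constant times \<open>w\<close> to the power \<open>j / 2\<close> times \<open>y\<^sub>j\<close>, and
two facts about the \<open>y\<^sub>j\<close> carry the whole proof: the equation
\<open>w y'' = 2 (j + 1) x y' - (l - j) (l + j + 1) y\<close> (\<open>rodrigues_ode\<close>), in which \<open>y'\<close> and \<open>y''\<close> are \<open>y\<^sub>j\<^sub>+\<^sub>1\<close> and
\<open>y\<^sub>j\<^sub>+\<^sub>2\<close>, and the reflection formula, by which \<open>y\<close> of index \<open>- m\<close> is a constant times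
\<open>w ^ m y\<^sub>m\<close> (\<open>rodrigues_reflect\<close>).

The wave equation. Put \<open>k = \<bar>m\<bar>\<close> and \<open>Z = x1 - \<i> x2\<close> or \<open>x1 + \<i> x2\<close>, according to the sign of \<open>m\<close>.
On the region \<open>N > 0\<close> the square roots cancel: both families are constants times
\<open>r powi (- 1 - j - k) * y\<^sub>j (t / r) * y\<^sub>k (x3 / r) * Z ^ k\<close>, with \<open>j = n\<close> for \<open>f_minus\<close> and, by the
reflection formula, with \<open>j = - n\<close> for \<open>f_plus\<close> (\<open>f_minus_separated\<close>, \<open>f_plus_separated\<close>). In this form
poles of the sphere are no longer special, so smoothness is evident. The wave operator of the
product is computed from the product rule and the Lorentzian inner products of the gradients of the
factors; the two ordinary differential equations and the choice of the exponent of \<open>r\<close> make it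
vanish (\<open>box31_separated\<close>). The product is homogeneous of degree \<open>- 1 - j\<close>, so \<open>degt\<close> multiplies it
by \<open>- j\<close> (\<open>degt_separated\<close>).

The pairing. On \<open>Htilde\<close> the two families coincide and \<open>degt\<close> multiplies \<open>f_plus\<close> by \<open>n\<close> and \<open>f_minus\<close> by
\<open>- n\<close>. Hence only integrals of \<open>f_minus\<close> against \<open>f_minus\<close> are needed, and they matter for \<open>n \<ge> 1\<close>
only. In the coordinates of \<open>H_param\<close> the density \<open>dS / \<parallel>Y\<parallel>\<close> is \<open>cosh\<^sup>2 \<eta> sin \<theta>\<close> (\<open>det_gram_H_param\<close>), so
the integral is a product of an integral over the rapidity \<open>\<eta>\<close>, one over \<open>\<theta>\<close> and one over \<open>\<phi>\<close>
(\<open>surface_integral\<close>, \<open>product_integrand\<close>). The integral over \<open>\<phi>\<close> forces \<open>m = m'\<close>; the one over \<open>\<theta>\<close> is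
the orthogonality of associated Legendre functions of equal order and forces \<open>l = l'\<close>. With
\<open>x = tanh \<eta>\<close> the one over \<open>\<eta>\<close> is the integral of \<open>P\<^sub>n P\<^sub>n\<^sub>' / w\<close> over the interval from -1 to 1, for
equal degrees \<open>l\<close>: as functions of \<open>\<eta>\<close> the two factors are eigenfunctions of one Schroedinger
operator for the eigenvalues \<open>- n\<^sup>2\<close> and \<open>- n'\<^sup>2\<close>, which gives the factor \<open>n = n'\<close>
(\<open>radial_orthogonal\<close>). The norms come from explicit primitives that lower or raise the order
(\<open>assoc_int_Suc\<close>, \<open>radial_int_Suc\<close>).

The involutions. \<open>f_plus = N ^ n * f_minus\<close>, and \<open>f_minus\<close> is homogeneous of degree \<open>- 1 - n\<close> and has
parity \<open>(-1) ^ l\<close> under the reflection of space. Since the inverse matrix is the reflected matrix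
divided by \<open>N\<close>, both involutions follow (\<open>involutions\<close>).\<close>

section \<open>Derivatives of powers of \<open>1 - x\<^sup>2\<close>\<close>

definition rodrigues :: "nat \<Rightarrow> nat \<Rightarrow> real poly" where
  "rodrigues l k = (pderiv ^^ k) ([:1, 0, -1:] ^ l)"

lemma pderiv_rodrigues: "pderiv (rodrigues l k) = rodrigues l (Suc k)"
  by (simp add: rodrigues_def)

text \<open>Identifies the iterated derivative in \<open>legP\<close>, which is a function, with a polynomial.\<close>

lemma deriv_funpow_rodrigues: "(deriv ^^ k) (\<lambda>u::real. (1 - u\<^sup>2) ^ l) = poly (rodrigues l k)"
proof (induction k)
  case 0
  show ?case by (simp add: rodrigues_def fun_eq_iff power2_eq_square)
next
  case (Suc k)
  have "deriv (poly p) = poly (pderiv p)" for p :: "real poly"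
    by (auto intro!: DERIV_imp_deriv poly_DERIV)
  then show ?case by (simp add: Suc pderiv_rodrigues)
qed

text \<open>For \<open>k = 0\<close> this is the derivative of \<open>w u' + 2 l x u = 0\<close>, which \<open>u = w ^ l\<close> satisfies; the
derivative of the equation for \<open>k\<close> is the equation for \<open>k + 1\<close>.\<close>

lemma rodrigues_ode_poly:
  "[:1, 0, -1:] * rodrigues l (Suc (Suc k)) - smult (2 * (real k + 1 - real l)) ([:0, 1:] * rodrigues l (Suc k))
     + smult ((2 * real l - real k) * (real k + 1)) (rodrigues l k) = 0"
proof (induction k)
  case 0
  have "[:1, 0, -1:] * rodrigues l 1 + smult (2 * real l) ([:0, 1:] * rodrigues l 0) = 0"
  proof (cases l)
    case (Suc l')
    have "rodrigues l 1 = smult (real l) ([:1, 0, -1:] ^ l' * [:0, -2:])"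
      by (simp add: rodrigues_def Suc pderiv_power_Suc pderiv_pCons algebra_simps del: power_Suc
        flip: smult_minus_left)
    moreover have "rodrigues l 0 = [:1, 0, -1:] * [:1, 0, -1:] ^ l'" by (simp add: rodrigues_def Suc)
    ultimately show ?thesis
      by (intro poly_eq_poly_eq_iff[THEN iffD1] ext) (simp add: algebra_simps)
  qed (simp add: rodrigues_def)
  from arg_cong[OF this, of pderiv]
  have d: "poly (pderiv ([:1, 0, -1:] * rodrigues l 1 + smult (2 * real l) ([:0, 1:] * rodrigues l 0))) x = 0" for x
    by simp
  show ?case
    using d by (intro poly_eq_poly_eq_iff[THEN iffD1] ext)
      (simp add: pderiv_mult pderiv_add pderiv_minus pderiv_smult pderiv_pCons pderiv_rodrigues algebra_simps)
next
  case (Suc k)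
  from arg_cong[OF Suc.IH, of "\<lambda>p. poly (pderiv p)"]
  have d: "poly (pderiv ([:1, 0, -1:] * rodrigues l (Suc (Suc k)) -
     smult (2 * (real k + 1 - real l)) ([:0, 1:] * rodrigues l (Suc k))
     + smult ((2 * real l - real k) * (real k + 1)) (rodrigues l k))) x = 0" for x
    by simp
  show ?case
    using d by (intro poly_eq_poly_eq_iff[THEN iffD1] ext)
      (simp add: pderiv_mult pderiv_add pderiv_diff pderiv_minus pderiv_smult pderiv_pCons pderiv_rodrigues algebra_simps)
qed

lemma rodrigues_ode:
  "(1 - x\<^sup>2) * poly (rodrigues l (Suc (Suc k))) x = 2 * (real k + 1 - real l) * x * poly (rodrigues l (Suc k)) x
     - (2 * real l - real k) * (real k + 1) * poly (rodrigues l k) x"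
  using arg_cong[OF rodrigues_ode_poly[of l k], of "\<lambda>p. poly p x"]
  by (simp add: power2_eq_square algebra_simps)

lemma eq_divide_left_imp: "c * a = b \<Longrightarrow> c \<noteq> 0 \<Longrightarrow> a = b / (c::'a::field)"
  by (simp add: field_simps)

lemma fact_diff_Suc: "k < l \<Longrightarrow> fact (l - k) = (real l - real k) * (fact (l - Suc k) :: real)"
  by (cases "l - k") (auto simp: of_nat_diff algebra_simps Suc_diff_Suc [symmetric])

text \<open>Write the differential equation at the indices \<open>- k - 1\<close> and \<open>k - 1\<close>, where it relates three
consecutive derivatives. The first of the two equations determines the derivative of order
\<open>l - k - 1\<close> from the ones of orders \<open>l - k\<close> and \<open>l - k + 1\<close>; insert the formula for the latter two and
eliminate the derivative of order \<open>l + k - 1\<close> with the second equation.\<close>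

lemma rodrigues_reflect:
  assumes "m \<le> l"
  shows "poly (rodrigues l (l - m)) x =
    (-1) ^ m * fact (l - m) / fact (l + m) * (1 - x\<^sup>2) ^ m * poly (rodrigues l (l + m)) x"
  using assms
proof (induction m rule: less_induct)
  case (less m)
  show ?case
  proof (cases m)
    case (Suc k)
    define w where "w = 1 - x\<^sup>2"
    define C :: "nat \<Rightarrow> real" where "C i = (-1) ^ i * fact (l - i) / fact (l + i)" for i
    let ?y = "\<lambda>i. poly (rodrigues l i) x"
    have kl: "k < l" using less.prems Suc by simp
    have IHk: "?y (l - k) = C k * w ^ k * ?y (l + k)"
      using less.IH[of k] Suc kl by (simp add: w_def C_def)
    \<comment> \<open>The equation with three consecutive derivatives of orders \<open>l - k - 1\<close>, \<open>l - k\<close>, \<open>l - k + 1\<close>.\<close>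
    have low: "w * ?y (Suc (l - k)) = - 2 * real k * x * ?y (l - k)
        - (real l + real k + 1) * (real l - real k) * ?y (l - Suc k)"
      using rodrigues_ode[of x l "l - Suc k"] kl
      by (simp add: w_def Suc_diff_Suc of_nat_diff algebra_simps)
    have rec: "w * ?y (Suc (l - k)) = C k * w ^ Suc k * ?y (Suc (l + k)) - 2 * real k * x * ?y (l - k)"
    proof (cases k)
      case 0
      then show ?thesis by (simp add: C_def)
    next
      case (Suc j)
      have jl: "j < l" using Suc kl by simp
      have IHj: "?y (Suc (l - k)) = C j * w ^ j * ?y (l + j)"
        using less.IH[of j] \<open>m = Suc k\<close> Suc kl by (simp add: w_def C_def Suc_diff_Suc)
      \<comment> \<open>The equation at the mirror image, which eliminates the order \<open>l + k - 1\<close>.\<close>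
      have up: "w * ?y (Suc (l + k)) = 2 * real k * x * ?y (l + k)
          - (real l - real k + 1) * (real l + real k) * ?y (l + j)"
        using rodrigues_ode[of x l "l + j"] Suc by (simp add: w_def algebra_simps)
      have "C j = - C k * ((real l - real k + 1) * (real l + real k))"
      proof -
        have "fact (l - j) = (real l - real k + 1) * (fact (l - k) :: real)"
          using jl Suc by (simp add: Suc_diff_Suc [symmetric] of_nat_diff)
        moreover have "fact (l + k) = (real l + real k) * (fact (l + j) :: real)"
          using Suc by (simp add: algebra_simps)
        moreover have "real l + real k \<noteq> 0" using Suc by linarith
        moreover have "(-1) ^ k = - ((-1) ^ j :: real)" using Suc by simp
        ultimately show ?thesis unfolding C_def by simp
      qed
      then have "C j * ?y (l + j) = C k * (w * ?y (Suc (l + k)) - 2 * real k * x * ?y (l + k))"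
        unfolding up by simp
      then have "w * ?y (Suc (l - k)) = w ^ Suc j * (C k * (w * ?y (Suc (l + k)) - 2 * real k * x * ?y (l + k)))"
        unfolding IHj by (metis mult.assoc mult.left_commute power_Suc)
      moreover have wk: "w ^ Suc j = w ^ k" using Suc by simp
      ultimately have "w * ?y (Suc (l - k)) = w ^ k * (C k * (w * ?y (Suc (l + k)) - 2 * real k * x * ?y (l + k)))"
        unfolding wk by blast
      then show ?thesis unfolding IHk by (simp add: algebra_simps)
    qed
    have "(real l + real k + 1) * (real l - real k) * ?y (l - Suc k) = - C k * w ^ Suc k * ?y (Suc (l + k))"
      using low rec by linarith
    moreover have "C k = - C (Suc k) * ((real l + real k + 1) * (real l - real k))"
    proof -
      have "fact (l - k) = (real l - real k) * (fact (l - Suc k) :: real)"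
        using kl by (simp add: Suc_diff_Suc [symmetric] of_nat_diff)
      moreover have "fact (l + Suc k) = (real l + real k + 1) * (fact (l + k) :: real)"
        by (simp add: algebra_simps)
      moreover have "real l + real k + 1 \<noteq> 0" by linarith
      moreover have "s * (b * F) / G = - (- s * F / (a * G)) * (a * b)" if "a \<noteq> 0" for s a b F G :: real
        using that by simp
      ultimately show ?thesis by (simp only: C_def power_Suc mult_minus_left mult_1_left)
    qed
    moreover have "(real l + real k + 1) * (real l - real k) \<noteq> 0" using kl by simp
    ultimately have "?y (l - Suc k) = C (Suc k) * w ^ Suc k * ?y (Suc (l + k))"
      by (simp add: mult.assoc)
    then show ?thesis by (simp add: Suc w_def C_def)
  qed simp
qed

lemma rodrigues_parity: "poly (rodrigues l k) (- x) = (-1) ^ k * poly (rodrigues l k) x"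
proof (induction k arbitrary: x)
  case 0
  show ?case by (simp add: rodrigues_def)
next
  case (Suc k)
  have "((\<lambda>x. poly (rodrigues l k) (- x)) has_real_derivative - poly (rodrigues l (Suc k)) (- x)) (at x)"
    by (auto intro!: derivative_eq_intros poly_DERIV simp: pderiv_rodrigues)
  moreover have "((\<lambda>x. poly (rodrigues l k) (- x)) has_real_derivative (-1) ^ k * poly (rodrigues l (Suc k)) x) (at x)"
    unfolding Suc by (auto intro!: derivative_eq_intros poly_DERIV simp: pderiv_rodrigues)
  ultimately have "- poly (rodrigues l (Suc k)) (- x) = (-1) ^ k * poly (rodrigues l (Suc k)) x"
    by (rule DERIV_unique)
  then show ?case by simp
qed

lemma rodrigues_top: "rodrigues l (2 * l) = [:(-1) ^ l * fact (2 * l):]"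
proof -
  have deg: "degree ([:1, 0, -1::real:] ^ l) = 2 * l"
    by (simp add: degree_power_eq)
  have "lead_coeff ([:1, 0, -1::real:] ^ l) = (-1) ^ l"
    by (simp add: lead_coeff_power)
  then have lc: "coeff ([:1, 0, -1::real:] ^ l) (2 * l) = (-1) ^ l" by (simp add: deg)
  have "degree (rodrigues l (2 * l)) = 0" by (simp add: rodrigues_def degree_higher_pderiv deg)
  moreover have "coeff (rodrigues l (2 * l)) 0 = (-1) ^ l * fact (2 * l)"
    by (simp add: rodrigues_def coeff_higher_pderiv lc pochhammer_fact)
  ultimately show ?thesis by (metis degree_0_id coeff_pCons_0 degree_eq_zeroE)
qed

section \<open>Orthogonality and norms of Legendre functions\<close>

definition antideriv :: "real poly \<Rightarrow> real poly" where
  "antideriv p = (\<Sum>i\<le>degree p. monom (coeff p i / real (Suc i)) (Suc i))"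

lemma pderiv_antideriv: "pderiv (antideriv p) = p"
  using higher_pderiv_sum[of 1 "\<lambda>i. monom (coeff p i / real (Suc i)) (Suc i)" "{..degree p}"]
  by (simp add: antideriv_def pderiv_monom poly_as_sum_of_monoms del: of_nat_Suc)

text \<open>The integral of \<open>p\<close> from -1 to 1. It is defined algebraically, so that substitutions such as
\<open>x = cos \<theta>\<close> and \<open>x = tanh \<eta>\<close> are instances of the fundamental theorem of calculus.\<close>

definition polyint :: "real poly \<Rightarrow> real" where
  "polyint p = poly (antideriv p) 1 - poly (antideriv p) (-1)"

lemma polyint_pderiv: "polyint (pderiv p) = poly p 1 - poly p (-1)"
proof -
  have "pderiv (antideriv (pderiv p) - p) = 0" by (simp add: pderiv_diff pderiv_antideriv)
  then obtain c where "antideriv (pderiv p) - p = [:c:]"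
    by (auto simp: pderiv_eq_0_iff elim: degree_eq_zeroE)
  then have "antideriv (pderiv p) = p + [:c:]" by (simp add: algebra_simps)
  then show ?thesis by (simp add: polyint_def)
qed

lemma polyint_add: "polyint (p + q) = polyint p + polyint q"
  using polyint_pderiv[of "antideriv p + antideriv q"]
  by (simp add: pderiv_add pderiv_antideriv) (simp add: polyint_def)

lemma polyint_smult: "polyint (smult c p) = c * polyint p"
  using polyint_pderiv[of "smult c (antideriv p)"]
  by (simp add: pderiv_smult pderiv_antideriv) (simp add: polyint_def algebra_simps)

text \<open>A primitive \<open>q\<close> that vanishes at both end points turns a pointwise identity into a relation between
two integrals. All recurrences below have this form.\<close>

lemma polyint_eqI:
  assumes "\<And>x. poly (pderiv q) x = a * poly p1 x - b * poly p2 x"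
    and "poly q 1 = 0" "poly q (-1) = 0"
  shows "a * polyint p1 = b * polyint p2"
proof -
  have "pderiv q = smult a p1 + smult (- b) p2"
    by (intro poly_eq_poly_eq_iff[THEN iffD1] ext) (simp add: assms)
  from arg_cong[OF this, of polyint] show ?thesis
    using assms(2,3) by (simp add: polyint_pderiv polyint_add polyint_smult del: smult_minus_left)
qed

definition wpoly :: "real poly" where "wpoly = [:1, 0, -1:]"

text \<open>Up to a constant this is \<open>P\<^sub>l\<^sup>k\<close> without its factor \<open>(1 - x\<^sup>2) powr (k / 2)\<close>.\<close>

definition leg :: "nat \<Rightarrow> nat \<Rightarrow> real poly" where "leg l k = rodrigues l (l + k)"

lemma poly_wpoly: "poly wpoly x = 1 - x\<^sup>2"
  by (simp add: wpoly_def power2_eq_square)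

lemma pderiv_wpoly_power:
  "pderiv (wpoly ^ Suc i) = smult (- 2 * (real i + 1)) ([:0, 1:] * wpoly ^ i)"
  by (simp add: pderiv_power_Suc wpoly_def pderiv_pCons del: power_Suc)
    (simp add: poly_eq_poly_eq_iff[symmetric] fun_eq_iff algebra_simps)

lemma pderiv_leg: "pderiv (leg l k) = leg l (Suc k)"
  by (simp add: leg_def pderiv_rodrigues)

lemma leg_ode:
  "(1 - x\<^sup>2) * poly (leg l (Suc (Suc k))) x = 2 * (real k + 1) * x * poly (leg l (Suc k)) x
     - (real l - real k) * (real l + real k + 1) * poly (leg l k) x"
  using rodrigues_ode[of x l "l + k"] by (simp add: leg_def algebra_simps)

text \<open>Up to constants, the inner product of the associated Legendre functions of order \<open>k\<close> and degrees
\<open>l\<close>, \<open>l'\<close>.\<close>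

definition assoc_int :: "nat \<Rightarrow> nat \<Rightarrow> nat \<Rightarrow> real" where
  "assoc_int l l' k = polyint (wpoly ^ k * leg l k * leg l' k)"

text \<open>Integration by parts, with the primitive \<open>w ^ (k + 1) * y\<^sub>k * z\<^sub>k\<^sub>+\<^sub>1\<close>, where \<open>y\<close> and \<open>z\<close> belong to \<open>l\<close> and
\<open>l'\<close>: by the differential equation for \<open>z\<close> its derivative has no other terms.\<close>

lemma assoc_int_Suc:
  "assoc_int l l' (Suc k) = (real l' - real k) * (real l' + real k + 1) * assoc_int l l' k"
proof -
  let ?w = "wpoly"
  have "1 * polyint (?w ^ Suc k * leg l (Suc k) * leg l' (Suc k)) =
    ((real l' - real k) * (real l' + real k + 1)) * polyint (?w ^ k * leg l k * leg l' k)"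
  proof (rule polyint_eqI[where q = "?w ^ Suc k * leg l k * leg l' (Suc k)"])
    fix x :: real
    define w where "w = 1 - x\<^sup>2"
    have "poly (pderiv (?w ^ Suc k * leg l k * leg l' (Suc k))) x =
      - 2 * (real k + 1) * x * w ^ k * poly (leg l k) x * poly (leg l' (Suc k)) x
      + w ^ Suc k * poly (leg l (Suc k)) x * poly (leg l' (Suc k)) x
      + w ^ k * poly (leg l k) x * (w * poly (leg l' (Suc (Suc k))) x)"
      by (simp add: pderiv_mult pderiv_wpoly_power pderiv_leg poly_wpoly w_def poly_power algebra_simps
          del: power_Suc) (simp add: algebra_simps)
    then show "poly (pderiv (?w ^ Suc k * leg l k * leg l' (Suc k))) x =
      1 * poly (?w ^ Suc k * leg l (Suc k) * leg l' (Suc k)) x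
       - (real l' - real k) * (real l' + real k + 1) * poly (?w ^ k * leg l k * leg l' k) x"
      unfolding leg_ode[of x l' k, folded w_def]
      by (simp add: poly_wpoly[of x, folded w_def] poly_power algebra_simps)
  qed (simp_all add: poly_power poly_wpoly)
  then show ?thesis by (simp add: assoc_int_def)
qed

lemma assoc_int_commute: "assoc_int l l' k = assoc_int l' l k"
  by (simp add: assoc_int_def ac_simps)

text \<open>The factor in \<open>assoc_int_Suc\<close> depends on \<open>l'\<close> only, while the integrals on both sides are symmetric
in \<open>l\<close> and \<open>l'\<close>. The factors for \<open>l\<close> and \<open>l'\<close> differ, so the integral vanishes.\<close>

lemma assoc_int_orth:
  assumes "l \<noteq> l'"
  shows "assoc_int l l' k = 0"
proof -
  have "((real l' - real k) * (real l' + real k + 1) - (real l - real k) * (real l + real k + 1)) * assoc_int l l' k = 0"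
    using assoc_int_Suc[of l l' k] assoc_int_Suc[of l' l k]
    by (simp add: assoc_int_commute[of l' l] left_diff_distrib)
  moreover have "(real l' - real k) * (real l' + real k + 1) - (real l - real k) * (real l + real k + 1)
     = (real l' - real l) * (real l + real l' + 1)"
    by (simp add: algebra_simps)
  moreover have "real l + real l' + 1 \<noteq> 0" by linarith
  ultimately show ?thesis using assms by simp
qed

lemma polyint_wpoly_power: "polyint (wpoly ^ l) = 2 * (2 ^ l * fact l)\<^sup>2 / fact (2 * l + 1)"
proof (induction l)
  case 0
  have "polyint 1 = 2" using polyint_pderiv[of "[:0, 1:]"] by (simp add: pderiv_pCons one_pCons)
  then show ?case by simp
next
  case (Suc l)
  have "(2 * real l + 3) * polyint (wpoly ^ Suc l) = (2 * (real l + 1)) * polyint (wpoly ^ l)"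
  proof (rule polyint_eqI[where q = "[:0, 1:] * wpoly ^ Suc l"])
    fix x :: real
    define w where "w = 1 - x\<^sup>2"
    have "poly (pderiv ([:0, 1:] * wpoly ^ Suc l)) x = w ^ Suc l - 2 * (real l + 1) * x\<^sup>2 * w ^ l"
      by (simp add: pderiv_mult pderiv_wpoly_power pderiv_pCons poly_wpoly poly_power w_def
          power2_eq_square algebra_simps del: power_Suc)
    also have "x\<^sup>2 = 1 - w" by (simp add: w_def)
    finally show "poly (pderiv ([:0, 1:] * wpoly ^ Suc l)) x =
        (2 * real l + 3) * poly (wpoly ^ Suc l) x - 2 * (real l + 1) * poly (wpoly ^ l) x"
      by (simp add: poly_wpoly[of x, folded w_def] poly_power algebra_simps)
  qed (simp_all add: poly_power poly_wpoly)
  then have "polyint (wpoly ^ Suc l) = 2 * (real l + 1) * polyint (wpoly ^ l) / (2 * real l + 3)"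
    by (simp add: field_simps)
  moreover have "fact (2 * Suc l + 1) = (2 * real l + 3) * (2 * (real l + 1)) * fact (2 * l + 1)"
    by (simp add: algebra_simps)
  moreover have "2 * real l + 3 \<noteq> 0" "real l + 1 \<noteq> 0" by linarith+
  moreover have "2 ^ Suc l * fact (Suc l) = 2 * (real l + 1) * (2 ^ l * fact l)" by simp
  moreover have "2 * m * (2 * a\<^sup>2 / F) / c = 2 * (2 * m * a)\<^sup>2 / (c * (2 * m) * F)"
    if "m \<noteq> 0" for m a F c :: real
    using that by (simp add: power2_eq_square)
  ultimately show ?case by (simp only: Suc not_False_eq_True)
qed

lemma leg_top: "leg l l = [:(-1) ^ l * fact (2 * l):]"
  using rodrigues_top[of l] by (simp add: leg_def mult_2)

text \<open>Downward induction from \<open>k = l\<close>, where \<open>leg l l\<close> is constant and the integral is one of a power of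
\<open>w\<close>.\<close>

lemma assoc_int_norm:
  assumes "k \<le> l"
  shows "assoc_int l l k = (2 ^ l * fact l)\<^sup>2 * 2 / real (2 * l + 1) * fact (l + k) / fact (l - k)"
  using assms
proof (induction k rule: inc_induct)
  case base
  have "wpoly ^ l * leg l l * leg l l = smult ((fact (2 * l))\<^sup>2) (wpoly ^ l)"
    by (simp add: leg_top power2_eq_square algebra_simps flip: power_mult_distrib)
  then have "assoc_int l l l = (fact (2 * l))\<^sup>2 * (2 * (2 ^ l * fact l)\<^sup>2 / fact (2 * l + 1))"
    by (simp only: assoc_int_def polyint_smult polyint_wpoly_power)
  moreover have "fact (2 * l + 1) = real (2 * l + 1) * (fact (2 * l) :: real)" by simp
  ultimately show ?case by (simp add: power2_eq_square mult_2 [symmetric] del: of_nat_Suc)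
next
  case (step k)
  have f: "fact (l - k) = (real l - real k) * (fact (l - Suc k) :: real)"
    by (rule fact_diff_Suc) (use step.hyps in simp)
  have g: "fact (l + Suc k) = (real l + real k + 1) * (fact (l + k) :: real)"
    by (simp add: algebra_simps)
  have nz: "real l - real k \<noteq> 0" "real l + real k + 1 \<noteq> 0" using step.hyps by linarith+
  have "(real l - real k) * (real l + real k + 1) * assoc_int l l k =
      (2 ^ l * fact l)\<^sup>2 * 2 / real (2 * l + 1) * ((real l + real k + 1) * (fact (l + k))) / fact (l - Suc k)"
    using step.IH assoc_int_Suc[of l l k] g by simp
  then have "assoc_int l l k = (2 ^ l * fact l)\<^sup>2 * 2 / real (2 * l + 1) *
      ((real l + real k + 1) * (fact (l + k))) / fact (l - Suc k) / ((real l - real k) * (real l + real k + 1))"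
    by (rule eq_divide_left_imp) (use nz in simp_all)
  also have "\<dots> = (2 ^ l * fact l)\<^sup>2 * 2 / real (2 * l + 1) * fact (l + k) / fact (l - k)"
    unfolding f using nz by (simp add: ac_simps)
  finally show ?case .
qed

text \<open>The integrals here have the weight \<open>w ^ (n - 1)\<close> instead of \<open>w ^ n\<close>; they are the norms with respect to
\<open>dx / w\<close>. With \<open>y = leg l n\<close>, \<open>z = leg l (n + 1)\<close> and \<open>lam = (l - n) (l + n + 1)\<close>, the derivatives of
\<open>x w ^ n y\<^sup>2\<close> and \<open>x w ^ (n + 1) z\<^sup>2\<close> combine to twice the difference of the two sides, up to a
multiple of \<open>lam w ^ n y\<^sup>2 - w ^ (n + 1) z\<^sup>2\<close>; the latter is minus the derivative of \<open>w ^ (n + 1) y z\<close>. The primitive vanishes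
at the end points because of \<open>n \<ge> 1\<close>.\<close>

lemma radial_int_Suc:
  assumes "n \<ge> 1"
  shows "(real n + 1) * polyint (wpoly ^ n * leg l (Suc n) * leg l (Suc n)) =
    ((real l - real n) * (real l + real n + 1) * real n) * polyint (wpoly ^ (n - 1) * leg l n * leg l n)"
proof -
  define lam where "lam = (real l - real n) * (real l + real n + 1)"
  obtain j where j: "n = Suc j" using assms by (cases n) auto
  let ?T = "smult (1/2) ([:0, lam:] * wpoly ^ n * leg l n * leg l n
      + [:0, 1:] * wpoly ^ Suc n * leg l (Suc n) * leg l (Suc n)
      + smult (2 * real n + 1) (wpoly ^ Suc n * leg l n * leg l (Suc n)))"
  show ?thesis unfolding lam_def[symmetric]
  proof (rule polyint_eqI[where q = ?T])
    fix x :: real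
    define w where "w = 1 - x\<^sup>2"
    define y z y2 where "y = poly (leg l n) x" and "z = poly (leg l (Suc n)) x"
      and "y2 = poly (leg l (Suc (Suc n))) x"
    have ode: "w * y2 = 2 * (real n + 1) * x * z - lam * y"
      using leg_ode[of x l n] by (simp add: w_def y_def z_def y2_def lam_def)
    have x2: "x * x = 1 - w" by (simp add: w_def power2_eq_square)
    have dw: "poly (pderiv (wpoly ^ Suc i)) x = - 2 * (real i + 1) * x * w ^ i" for i
      unfolding w_def by (simp add: pderiv_wpoly_power poly_wpoly poly_power w_def del: power_Suc)
    have pw: "poly (wpoly ^ i) x = w ^ i" for i
      by (simp add: poly_wpoly[of x, folded w_def] poly_power)
    have dwn: "poly (pderiv (wpoly ^ n)) x = - 2 * real n * x * w ^ j"
      using dw[of j] j by simp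
    have dX: "pderiv [:0, 1::real:] = 1" "pderiv [:0, lam:] = [:lam:]" by (simp_all add: pderiv_pCons)
    have poly_X: "poly [:0, 1:] x = x" "poly [:0, lam:] x = x * lam" "poly [:lam:] x = lam" by simp_all
    have "poly (pderiv ?T) x = (1/2) *
      (lam * w ^ n * y * y - 2 * real n * lam * (x * x) * w ^ j * y * y + 2 * lam * x * w ^ n * y * z
       + w ^ Suc n * z * z - 2 * (real n + 1) * (x * x) * w ^ n * z * z + 2 * x * w ^ n * z * (w * y2)
       + (2 * real n + 1) * (- 2 * (real n + 1) * x * w ^ n * y * z + w ^ Suc n * z * z + w ^ n * y * (w * y2)))"
      unfolding y_def z_def y2_def
      by (simp only: pderiv_smult pderiv_add pderiv_mult poly_smult poly_add poly_mult pw
          dw dwn pderiv_leg dX poly_X poly_1) (simp add: algebra_simps)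
    also have "\<dots> = (x * x + w) * ((real n + 1) * (w ^ n * z * z) - lam * real n * (w ^ j * y * y))"
      unfolding ode j power_Suc by (simp add: algebra_simps)
    also have "\<dots> = (real n + 1) * (w ^ n * z * z) - lam * real n * (w ^ j * y * y)"
      unfolding x2 by simp
    finally show "poly (pderiv ?T) x = (real n + 1) * poly (wpoly ^ n * leg l (Suc n) * leg l (Suc n)) x
       - lam * real n * poly (wpoly ^ (n - 1) * leg l n * leg l n) x"
      unfolding y_def z_def using j by (simp only: poly_mult pw diff_Suc_1)
  qed (use j in \<open>simp_all add: poly_power poly_wpoly\<close>)
qed

lemma radial_int_norm:
  assumes "n \<le> l" "1 \<le> n"
  shows "polyint (wpoly ^ (n - 1) * leg l n * leg l n) =
    (2 ^ l * fact l)\<^sup>2 * fact (l + n) / (real n * fact (l - n))"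
  using assms
proof (induction n rule: inc_induct)
  case base
  then obtain j where j: "l = Suc j" by (cases l) auto
  have "wpoly ^ (l - 1) * leg l l * leg l l = smult ((fact (2 * l))\<^sup>2) (wpoly ^ j)"
    by (simp add: leg_top power2_eq_square algebra_simps j flip: power_mult_distrib)
  then have "polyint (wpoly ^ (l - 1) * leg l l * leg l l) =
      (fact (2 * l))\<^sup>2 * (2 * (2 ^ j * fact j)\<^sup>2 / fact (2 * j + 1))"
    by (simp only: polyint_smult polyint_wpoly_power)
  moreover have "fact (2 * l) = 2 * real l * (fact (2 * j + 1) :: real)"
    by (simp add: j algebra_simps)
  ultimately have "polyint (wpoly ^ (l - 1) * leg l l * leg l l) =
      2 * real l * fact (2 * l) * (2 * (2 ^ j * fact j)\<^sup>2)"
    by (simp add: power2_eq_square)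
  also have "\<dots> = (2 ^ l * fact l)\<^sup>2 * fact (l + l) / (real l * fact (l - l))"
  proof -
    have "2 ^ l * fact l = 2 * real l * (2 ^ j * fact j)" by (simp add: j)
    moreover have "real l \<noteq> 0" "l + l = 2 * l" by (simp_all add: j)
    moreover have "2 * c * G * (2 * a\<^sup>2) = (2 * c * a)\<^sup>2 * G / (c * 1)" if "c \<noteq> 0" for c G a :: real
      using that by (simp add: power2_eq_square)
    ultimately show ?thesis by (simp only: diff_self_eq_0 fact_0 not_False_eq_True)
  qed
  finally show ?case .
next
  case (step n)
  have f: "fact (l - n) = (real l - real n) * (fact (l - Suc n) :: real)"
    by (rule fact_diff_Suc) (use step.hyps in simp)
  have g: "fact (l + Suc n) = (real l + real n + 1) * (fact (l + n) :: real)"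
    by (simp add: algebra_simps)
  have nz: "real l - real n \<noteq> 0" "real l + real n + 1 \<noteq> 0" "real n \<noteq> 0" "real n + 1 \<noteq> 0"
    using step by linarith+
  have "(real n + 1) * polyint (wpoly ^ n * leg l (Suc n) * leg l (Suc n)) =
      (2 ^ l * fact l)\<^sup>2 * ((real l + real n + 1) * fact (l + n)) / fact (l - Suc n)"
    using step.IH g nz by (simp add: mult.assoc add.commute)
  then have "polyint (wpoly ^ (n - 1) * leg l n * leg l n) = (2 ^ l * fact l)\<^sup>2 *
      ((real l + real n + 1) * fact (l + n)) / fact (l - Suc n) / ((real l - real n) * (real l + real n + 1) * real n)"
    unfolding radial_int_Suc[OF step.prems(1), of l]
    by (rule eq_divide_left_imp) (use nz in simp_all)
  also have "\<dots> = (2 ^ l * fact l)\<^sup>2 * fact (l + n) / (real n * fact (l - n))"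
    unfolding f using nz by (simp add: ac_simps)
  finally show ?case .
qed

section \<open>Regular functions on the region \<open>N > 0\<close>\<close>

text \<open>The coordinate functions are affine along every line, on the matrices outside \<open>Mink\<close> as well.\<close>

lemma coords_line [simp]:
  "tc (Y + s *\<^sub>R E) = tc Y + s * tc E" "x1 (Y + s *\<^sub>R E) = x1 Y + s * x1 E"
  "x2 (Y + s *\<^sub>R E) = x2 Y + s * x2 E" "x3 (Y + s *\<^sub>R E) = x3 Y + s * x3 E"
  by (simp_all add: tc_def x1_def x2_def x3_def algebra_simps add_divide_distrib diff_divide_distrib)

lemma coords_scaleR [simp]:
  "tc (s *\<^sub>R E) = s * tc E" "x1 (s *\<^sub>R E) = s * x1 E"
  "x2 (s *\<^sub>R E) = s * x2 E" "x3 (s *\<^sub>R E) = s * x3 E"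
  by (simp_all add: tc_def x1_def x2_def x3_def algebra_simps)

lemma coords_basis [simp]:
  "tc e_t = 1" "x1 e_t = 0" "x2 e_t = 0" "x3 e_t = 0"
  "tc e_1 = 0" "x1 e_1 = 1" "x2 e_1 = 0" "x3 e_1 = 0"
  "tc e_2 = 0" "x1 e_2 = 0" "x2 e_2 = 1" "x3 e_2 = 0"
  "tc e_3 = 0" "x1 e_3 = 0" "x2 e_3 = 0" "x3 e_3 = 1"
  by (simp_all add: e_t_def e_1_def e_2_def e_3_def)

lemma mink_line: "mink t a b c + s *\<^sub>R mink t' a' b' c' = mink (t + s * t') (a + s * a') (b + s * b') (c + s * c')"
  by (simp add: mink_def vec_eq_iff forall_2 complex_eq_iff algebra_simps)

lemma Mink_line: "Y \<in> Mink \<Longrightarrow> E \<in> Mink \<Longrightarrow> Y + s *\<^sub>R E \<in> Mink"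
  unfolding Mink_def using mink_line by blast

lemma Mink_scaleR: "E \<in> Mink \<Longrightarrow> s *\<^sub>R E \<in> Mink"
  using Mink_line[of "mink 0 0 0 0" E s]
  by (auto simp: Mink_def mink_def vec_eq_iff forall_2 complex_eq_iff)

lemma basis_Mink: "E \<in> {e_t, e_1, e_2, e_3} \<Longrightarrow> E \<in> Mink"
  by (auto simp: Mink_def e_t_def e_1_def e_2_def e_3_def)

lemma Mplus_iff: "Y \<in> Mplus \<longleftrightarrow> Y \<in> Mink \<and> (tc Y)\<^sup>2 < (rad Y)\<^sup>2"
  by (auto simp: Mplus_def N_eq)

lemma rad_sq: "(rad Y)\<^sup>2 = (x1 Y)\<^sup>2 + (x2 Y)\<^sup>2 + (x3 Y)\<^sup>2"
  by (simp add: rad_def)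

lemma rad_pos: "Y \<in> Mplus \<Longrightarrow> rad Y > 0"
proof -
  assume "Y \<in> Mplus"
  then have "(rad Y)\<^sup>2 > 0" unfolding Mplus_iff using zero_le_power2[of "tc Y"] by linarith
  moreover have "rad Y \<ge> 0" by (simp add: rad_def)
  ultimately show ?thesis by (simp add: order_less_le)
qed

lemma continuous_coords:
  "continuous_on UNIV tc" "continuous_on UNIV x1" "continuous_on UNIV x2" "continuous_on UNIV x3"
  "continuous_on UNIV rad"
  unfolding tc_def[abs_def] x1_def[abs_def] x2_def[abs_def] x3_def[abs_def] rad_def[abs_def]
  by (auto intro!: continuous_intros)

text \<open>\<open>Mplus\<close> is open in \<open>Mink\<close>, but not in the space of matrices. This is the form of openness that
derivatives along lines need.\<close>

lemma eventually_Mplus: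
  assumes "Y \<in> Mplus" "E \<in> Mink"
  shows "\<forall>\<^sub>F s in nhds 0. Y + s *\<^sub>R E \<in> Mplus"
proof -
  let ?f = "\<lambda>s. (x1 Y + s * x1 E)\<^sup>2 + (x2 Y + s * x2 E)\<^sup>2 + (x3 Y + s * x3 E)\<^sup>2 - (tc Y + s * tc E)\<^sup>2"
  have "open {s. ?f s > 0}"
    by (intro open_Collect_less continuous_intros)
  moreover have "0 \<in> {s. ?f s > 0}" using assms by (simp add: Mplus_iff rad_sq)
  ultimately have "\<forall>\<^sub>F s in nhds 0. s \<in> {s. ?f s > 0}" by (rule eventually_nhds_in_open)
  then show ?thesis
    by eventually_elim (use assms in \<open>simp add: Mplus_iff Mink_line rad_sq\<close>)
qed

text \<open>\<open>pd\<close> is total; \<open>has_pd\<close> also says that the derivative exists.\<close>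

definition has_pd :: "cmat \<Rightarrow> (cmat \<Rightarrow> complex) \<Rightarrow> cmat \<Rightarrow> complex \<Rightarrow> bool" where
  "has_pd E f Y d \<longleftrightarrow> ((\<lambda>s::real. f (Y + s *\<^sub>R E)) has_vector_derivative d) (at 0)"

lemma has_pd_imp: "has_pd E f Y d \<Longrightarrow> pd E f Y = d"
  by (simp add: has_pd_def pd_def vector_derivative_at)

lemma has_pd_cong:
  assumes "Y \<in> Mplus" "E \<in> Mink" "\<And>Y. Y \<in> Mplus \<Longrightarrow> f Y = g Y"
  shows "has_pd E f Y d \<longleftrightarrow> has_pd E g Y d"
proof -
  have "\<forall>\<^sub>F s in nhds 0. f (Y + s *\<^sub>R E) = g (Y + s *\<^sub>R E)"
    using eventually_Mplus[OF assms(1,2)] by eventually_elim (rule assms(3))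
  then show ?thesis unfolding has_pd_def
    by (intro has_vector_derivative_cong_ev refl) (auto dest: eventually_nhds_x_imp_x elim: eventually_mono)
qed

lemma pd_cong:
  assumes "Y \<in> Mplus" "E \<in> Mink" "\<And>Y. Y \<in> Mplus \<Longrightarrow> f Y = g Y"
  shows "pd E f Y = pd E g Y"
proof -
  have "\<forall>\<^sub>F s in nhds 0. f (Y + s *\<^sub>R E) = g (Y + s *\<^sub>R E)"
    using eventually_Mplus[OF assms(1,2)] by eventually_elim (rule assms(3))
  then show ?thesis unfolding pd_def by (intro vector_derivative_cong_eq) auto
qed

lemma has_pd_of_real:
  "((\<lambda>s. u (Y + s *\<^sub>R E)) has_real_derivative d) (at 0) \<Longrightarrow> has_pd E (\<lambda>Y. of_real (u Y)) Y (of_real d)"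
  unfolding has_pd_def has_real_derivative_iff_has_vector_derivative
  by (rule bounded_linear.has_vector_derivative[OF bounded_linear_of_real])

lemma has_pd_coord:
  "has_pd E (\<lambda>Y. of_real (tc Y)) Y (of_real (tc E))"
  "has_pd E (\<lambda>Y. of_real (x1 Y)) Y (of_real (x1 E))"
  "has_pd E (\<lambda>Y. of_real (x2 Y)) Y (of_real (x2 E))"
  "has_pd E (\<lambda>Y. of_real (x3 Y)) Y (of_real (x3 E))"
  by (auto intro!: has_pd_of_real derivative_eq_intros)

text \<open>The Euclidean inner product of the spatial parts; it is \<open>rad Y\<close> times the derivative of \<open>rad\<close> at \<open>Y\<close> in
the direction \<open>E\<close>.\<close>

definition spatial_inner :: "cmat \<Rightarrow> cmat \<Rightarrow> real" where
  "spatial_inner E Y = x1 E * x1 Y + x2 E * x2 Y + x3 E * x3 Y"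

lemma has_pd_rad_power:
  assumes "rad Y > 0"
  shows "has_pd E (\<lambda>Y. of_real (rad Y powi e)) Y (of_real (of_int e * rad Y powi (e - 2) * spatial_inner E Y))"
proof (rule has_pd_of_real)
  have "(x1 Y)\<^sup>2 + (x2 Y)\<^sup>2 + (x3 Y)\<^sup>2 > 0" using assms by (simp add: rad_def)
  then have "((\<lambda>s. rad (Y + s *\<^sub>R E)) has_real_derivative spatial_inner E Y / rad Y) (at 0)"
    unfolding rad_def coords_line
    by (auto intro!: derivative_eq_intros simp: spatial_inner_def field_simps)
  from DERIV_power_int[OF this, of e]
  have "((\<lambda>s. rad (Y + s *\<^sub>R E) powi e) has_real_derivative
      of_int e * rad Y powi (e - 1) * (spatial_inner E Y / rad Y)) (at 0)"
    using assms by simp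
  moreover have "rad Y powi (e - 1) = rad Y powi (e - 2) * rad Y"
    using assms power_int_add_1[of "rad Y" "e - 2"] by simp
  ultimately show "((\<lambda>s. rad (Y + s *\<^sub>R E) powi e) has_real_derivative
      of_int e * rad Y powi (e - 2) * spatial_inner E Y) (at 0)"
    using assms by (simp add: mult.assoc)
qed

lemma has_pd_add: "has_pd E f Y a \<Longrightarrow> has_pd E g Y b \<Longrightarrow> has_pd E (\<lambda>Y. f Y + g Y) Y (a + b)"
  unfolding has_pd_def by (rule has_vector_derivative_add)

lemma has_pd_mult: "has_pd E f Y a \<Longrightarrow> has_pd E g Y b \<Longrightarrow> has_pd E (\<lambda>Y. f Y * g Y) Y (f Y * b + a * g Y)"
  unfolding has_pd_def using has_vector_derivative_mult by fastforce

lemma has_pd_const: "has_pd E (\<lambda>_. c) Y 0"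
  by (simp add: has_pd_def)

text \<open>An algebra of functions that is visibly closed under partial derivatives and that contains both
families. The last rule makes membership depend on the values on \<open>Mplus\<close> only, so that \<open>pd E f\<close>
itself belongs to it, whatever \<open>pd\<close> does elsewhere.\<close>

inductive regular :: "(cmat \<Rightarrow> complex) \<Rightarrow> bool" where
  const: "regular (\<lambda>_. c)"
| coord_t: "regular (\<lambda>Y. of_real (tc Y))"
| coord_1: "regular (\<lambda>Y. of_real (x1 Y))"
| coord_2: "regular (\<lambda>Y. of_real (x2 Y))"
| coord_3: "regular (\<lambda>Y. of_real (x3 Y))"
| rad_power: "regular (\<lambda>Y. of_real (rad Y powi e))"
| add: "regular f \<Longrightarrow> regular g \<Longrightarrow> regular (\<lambda>Y. f Y + g Y)"
| mult: "regular f \<Longrightarrow> regular g \<Longrightarrow> regular (\<lambda>Y. f Y * g Y)"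
| cong: "regular f \<Longrightarrow> (\<And>Y. Y \<in> Mplus \<Longrightarrow> g Y = f Y) \<Longrightarrow> regular g"

lemmas regular_intros = regular.const regular.coord_t regular.coord_1 regular.coord_2 regular.coord_3
  regular.rad_power regular.add regular.mult

lemma regular_has_pd_exists:
  assumes "regular f" "E \<in> Mink"
  shows "\<exists>f'. regular f' \<and> (\<forall>Y\<in>Mplus. has_pd E f Y (f' Y))"
  using assms(1)
proof induction
  case (const c)
  show ?case using regular.const has_pd_const by blast
next
  case coord_t
  show ?case using regular.const has_pd_coord(1) by blast
next
  case coord_1
  show ?case using regular.const has_pd_coord(2) by blast
next
  case coord_2
  show ?case using regular.const has_pd_coord(3) by blast
next
  case coord_3
  show ?case using regular.const has_pd_coord(4) by blast
next
  case (rad_power e)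
  have "regular (\<lambda>Y. of_real (of_int e) * of_real (rad Y powi (e - 2)) *
      (of_real (x1 E) * of_real (x1 Y) + of_real (x2 E) * of_real (x2 Y) + of_real (x3 E) * of_real (x3 Y)))"
    by (intro regular_intros)
  then have "regular (\<lambda>Y. of_real (of_int e * rad Y powi (e - 2) * spatial_inner E Y))"
    by (simp only: spatial_inner_def of_real_mult of_real_add)
  then show ?case using has_pd_rad_power rad_pos by blast
next
  case (add f g)
  then obtain f' g' where "regular f'" "regular g'" "\<forall>Y\<in>Mplus. has_pd E f Y (f' Y)"
    "\<forall>Y\<in>Mplus. has_pd E g Y (g' Y)" by blast
  then show ?case by (intro exI[of _ "\<lambda>Y. f' Y + g' Y"]) (simp add: regular.add has_pd_add)
next
  case (mult f g)
  then obtain f' g' where "regular f'" "regular g'" "\<forall>Y\<in>Mplus. has_pd E f Y (f' Y)"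
    "\<forall>Y\<in>Mplus. has_pd E g Y (g' Y)" by blast
  with mult.hyps show ?case
    by (intro exI[of _ "\<lambda>Y. f Y * g' Y + f' Y * g Y"]) (simp add: regular.add regular.mult has_pd_mult)
next
  case (cong f g)
  then obtain f' where "regular f'" "\<forall>Y\<in>Mplus. has_pd E f Y (f' Y)" by blast
  then show ?case
    using has_pd_cong[where f = g and g = f, OF _ assms(2)] cong.hyps(2) by auto
qed

lemma regular_has_pd: "regular f \<Longrightarrow> E \<in> Mink \<Longrightarrow> Y \<in> Mplus \<Longrightarrow> has_pd E f Y (pd E f Y)"
proof -
  assume "regular f" "E \<in> Mink" "Y \<in> Mplus"
  then obtain d where d: "has_pd E f Y d" using regular_has_pd_exists by blast
  with has_pd_imp[OF d] show ?thesis by simp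
qed

lemma regular_pd:
  assumes "regular f" "E \<in> Mink"
  shows "regular (pd E f)"
proof -
  obtain f' where "regular f'" and f': "\<forall>Y\<in>Mplus. has_pd E f Y (f' Y)"
    using regular_has_pd_exists[OF assms] by blast
  show ?thesis
  proof (rule regular.cong[OF \<open>regular f'\<close>])
    fix Y assume "Y \<in> Mplus"
    then show "pd E f Y = f' Y" using f' has_pd_imp by blast
  qed
qed

lemma regular_continuous_on: "regular f \<Longrightarrow> continuous_on Mplus f"
proof (induction rule: regular.induct)
  case (cong f g)
  then show ?case using continuous_on_cong by blast
next
  case (rad_power e)
  have "continuous_on Mplus rad" by (rule continuous_on_subset[OF continuous_coords(5)]) simp
  then show ?case by (intro continuous_intros) (auto dest: rad_pos)
next
  case coord_t
  show ?case by (intro continuous_on_of_real continuous_on_subset[OF continuous_coords(1)]) simp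
next
  case coord_1
  show ?case by (intro continuous_on_of_real continuous_on_subset[OF continuous_coords(2)]) simp
next
  case coord_2
  show ?case by (intro continuous_on_of_real continuous_on_subset[OF continuous_coords(3)]) simp
next
  case coord_3
  show ?case by (intro continuous_on_of_real continuous_on_subset[OF continuous_coords(4)]) simp
next
  case (const c)
  show ?case by (rule continuous_on_const)
next
  case (add f g)
  then show ?case by (intro continuous_on_add)
next
  case (mult f g)
  then show ?case by (intro continuous_on_mult)
qed

text \<open>\<open>Ck_on\<close> asks for continuity and existence of derivatives at every order, which closure under \<open>pd\<close>
provides.\<close>

lemma regular_Ck: "regular f \<Longrightarrow> Ck_on k Mplus f"
proof (induction k arbitrary: f)
  case (Suc k)
  have "(\<lambda>s::real. f (Y + s *\<^sub>R E)) differentiable (at 0)" if "E \<in> {e_t, e_1, e_2, e_3}" "Y \<in> Mplus" for E Y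
    using regular_has_pd[OF Suc.prems basis_Mink[OF that(1)] that(2)]
    unfolding has_pd_def by (rule differentiableI_vector)
  then show ?case
    using Suc regular_pd[OF Suc.prems basis_Mink] by (simp add: regular_continuous_on)
qed (simp add: regular_continuous_on)

lemma regular_power: "regular f \<Longrightarrow> regular (\<lambda>Y. f Y ^ k)"
  by (induction k) (simp_all add: regular.const regular.mult)

lemma regular_poly:
  "regular (\<lambda>Y. of_real (u Y)) \<Longrightarrow> regular (\<lambda>Y. of_real (poly p (u Y)))"
proof (induction p)
  case (pCons a p)
  have "regular (\<lambda>Y. of_real a + of_real (u Y) * of_real (poly p (u Y)))"
    using pCons by (intro regular.add regular.mult regular.const)
  then show ?case by simp
next
  case 0
  show ?case using regular.const[of 0] by simp
qed

lemma pd_const: "pd E (\<lambda>_. c) Y = 0"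
  by (intro has_pd_imp has_pd_const)

lemma pd_coord:
  "pd E (\<lambda>Y. of_real (tc Y)) Y = of_real (tc E)"
  "pd E (\<lambda>Y. of_real (x1 Y)) Y = of_real (x1 E)"
  "pd E (\<lambda>Y. of_real (x2 Y)) Y = of_real (x2 E)"
  "pd E (\<lambda>Y. of_real (x3 Y)) Y = of_real (x3 E)"
  by (intro has_pd_imp has_pd_coord)+

context
  fixes E :: cmat and Y :: cmat
  assumes E: "E \<in> Mink" and Y: "Y \<in> Mplus"
begin

lemma pd_add: "regular f \<Longrightarrow> regular g \<Longrightarrow> pd E (\<lambda>Y. f Y + g Y) Y = pd E f Y + pd E g Y"
  by (intro has_pd_imp has_pd_add regular_has_pd E Y)

lemma pd_mult: "regular f \<Longrightarrow> regular g \<Longrightarrow> pd E (\<lambda>Y. f Y * g Y) Y = f Y * pd E g Y + pd E f Y * g Y"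
  by (intro has_pd_imp has_pd_mult regular_has_pd E Y)

lemma pd_rad_power:
  "pd E (\<lambda>Y. of_real (rad Y powi e)) Y = of_real (of_int e * rad Y powi (e - 2) * spatial_inner E Y)"
  by (intro has_pd_imp has_pd_rad_power rad_pos Y)

lemma pd_power:
  assumes "regular f"
  shows "pd E (\<lambda>Y. f Y ^ k) Y = of_nat k * f Y ^ (k - 1) * pd E f Y"
proof (induction k)
  case (Suc k)
  then show ?case using pd_mult[OF assms regular_power[OF assms, of k]]
    by (cases k) (simp_all add: algebra_simps)
qed (simp add: pd_const)

lemma pd_poly:
  assumes "regular (\<lambda>Y. of_real (u Y))"
  shows "pd E (\<lambda>Y. of_real (poly p (u Y))) Y = of_real (poly (pderiv p) (u Y)) * pd E (\<lambda>Y. of_real (u Y)) Y"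
proof (induction p)
  case (pCons a p)
  have "pd E (\<lambda>Y. of_real a + of_real (u Y) * of_real (poly p (u Y))) Y =
    pd E (\<lambda>Y. of_real a) Y + (of_real (u Y) * pd E (\<lambda>Y. of_real (poly p (u Y))) Y
      + pd E (\<lambda>Y. of_real (u Y)) Y * of_real (poly p (u Y)))"
    using pd_add[OF regular.const regular.mult[OF assms regular_poly[OF assms]]]
      pd_mult[OF assms regular_poly[OF assms]] by simp
  then show ?case by (simp add: pCons pd_const pderiv_pCons algebra_simps)
qed (simp add: pd_const)

end

section \<open>The product rule for the wave operator\<close>

text \<open>The generators \<open>of_real (rad Y powi e)\<close> of the algebra have to keep their form under simplification,
since the rules for their derivatives match on it.\<close>

declare of_real_power_int [simp del]

text \<open>The Lorentzian inner product of the gradients of \<open>f\<close> and \<open>g\<close>, the polarisation of \<open>box31\<close> as a second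
order operator (see \<open>box31_mult\<close>).\<close>

definition mgrad :: "(cmat \<Rightarrow> complex) \<Rightarrow> (cmat \<Rightarrow> complex) \<Rightarrow> cmat \<Rightarrow> complex" where
  "mgrad f g Y = pd e_1 f Y * pd e_1 g Y + pd e_2 f Y * pd e_2 g Y + pd e_3 f Y * pd e_3 g Y
     - pd e_t f Y * pd e_t g Y"

lemma mgrad_commute: "mgrad f g Y = mgrad g f Y"
  by (simp add: mgrad_def mult.commute)

lemma mgrad_mult:
  assumes "regular f" "regular g" "Y \<in> Mplus"
  shows "mgrad (\<lambda>Y. f Y * g Y) h Y = f Y * mgrad g h Y + g Y * mgrad f h Y"
  using assms by (simp add: mgrad_def pd_mult basis_Mink algebra_simps)

lemma mgrad_poly:
  assumes "regular (\<lambda>Y. of_real (u Y))" "Y \<in> Mplus"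
  shows "mgrad (\<lambda>Y. of_real (poly p (u Y))) h Y = of_real (poly (pderiv p) (u Y)) * mgrad (\<lambda>Y. of_real (u Y)) h Y"
  using assms by (simp add: mgrad_def pd_poly basis_Mink algebra_simps)

lemma mgrad_power:
  assumes "regular f" "Y \<in> Mplus"
  shows "mgrad (\<lambda>Y. f Y ^ k) h Y = of_nat k * f Y ^ (k - 1) * mgrad f h Y"
  using assms by (simp add: mgrad_def pd_power basis_Mink algebra_simps)

lemma pd_pd_mult:
  assumes "regular f" "regular g" "Y \<in> Mplus" "E \<in> Mink"
  shows "pd E (pd E (\<lambda>Y. f Y * g Y)) Y =
    f Y * pd E (pd E g) Y + 2 * pd E f Y * pd E g Y + pd E (pd E f) Y * g Y"
proof -
  have "pd E (pd E (\<lambda>Y. f Y * g Y)) Y = pd E (\<lambda>Y. f Y * pd E g Y + pd E f Y * g Y) Y"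
    using assms by (intro pd_cong) (auto simp: pd_mult)
  also have "\<dots> = pd E (\<lambda>Y. f Y * pd E g Y) Y + pd E (\<lambda>Y. pd E f Y * g Y) Y"
    by (intro pd_add regular_intros regular_pd assms)
  finally show ?thesis using assms
    by (simp add: pd_mult regular_pd algebra_simps)
qed

lemma pd_pd_poly:
  assumes "regular (\<lambda>Y. of_real (u Y))" "Y \<in> Mplus" "E \<in> Mink"
  shows "pd E (pd E (\<lambda>Y. of_real (poly p (u Y)))) Y =
    of_real (poly (pderiv (pderiv p)) (u Y)) * (pd E (\<lambda>Y. of_real (u Y)) Y)\<^sup>2
    + of_real (poly (pderiv p) (u Y)) * pd E (pd E (\<lambda>Y. of_real (u Y))) Y"
proof -
  have "pd E (pd E (\<lambda>Y. of_real (poly p (u Y)))) Y =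
      pd E (\<lambda>Y. of_real (poly (pderiv p) (u Y)) * pd E (\<lambda>Y. of_real (u Y)) Y) Y"
    using assms by (intro pd_cong) (auto simp: pd_poly)
  then show ?thesis using assms
    by (simp add: pd_mult pd_poly regular_pd regular_poly algebra_simps power2_eq_square)
qed

lemma pd_pd_rad_power:
  assumes "Y \<in> Mplus" "E \<in> Mink"
  shows "pd E (pd E (\<lambda>Y. of_real (rad Y powi e))) Y =
    of_real (of_int e * (of_int (e - 2) * rad Y powi (e - 4) * (spatial_inner E Y)\<^sup>2 + rad Y powi (e - 2) * spatial_inner E E))"
proof -
  have hs: "has_pd E (\<lambda>Y. of_real (spatial_inner E Y)) Y (of_real (spatial_inner E E))" for Y
    unfolding spatial_inner_def by (rule has_pd_of_real) (auto intro!: derivative_eq_intros)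
  have "pd E (pd E (\<lambda>Y. of_real (rad Y powi e))) Y =
      pd E (\<lambda>Y. of_real (of_int e) * (of_real (rad Y powi (e - 2)) * of_real (spatial_inner E Y))) Y"
    using assms by (intro pd_cong) (auto simp: pd_rad_power mult.assoc)
  also have "\<dots> = of_real (of_int e) * (of_real (rad Y powi (e - 2)) * of_real (spatial_inner E E)
      + of_real (of_int (e - 2) * rad Y powi (e - 2 - 2) * spatial_inner E Y) * of_real (spatial_inner E Y)) + 0 * (of_real (rad Y powi (e - 2)) * of_real (spatial_inner E Y))"
    by (intro has_pd_imp has_pd_mult has_pd_const has_pd_rad_power rad_pos hs assms)
  finally show ?thesis by (simp add: algebra_simps power2_eq_square)
qed

lemma box31_mult:
  assumes "regular f" "regular g" "Y \<in> Mplus"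
  shows "box31 (\<lambda>Y. f Y * g Y) Y = f Y * box31 g Y + g Y * box31 f Y + 2 * mgrad f g Y"
  using assms by (simp add: box31_def mgrad_def pd_pd_mult basis_Mink algebra_simps)

lemma box31_poly:
  assumes "regular (\<lambda>Y. of_real (u Y))" "Y \<in> Mplus"
  shows "box31 (\<lambda>Y. of_real (poly p (u Y))) Y =
    of_real (poly (pderiv (pderiv p)) (u Y)) * mgrad (\<lambda>Y. of_real (u Y)) (\<lambda>Y. of_real (u Y)) Y
    + of_real (poly (pderiv p) (u Y)) * box31 (\<lambda>Y. of_real (u Y)) Y"
  using assms by (simp add: box31_def mgrad_def pd_pd_poly basis_Mink algebra_simps power2_eq_square)

text \<open>A function with null gradient that solves the wave equation has powers with the same properties;
this is used for \<open>x1 - \<i> x2\<close> and \<open>x1 + \<i> x2\<close>.\<close>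

lemma box31_null_power:
  assumes "regular f" "Y \<in> Mplus" "mgrad f f Y = 0" "box31 f Y = 0"
  shows "box31 (\<lambda>Y. f Y ^ k) Y = 0"
proof (induction k)
  case 0
  show ?case using assms(2) by (simp add: box31_def pd_const basis_Mink)
      (simp add: pd_def)
next
  case (Suc k)
  have "mgrad f (\<lambda>Y. f Y ^ k) Y = 0"
    using assms by (subst mgrad_commute) (simp add: mgrad_power)
  then show ?case using assms Suc
    by (simp add: box31_mult regular_power)
qed

lemma box31_rad_power:
  assumes "Y \<in> Mplus"
  shows "box31 (\<lambda>Y. of_real (rad Y powi e)) Y = of_real (of_int (e * (e + 1)) * rad Y powi (e - 2))"
proof -
  have r: "rad Y > 0" using assms by (rule rad_pos)
  have "rad Y powi (e - 2) = rad Y powi (e - 4) * (rad Y)\<^sup>2"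
    using r power_int_add[of "rad Y" "e - 4" 2] by simp
  then have *: "rad Y powi (e - 4) * ((x1 Y)\<^sup>2 + (x2 Y)\<^sup>2 + (x3 Y)\<^sup>2) = rad Y powi (e - 2)"
    by (simp add: rad_sq)
  have "u * ((u - 2) * A * a + B) + u * ((u - 2) * A * b + B) + u * ((u - 2) * A * c + B) = u * (u + 1) * B"
    if "A * (a + b + c) = B" for u A B a b c :: real
    unfolding that[symmetric] by (simp add: algebra_simps)
  from this[OF *, of "of_int e"] have "of_int e * (of_int (e - 2) * rad Y powi (e - 4) * (x1 Y)\<^sup>2 + rad Y powi (e - 2))
    + of_int e * (of_int (e - 2) * rad Y powi (e - 4) * (x2 Y)\<^sup>2 + rad Y powi (e - 2))
    + of_int e * (of_int (e - 2) * rad Y powi (e - 4) * (x3 Y)\<^sup>2 + rad Y powi (e - 2))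
    = of_int (e * (e + 1)) * rad Y powi (e - 2)"
    by simp
  note sum = arg_cong[OF this, of complex_of_real]
  have pp: "pd E (pd E (\<lambda>Y. of_real (rad Y powi e))) Y =
    of_real (of_int e * (of_int (e - 2) * rad Y powi (e - 4) * (spatial_inner E Y)\<^sup>2 + rad Y powi (e - 2) * spatial_inner E E))"
    if "E \<in> {e_t, e_1, e_2, e_3}" for E
    by (rule pd_pd_rad_power[OF assms basis_Mink[OF that]])
  show ?thesis unfolding box31_def sum[symmetric] of_real_add
    by (subst (1 2 3 4) pp) (simp_all add: spatial_inner_def del: of_real_add of_real_mult)
qed

section \<open>Separated solutions of the wave equation\<close>

definition ratio_t :: "cmat \<Rightarrow> real" where "ratio_t Y = tc Y * rad Y powi (- 1)"
definition ratio_3 :: "cmat \<Rightarrow> real" where "ratio_3 Y = x3 Y * rad Y powi (- 1)"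
text \<open>For \<open>\<sigma> = 1\<close> and \<open>\<sigma> = -1\<close> the complex coordinates \<open>r sin \<theta>\<close> times \<open>exp (- \<i> \<phi>)\<close> and \<open>exp (\<i> \<phi>)\<close>.\<close>

definition zcoord :: "real \<Rightarrow> cmat \<Rightarrow> complex" where "zcoord \<sigma> Y = of_real (x1 Y) - \<i> * of_real \<sigma> * of_real (x2 Y)"

lemma regular_ratio_t: "regular (\<lambda>Y. of_real (ratio_t Y))"
  unfolding ratio_t_def of_real_mult by (intro regular.mult regular.coord_t regular.rad_power)

lemma regular_ratio_3: "regular (\<lambda>Y. of_real (ratio_3 Y))"
  unfolding ratio_3_def of_real_mult by (intro regular.mult regular.coord_3 regular.rad_power)

lemma regular_zcoord: "regular (zcoord \<sigma>)"
proof -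
  have "regular (\<lambda>Y. of_real (x1 Y) + (- \<i> * of_real \<sigma>) * of_real (x2 Y))"
    by (intro regular.add regular.mult regular.coord_1 regular.coord_2 regular.const)
  then show ?thesis by (simp add: zcoord_def[abs_def])
qed

lemma pd_zcoord: "pd E (zcoord \<sigma>) Y = zcoord \<sigma> E"
proof -
  have "pd E (\<lambda>Y. of_real (x1 Y) + (- \<i> * of_real \<sigma>) * of_real (x2 Y)) Y
    = of_real (x1 E) + ((- \<i> * of_real \<sigma>) * of_real (x2 E) + 0 * of_real (x2 Y))"
    by (intro has_pd_imp has_pd_add has_pd_mult has_pd_coord has_pd_const)
  then show ?thesis by (simp add: zcoord_def[abs_def])
qed

context
  fixes Y :: cmat
  assumes Y: "Y \<in> Mplus"
begin

lemma pd_ratio_t: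
  assumes "E \<in> Mink"
  shows "pd E (\<lambda>Y. of_real (ratio_t Y)) Y =
    of_real (tc E * rad Y powi (- 1) - tc Y * rad Y powi (- 3) * spatial_inner E Y)"
proof -
  have "pd E (\<lambda>Y. of_real (tc Y) * of_real (rad Y powi (- 1))) Y =
    of_real (tc Y) * of_real (of_int (- 1) * rad Y powi (- 1 - 2) * spatial_inner E Y)
    + of_real (tc E) * of_real (rad Y powi (- 1))"
    by (intro has_pd_imp has_pd_mult has_pd_coord has_pd_rad_power rad_pos Y)
  then show ?thesis by (simp add: ratio_t_def[abs_def] algebra_simps)
qed

lemma pd_ratio_3:
  assumes "E \<in> Mink"
  shows "pd E (\<lambda>Y. of_real (ratio_3 Y)) Y =
    of_real (x3 E * rad Y powi (- 1) - x3 Y * rad Y powi (- 3) * spatial_inner E Y)"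
proof -
  have "pd E (\<lambda>Y. of_real (x3 Y) * of_real (rad Y powi (- 1))) Y =
    of_real (x3 Y) * of_real (of_int (- 1) * rad Y powi (- 1 - 2) * spatial_inner E Y)
    + of_real (x3 E) * of_real (rad Y powi (- 1))"
    by (intro has_pd_imp has_pd_mult has_pd_coord has_pd_rad_power rad_pos Y)
  then show ?thesis by (simp add: ratio_3_def[abs_def] algebra_simps)
qed

lemma box31_coord:
  "box31 (\<lambda>Y. of_real (tc Y)) Y = 0" "box31 (\<lambda>Y. of_real (x3 Y)) Y = 0" "box31 (zcoord \<sigma>) Y = 0"
proof -
  have *: "pd E (pd E f) Y = 0" if "E \<in> Mink" "\<And>Y. pd E f Y = c" for E f c
    using pd_cong[OF Y that(1), where f = "pd E f" and g = "\<lambda>_. c"] that(2) by (simp add: pd_const)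
  have "pd E (pd E (\<lambda>Y. of_real (tc Y))) Y = 0" "pd E (pd E (\<lambda>Y. of_real (x3 Y))) Y = 0"
    "pd E (pd E (zcoord \<sigma>)) Y = 0" if "E \<in> Mink" for E
    by (rule *[OF that], rule pd_coord pd_zcoord)+
  then show "box31 (\<lambda>Y. of_real (tc Y)) Y = 0" "box31 (\<lambda>Y. of_real (x3 Y)) Y = 0"
    "box31 (zcoord \<sigma>) Y = 0"
    by (simp_all add: box31_def basis_Mink)
qed

end

lemma box31_ratio_t:
  assumes "Y \<in> Mplus"
  shows "box31 (\<lambda>Y. of_real (ratio_t Y)) Y = 0"
proof -
  have "mgrad (\<lambda>Y. of_real (tc Y)) (\<lambda>Y. of_real (rad Y powi (- 1))) Y = 0"
    using assms by (simp add: mgrad_def pd_coord basis_Mink has_pd_imp[OF has_pd_rad_power] rad_pos spatial_inner_def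
        del: power_int_minus1_right)
  moreover have "box31 (\<lambda>Y. of_real (rad Y powi (- 1))) Y = 0"
    by (subst box31_rad_power[OF assms]) simp
  ultimately show ?thesis
    unfolding ratio_t_def of_real_mult
    by (subst box31_mult[OF regular.coord_t regular.rad_power assms]) (simp only: box31_coord[OF assms] mult_zero_right add_0)
qed

lemma box31_ratio_3:
  assumes "Y \<in> Mplus"
  shows "box31 (\<lambda>Y. of_real (ratio_3 Y)) Y = of_real (- 2 * x3 Y * rad Y powi (- 3))"
proof -
  have "mgrad (\<lambda>Y. of_real (x3 Y)) (\<lambda>Y. of_real (rad Y powi (- 1))) Y = of_real (- x3 Y * rad Y powi (- 3))"
    using assms by (simp add: mgrad_def pd_coord basis_Mink has_pd_imp[OF has_pd_rad_power] rad_pos spatial_inner_def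
        del: power_int_minus1_right)
  moreover have "box31 (\<lambda>Y. of_real (rad Y powi (- 1))) Y = 0"
    by (subst box31_rad_power[OF assms]) simp
  ultimately show ?thesis
    unfolding ratio_3_def of_real_mult
    by (subst box31_mult[OF regular.coord_3 regular.rad_power assms])
       (simp only: box31_coord[OF assms] mult_zero_right add_0, simp)
qed

definition separated :: "int \<Rightarrow> real poly \<Rightarrow> real poly \<Rightarrow> real \<Rightarrow> nat \<Rightarrow> cmat \<Rightarrow> complex" where
  "separated e q p \<sigma> k Y =
     (of_real (rad Y powi e) * of_real (poly q (ratio_t Y))) *
     (of_real (poly p (ratio_3 Y)) * zcoord \<sigma> Y ^ k)"

lemma regular_separated: "regular (separated e q p \<sigma> k)"
  unfolding separated_def[abs_def]
  by (intro regular.mult regular.rad_power regular_poly regular_power regular_ratio_t regular_ratio_3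
      regular_zcoord)

text \<open>All gradient products of the factors of a separated solution. The gradients of \<open>t / r\<close> and \<open>x3 / r\<close>
are orthogonal, and radial derivatives of functions of degree zero in \<open>x1\<close>, \<open>x2\<close>, \<open>x3\<close> vanish;
these two facts make the variables separate.\<close>

lemma separated_mgrads:
  assumes Y: "Y \<in> Mplus" and \<sigma>: "\<sigma>\<^sup>2 = 1"
  defines "i \<equiv> complex_of_real (rad Y powi (- 2))"
  shows
    "mgrad (\<lambda>Y. of_real (ratio_t Y)) (\<lambda>Y. of_real (ratio_t Y)) Y = - (1 - (of_real (ratio_t Y))\<^sup>2) * i"
    "mgrad (\<lambda>Y. of_real (ratio_3 Y)) (\<lambda>Y. of_real (ratio_3 Y)) Y = (1 - (of_real (ratio_3 Y))\<^sup>2) * i"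
    "mgrad (\<lambda>Y. of_real (ratio_t Y)) (\<lambda>Y. of_real (ratio_3 Y)) Y = 0"
    "mgrad (\<lambda>Y. of_real (rad Y powi e)) (\<lambda>Y. of_real (ratio_t Y)) Y =
       - of_int e * of_real (rad Y powi e) * i * of_real (ratio_t Y)"
    "mgrad (\<lambda>Y. of_real (rad Y powi e)) (\<lambda>Y. of_real (ratio_3 Y)) Y = 0"
    "mgrad (zcoord \<sigma>) (zcoord \<sigma>) Y = 0"
    "mgrad (\<lambda>Y. of_real (ratio_t Y)) (zcoord \<sigma>) Y = - of_real (ratio_t Y) * i * zcoord \<sigma> Y"
    "mgrad (\<lambda>Y. of_real (ratio_3 Y)) (zcoord \<sigma>) Y = - of_real (ratio_3 Y) * i * zcoord \<sigma> Y"
    "mgrad (\<lambda>Y. of_real (rad Y powi e)) (zcoord \<sigma>) Y = of_int e * of_real (rad Y powi e) * i * zcoord \<sigma> Y"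
proof -
  define h where "h = inverse (rad Y)"
  have r: "rad Y > 0" using Y by (rule rad_pos)
  have hh: "h * h * ((x1 Y)\<^sup>2 + (x2 Y)\<^sup>2 + (x3 Y)\<^sup>2) = 1"
    unfolding rad_sq[symmetric] h_def using r by (simp add: power2_eq_square field_simps)
  have pw: "rad Y powi (- 1) = h" "rad Y powi (- 2) = h * h" "rad Y powi (- 3) = h * h * h"
    "rad Y powi (e - 2) = rad Y powi e * h * h"
    using r by (simp_all add: h_def power_int_diff power_int_minus field_simps power2_eq_square power3_eq_cube)
  note rat = ratio_t_def[of Y, unfolded pw] ratio_3_def[of Y, unfolded pw]
  note pds = pd_zcoord pd_ratio_t[OF Y, unfolded pw] pd_ratio_3[OF Y, unfolded pw]
    has_pd_imp[OF has_pd_rad_power[OF r, where e = e], unfolded pw]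
  have i: "i = of_real h * of_real h" by (simp add: i_def pw)
  have hc: "of_real h * of_real h * ((of_real (x1 Y))\<^sup>2 + (of_real (x2 Y))\<^sup>2 + (of_real (x3 Y))\<^sup>2) = (1::complex)"
    using arg_cong[OF hh, of complex_of_real] by simp
  have s2: "(complex_of_real \<sigma>)\<^sup>2 = 1" using arg_cong[OF \<sigma>, of complex_of_real] by simp
  have ii: "\<i> * (\<i> * x) = - x" for x :: complex by (simp flip: mult.assoc)
  show "mgrad (\<lambda>Y. of_real (ratio_t Y)) (\<lambda>Y. of_real (ratio_t Y)) Y = - (1 - (of_real (ratio_t Y))\<^sup>2) * i"
    unfolding mgrad_def i rat using hc by (simp add: pds basis_Mink spatial_inner_def) algebra
  show "mgrad (\<lambda>Y. of_real (ratio_3 Y)) (\<lambda>Y. of_real (ratio_3 Y)) Y = (1 - (of_real (ratio_3 Y))\<^sup>2) * i"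
    unfolding mgrad_def i rat using hc by (simp add: pds basis_Mink spatial_inner_def) algebra
  show "mgrad (\<lambda>Y. of_real (ratio_t Y)) (\<lambda>Y. of_real (ratio_3 Y)) Y = 0"
    unfolding mgrad_def i rat using hc by (simp add: pds basis_Mink spatial_inner_def) algebra
  show "mgrad (\<lambda>Y. of_real (rad Y powi e)) (\<lambda>Y. of_real (ratio_t Y)) Y =
       - of_int e * of_real (rad Y powi e) * i * of_real (ratio_t Y)"
    unfolding mgrad_def i rat using hc by (simp add: pds basis_Mink spatial_inner_def) algebra
  show "mgrad (\<lambda>Y. of_real (rad Y powi e)) (\<lambda>Y. of_real (ratio_3 Y)) Y = 0"
    unfolding mgrad_def i rat using hc by (simp add: pds basis_Mink spatial_inner_def) algebra
  show "mgrad (zcoord \<sigma>) (zcoord \<sigma>) Y = 0"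
    unfolding mgrad_def i rat using s2 by (simp add: pds basis_Mink zcoord_def)
      (simp add: ii power2_eq_square mult.left_commute[of _ \<i>] mult.assoc)
  show "mgrad (\<lambda>Y. of_real (ratio_t Y)) (zcoord \<sigma>) Y = - of_real (ratio_t Y) * i * zcoord \<sigma> Y"
    unfolding mgrad_def i rat by (simp add: pds basis_Mink spatial_inner_def zcoord_def algebra_simps)
  show "mgrad (\<lambda>Y. of_real (ratio_3 Y)) (zcoord \<sigma>) Y = - of_real (ratio_3 Y) * i * zcoord \<sigma> Y"
    unfolding mgrad_def i rat by (simp add: pds basis_Mink spatial_inner_def zcoord_def algebra_simps)
  show "mgrad (\<lambda>Y. of_real (rad Y powi e)) (zcoord \<sigma>) Y = of_int e * of_real (rad Y powi e) * i * zcoord \<sigma> Y"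
    unfolding mgrad_def i rat by (simp add: pds basis_Mink spatial_inner_def zcoord_def algebra_simps)
qed

text \<open>Collecting the second derivatives leaves the two differential equations with opposite signs and a
multiple of the product itself. The multiple is \<open>(e + k) (e + k + 1) - j (j + 1)\<close>, which vanishes for
\<open>e + k = - 1 - j\<close>.\<close>

lemma box31_separated:
  fixes j :: int
  assumes Y: "Y \<in> Mplus" and \<sigma>: "\<sigma>\<^sup>2 = 1" and e: "e = - 1 - j - int k"
    and q: "\<And>x. (1 - x\<^sup>2) * poly (pderiv (pderiv q)) x = 2 * (of_int j + 1) * x * poly (pderiv q) x
      - (real l - of_int j) * (real l + of_int j + 1) * poly q x"
    and p: "\<And>x. (1 - x\<^sup>2) * poly (pderiv (pderiv p)) x = 2 * (real k + 1) * x * poly (pderiv p) x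
      - (real l - real k) * (real l + real k + 1) * poly p x"
  shows "box31 (separated e q p \<sigma> k) Y = 0"
proof -
  define i where "i = complex_of_real (rad Y powi (- 2))"
  define R where "R = complex_of_real (rad Y powi e)"
  define s where "s = complex_of_real (ratio_t Y)"
  define z where "z = complex_of_real (ratio_3 Y)"
  define Z where "Z = zcoord \<sigma> Y ^ k"
  define q0 q1 q2 where "q0 = complex_of_real (poly q (ratio_t Y))"
    and "q1 = complex_of_real (poly (pderiv q) (ratio_t Y))"
    and "q2 = complex_of_real (poly (pderiv (pderiv q)) (ratio_t Y))"
  define p0 p1 p2 where "p0 = complex_of_real (poly p (ratio_3 Y))"
    and "p1 = complex_of_real (poly (pderiv p) (ratio_3 Y))"
    and "p2 = complex_of_real (poly (pderiv (pderiv p)) (ratio_3 Y))"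
  define J K L where "J = complex_of_int j" and "K = complex_of_nat k" and "L = complex_of_nat l"
  note regs = regular.rad_power regular_poly[OF regular_ratio_t] regular_poly[OF regular_ratio_3]
    regular_power[OF regular_zcoord] regular_ratio_t regular_ratio_3 regular_zcoord regular.mult
  note mg = separated_mgrads[OF Y \<sigma>, folded i_def]
  \<comment> \<open>The derivative of \<open>Z ^ k\<close> contains \<open>Z ^ (k - 1)\<close>, which for \<open>k = 0\<close> is harmless because of the factor \<open>k\<close>.\<close>
  have Zk: "K * zcoord \<sigma> Y ^ (k - 1) * zcoord \<sigma> Y = K * Z"
    by (cases k) (simp_all add: K_def Z_def)
  have mgZ: "mgrad f (\<lambda>Y. zcoord \<sigma> Y ^ k) Y = K * zcoord \<sigma> Y ^ (k - 1) * mgrad f (zcoord \<sigma>) Y" for f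
    by (subst mgrad_commute) (simp add: mgrad_power[OF regular_zcoord Y] K_def mgrad_commute[of f])
  have mgq: "mgrad f (\<lambda>Y. of_real (poly r (ratio_3 Y))) Y =
      of_real (poly (pderiv r) (ratio_3 Y)) * mgrad f (\<lambda>Y. of_real (ratio_3 Y)) Y" for f r
    by (subst mgrad_commute) (simp add: mgrad_poly[OF regular_ratio_3 Y] mgrad_commute[of f])
  have mgt: "mgrad f (\<lambda>Y. of_real (poly r (ratio_t Y))) Y =
      of_real (poly (pderiv r) (ratio_t Y)) * mgrad f (\<lambda>Y. of_real (ratio_t Y)) Y" for f r
    by (subst mgrad_commute) (simp add: mgrad_poly[OF regular_ratio_t Y] mgrad_commute[of f])
  have mgm: "mgrad h (\<lambda>Y. f Y * g Y) Y = f Y * mgrad h g Y + g Y * mgrad h f Y"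
    if "regular f" "regular g" for f g h
    by (subst mgrad_commute) (simp add: mgrad_mult[OF that Y] mgrad_commute[of h])
  have bR: "box31 (\<lambda>Y. of_real (rad Y powi e)) Y = of_int e * (of_int e + 1) * R * i"
    using rad_pos[OF Y] by (simp add: box31_rad_power[OF Y] R_def i_def power_int_diff power_int_minus field_simps)
  have b3: "box31 (\<lambda>Y. of_real (ratio_3 Y)) Y = - 2 * z * i"
    using rad_pos[OF Y]
    by (subst box31_ratio_3[OF Y]) (simp add: z_def i_def ratio_3_def power_int_minus field_simps power2_eq_square power3_eq_cube)
  have B1: "box31 (\<lambda>Y. of_real (rad Y powi e) * of_real (poly q (ratio_t Y))) Y =
      R * (q2 * (- (1 - s\<^sup>2) * i)) + q0 * (of_int e * (of_int e + 1) * R * i)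
      + 2 * (q1 * (- of_int e * R * i * s))"
    by (simp add: box31_mult regs Y bR box31_poly box31_ratio_t mgt mg R_def q0_def q1_def q2_def s_def)
  have B2: "box31 (\<lambda>Y. of_real (poly p (ratio_3 Y)) * zcoord \<sigma> Y ^ k) Y =
      Z * (p2 * ((1 - z\<^sup>2) * i) + p1 * (- 2 * z * i)) + 2 * (p1 * (- z * i * (K * Z)))"
    using Zk
    by (simp add: box31_mult regs Y b3 box31_poly box31_null_power[OF regular_zcoord Y] box31_coord[OF Y] mg
        mgZ mgrad_poly p0_def p1_def p2_def z_def Z_def) (auto simp: algebra_simps)
  have M: "mgrad (\<lambda>Y. of_real (rad Y powi e) * of_real (poly q (ratio_t Y)))
       (\<lambda>Y. of_real (poly p (ratio_3 Y)) * zcoord \<sigma> Y ^ k) Y =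
     R * p0 * q1 * (- s * i * (K * Z)) + q0 * p0 * (of_int e * R * i * (K * Z))"
    unfolding Zk[symmetric]
    by (simp add: mgm regs mgrad_mult Y mgZ mgq mgrad_poly mg R_def p0_def p1_def q0_def q1_def s_def)
  have e': "complex_of_int e = - 1 - J - K" by (simp add: e J_def K_def)
  have q': "(1 - s\<^sup>2) * q2 = 2 * (J + 1) * s * q1 - (L - J) * (L + J + 1) * q0"
    using arg_cong[OF q[of "ratio_t Y"], of complex_of_real]
    by (simp add: s_def q0_def q1_def q2_def J_def L_def)
  have p': "(1 - z\<^sup>2) * p2 = 2 * (K + 1) * z * p1 - (L - K) * (L + K + 1) * p0"
    using arg_cong[OF p[of "ratio_3 Y"], of complex_of_real]
    by (simp add: z_def p0_def p1_def p2_def K_def L_def)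
  have "box31 (separated e q p \<sigma> k) Y =
     R * q0 * (Z * (p2 * ((1 - z\<^sup>2) * i) + p1 * (- 2 * z * i)) + 2 * (p1 * (- z * i * (K * Z))))
     + p0 * Z * (R * (q2 * (- (1 - s\<^sup>2) * i)) + q0 * (of_int e * (of_int e + 1) * R * i)
      + 2 * (q1 * (- of_int e * R * i * s)))
     + 2 * (R * p0 * q1 * (- s * i * (K * Z)) + q0 * p0 * (of_int e * R * i * (K * Z)))"
    unfolding separated_def[abs_def]
    by (subst box31_mult[OF _ _ Y], (intro regs)+, unfold B1 B2 M)
       (simp add: R_def q0_def p0_def Z_def)
  also have "\<dots> = R * i * Z * (q0 * ((1 - z\<^sup>2) * p2 - 2 * (K + 1) * z * p1 ) - p0 * ((1 - s\<^sup>2) * q2)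
     + p0 * q0 * (of_int e * (of_int e + 1) + 2 * of_int e * K) - 2 * p0 * q1 * s * (of_int e + K))"
    by (simp add: algebra_simps)
  also have "\<dots> = 0"
    unfolding q' p' e' by (simp add: algebra_simps)
  finally show ?thesis .
qed

text \<open>The factors have the degrees \<open>e\<close>, 0, 0 and \<open>k\<close>, so \<open>degt\<close> multiplies the product by \<open>1 + e + k\<close>.\<close>

lemma degt_separated:
  assumes Y: "Y \<in> Mplus" and e: "e = - 1 - j - int k"
  shows "degt (separated e q p \<sigma> k) Y = - of_int j * separated e q p \<sigma> k Y"
proof -
  define eul where "eul f = of_real (tc Y) * pd e_t f Y + of_real (x1 Y) * pd e_1 f Y
     + of_real (x2 Y) * pd e_2 f Y + of_real (x3 Y) * pd e_3 f Y" for f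
  note regs = regular.rad_power regular_poly[OF regular_ratio_t] regular_poly[OF regular_ratio_3]
    regular_power[OF regular_zcoord] regular_ratio_t regular_ratio_3 regular_zcoord regular.mult
  have m: "eul (\<lambda>Y. f Y * g Y) = f Y * eul g + g Y * eul f" if "regular f" "regular g" for f g
    by (simp add: eul_def pd_mult basis_Mink Y that algebra_simps)
  have r: "rad Y > 0" using Y by (rule rad_pos)
  define h where "h = inverse (rad Y)"
  have pw: "rad Y powi (- 1) = h" "rad Y powi (- 3) = h * h * h"
    "rad Y powi (e - 2) = rad Y powi e * h * h"
    using r by (simp_all add: h_def power_int_diff power_int_minus field_simps power2_eq_square power3_eq_cube)
  have hh: "h * h * ((x1 Y)\<^sup>2 + (x2 Y)\<^sup>2 + (x3 Y)\<^sup>2) = 1"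
    unfolding rad_sq[symmetric] h_def using r by (simp add: power2_eq_square field_simps)
  have hc: "of_real h * of_real h * ((of_real (x1 Y))\<^sup>2 + (of_real (x2 Y))\<^sup>2 + (of_real (x3 Y))\<^sup>2) = (1::complex)"
    using arg_cong[OF hh, of complex_of_real] by simp
  note pds = pd_zcoord pd_ratio_t[OF Y, unfolded pw] pd_ratio_3[OF Y, unfolded pw]
    has_pd_imp[OF has_pd_rad_power[OF r, where e = e], unfolded pw]
  have 1: "eul (\<lambda>Y. of_real (rad Y powi e)) = of_int e * of_real (rad Y powi e)"
    unfolding eul_def using hc by (simp add: pds basis_Mink spatial_inner_def) algebra
  have "eul (\<lambda>Y. of_real (ratio_t Y)) = 0"
    unfolding eul_def using hc by (simp add: pds basis_Mink spatial_inner_def) algebra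
  then have 2: "eul (\<lambda>Y. of_real (poly q (ratio_t Y))) = 0"
    unfolding eul_def by (simp add: pd_poly basis_Mink Y regs algebra_simps) algebra
  have "eul (\<lambda>Y. of_real (ratio_3 Y)) = 0"
    unfolding eul_def using hc by (simp add: pds basis_Mink spatial_inner_def) algebra
  then have 3: "eul (\<lambda>Y. of_real (poly p (ratio_3 Y))) = 0"
    unfolding eul_def by (simp add: pd_poly basis_Mink Y regs algebra_simps) algebra
  have 4: "eul (\<lambda>Y. zcoord \<sigma> Y ^ k) = of_nat k * zcoord \<sigma> Y ^ k"
  proof -
    have "eul (\<lambda>Y. zcoord \<sigma> Y ^ k) = of_nat k * zcoord \<sigma> Y ^ (k - 1) * eul (zcoord \<sigma>)"
      by (simp add: eul_def pd_power basis_Mink Y regs) (simp add: algebra_simps)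
    moreover have "eul (zcoord \<sigma>) = zcoord \<sigma> Y"
      by (simp add: eul_def pds basis_Mink zcoord_def algebra_simps)
    ultimately show ?thesis by (cases k) simp_all
  qed
  have "eul (separated e q p \<sigma> k) = (of_int e + of_nat k) * separated e q p \<sigma> k Y"
    unfolding separated_def[abs_def]
    by (simp add: m regs 1 2 3 4 algebra_simps)
  moreover have "degt (separated e q p \<sigma> k) Y = separated e q p \<sigma> k Y + eul (separated e q p \<sigma> k)"
    by (simp add: degt_def eul_def)
  moreover have "complex_of_int e + of_nat k = - 1 - of_int j" by (simp add: e)
  ultimately have "degt (separated e q p \<sigma> k) Y =
      separated e q p \<sigma> k Y + (- 1 - of_int j) * separated e q p \<sigma> k Y"
    by (simp only:)
  then show ?thesis by (simp add: left_diff_distrib)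
qed

section \<open>The two families as separated solutions\<close>

text \<open>The second factor is the constant of the reflection formula; with it, negative orders are written
with the polynomials for the positive ones.\<close>

definition leg_coeff :: "nat \<Rightarrow> int \<Rightarrow> real" where
  "leg_coeff l m = (-1) ^ nat (int l + m) / (2 ^ l * fact l) *
     (if m < 0 then (-1) ^ nat \<bar>m\<bar> * fact (l - nat \<bar>m\<bar>) / fact (l + nat \<bar>m\<bar>) else 1)"

text \<open>The formula holds at the end points too: for \<open>m < 0\<close> the value 0 of \<open>legP\<close> there is the limit.\<close>

lemma legP_closed:
  assumes "- int l \<le> m" "m \<le> int l" "\<bar>x\<bar> \<le> 1"
  shows "legP l m x = leg_coeff l m * sqrt (1 - x\<^sup>2) ^ nat \<bar>m\<bar> * poly (leg l (nat \<bar>m\<bar>)) x"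
proof (cases "m < 0")
  case False
  then obtain k where "m = int k" by (metis nonneg_int_cases not_less)
  then show ?thesis by (simp add: legP_def leg_coeff_def deriv_funpow_rodrigues leg_def nat_add_distrib)
next
  case True
  then obtain k where k: "m = - int k" "k > 0" by (metis neg_int_cases)
  have kl: "k \<le> l" using assms k by simp
  have n: "nat (int l + m) = l - k" "nat \<bar>m\<bar> = k" using k kl by (simp_all add: nat_diff_distrib')
  have "x\<^sup>2 \<le> 1" using assms(3) by (simp add: abs_square_le_1)
  then have vv: "1 - x\<^sup>2 = sqrt (1 - x\<^sup>2) * sqrt (1 - x\<^sup>2)" by simp
  have "v powi m * (v * v) ^ k = v ^ k" for v :: real
    using k by (cases "v = 0") (auto simp: power_int_minus power_mult_distrib field_simps)
  from this[of "sqrt (1 - x\<^sup>2)", folded vv]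
  have w: "sqrt (1 - x\<^sup>2) powi m * (1 - x\<^sup>2) ^ k = sqrt (1 - x\<^sup>2) ^ k" .
  have "legP l m x = (-1) ^ (l - k) / (2 ^ l * fact l) * (sqrt (1 - x\<^sup>2) powi m * (1 - x\<^sup>2) ^ k) *
      ((-1) ^ k * fact (l - k) / fact (l + k)) * poly (leg l k) x"
    by (simp add: legP_def deriv_funpow_rodrigues n rodrigues_reflect[OF kl] leg_def)
  then show ?thesis unfolding w using k n by (simp add: leg_coeff_def)
qed

definition ylm_coeff :: "nat \<Rightarrow> int \<Rightarrow> complex" where
  "ylm_coeff l m = (- \<i>) powi m * of_real (sqrt (fact (nat (int l - m)) / fact (nat (int l + m))) * leg_coeff l m)"

lemma Ylm_closed:
  assumes "- int l \<le> m" "m \<le> int l" "0 \<le> \<theta>" "\<theta> \<le> pi"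
  shows "Ylm l m \<theta> \<phi> = ylm_coeff l m * of_real (sin \<theta> ^ nat \<bar>m\<bar> * poly (leg l (nat \<bar>m\<bar>)) (cos \<theta>)) *
      exp (- \<i> * of_int m * of_real \<phi>)"
proof -
  have "sqrt (1 - (cos \<theta>)\<^sup>2) = sin \<theta>"
    using assms by (simp add: sin_squared_eq[symmetric] sin_ge_zero)
  then show ?thesis
    using legP_closed[OF assms(1,2), of "cos \<theta>"] by (simp add: Ylm_def ylm_coeff_def)
qed

text \<open>A sign with square 1 for \<open>m = 0\<close> as well, unlike \<open>sgn\<close>: the square makes the gradient of \<open>zcoord\<close> null.\<close>

definition sgn_dir :: "int \<Rightarrow> real" where "sgn_dir m = (if m < 0 then -1 else 1)"

lemma exp_sgn_dir: "exp (- \<i> * of_int m * of_real \<phi>) = (of_real (cos \<phi>) - \<i> * of_real (sgn_dir m) * of_real (sin \<phi>)) ^ nat \<bar>m\<bar>"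
proof -
  have "of_real (cos \<phi>) - \<i> * of_real (sgn_dir m) * of_real (sin \<phi>) = cis (- sgn_dir m * \<phi>)"
    by (simp add: sgn_dir_def complex_eq_iff)
  then have "(of_real (cos \<phi>) - \<i> * of_real (sgn_dir m) * of_real (sin \<phi>)) ^ nat \<bar>m\<bar> =
      cis (real (nat \<bar>m\<bar>) * (- sgn_dir m * \<phi>))"
    by (simp only: Complex.DeMoivre)
  also have "real (nat \<bar>m\<bar>) * (- sgn_dir m * \<phi>) = - (of_int m * \<phi>)"
    by (simp add: sgn_dir_def)
  finally show ?thesis by (simp add: cis_conv_exp mult.assoc)
qed

lemma theta_range:
  assumes "rad Y > 0"
  shows "0 \<le> theta Y" "theta Y \<le> pi" "cos (theta Y) = x3 Y / rad Y"
proof -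
  have "\<bar>x3 Y\<bar> \<le> rad Y" by (simp add: rad_def real_le_rsqrt)
  then have "-1 \<le> x3 Y / rad Y" "x3 Y / rad Y \<le> 1" using assms by (auto simp: field_simps abs_le_iff)
  then show "0 \<le> theta Y" "theta Y \<le> pi" "cos (theta Y) = x3 Y / rad Y"
    by (simp_all add: theta_def arccos_lbound arccos_ubound)
qed

text \<open>The factor \<open>sin \<theta> ^ \<bar>m\<bar> * exp (- \<i> m \<phi>)\<close> is a power of \<open>zcoord / r\<close>, a function that is smooth at the poles
of the sphere, where \<open>phi\<close> is not.\<close>

lemma Ylm_cartesian:
  assumes "- int l \<le> m" "m \<le> int l" "rad Y > 0"
  shows "Ylm l m (theta Y) (phi Y) = ylm_coeff l m * of_real (rad Y powi (- int (nat \<bar>m\<bar>))) *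
    (of_real (poly (leg l (nat \<bar>m\<bar>)) (ratio_3 Y)) * zcoord (sgn_dir m) Y ^ nat \<bar>m\<bar>)"
proof -
  note th = theta_range[OF assms(3)]
  note sc = spherical_coords[of Y]
  have r: "rad Y \<noteq> 0" using assms by simp
  have "zcoord (sgn_dir m) Y = of_real (rad Y * sin (theta Y)) *
      (of_real (cos (phi Y)) - \<i> * of_real (sgn_dir m) * of_real (sin (phi Y)))"
    unfolding zcoord_def by (subst sc(1)[OF r], subst sc(2)[OF r]) (simp add: algebra_simps)
  then have "zcoord (sgn_dir m) Y ^ nat \<bar>m\<bar> = of_real (rad Y ^ nat \<bar>m\<bar>) * of_real (sin (theta Y) ^ nat \<bar>m\<bar>) *
      exp (- \<i> * of_int m * of_real (phi Y))"
    unfolding exp_sgn_dir by (simp add: power_mult_distrib)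
  moreover have "of_real (rad Y ^ nat \<bar>m\<bar>) * of_real (rad Y powi (- int (nat \<bar>m\<bar>))) = (1::complex)"
  proof -
    have "rad Y ^ k * rad Y powi (- int k) = 1" for k using r by (simp add: power_int_minus)
    from arg_cong[OF this[of "nat \<bar>m\<bar>"], of complex_of_real] show ?thesis by (simp del: int_nat_eq)
  qed
  moreover have "ratio_3 Y = cos (theta Y)" using r by (simp add: ratio_3_def th divide_inverse)
  ultimately show ?thesis
    unfolding Ylm_closed[OF assms(1,2) th(1,2)] by (simp add: mult.assoc mult.left_commute)
qed

lemma abs_ratio_t:
  assumes "Y \<in> Mplus"
  shows "\<bar>ratio_t Y\<bar> < 1" "tc Y / rad Y = ratio_t Y"
proof -
  have r: "rad Y > 0" using assms by (rule rad_pos)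
  have "\<bar>tc Y\<bar> < rad Y"
    using assms r unfolding Mplus_iff by (metis abs_of_pos power2_less_imp_less abs_ge_zero power2_abs less_imp_le)
  then show "\<bar>ratio_t Y\<bar> < 1" "tc Y / rad Y = ratio_t Y"
    using r by (simp_all add: ratio_t_def abs_mult field_simps)
qed

definition fam_coeff :: "nat \<Rightarrow> int \<Rightarrow> nat \<Rightarrow> complex" where
  "fam_coeff l m n = of_real (f_coeff l n * leg_coeff l (int n)) * ylm_coeff l m"

text \<open>The root \<open>sqrt (1 - t\<^sup>2 / r\<^sup>2) ^ n\<close> in \<open>legP\<close> is \<open>sqrt N ^ n / r ^ n\<close>, and the power of \<open>N\<close> in \<open>f_minus\<close>
cancels it.\<close>

lemma f_minus_separated:
  assumes "- int l \<le> m" "m \<le> int l" "n \<le> l" "Y \<in> Mplus"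
  shows "f_minus l m n Y = fam_coeff l m n *
    separated (- 1 - int n - int (nat \<bar>m\<bar>)) (leg l n) (leg l (nat \<bar>m\<bar>)) (sgn_dir m) (nat \<bar>m\<bar>) Y"
proof -
  have r: "rad Y > 0" using assms(4) by (rule rad_pos)
  define D where "D = (rad Y)\<^sup>2 - (tc Y)\<^sup>2"
  have D: "D > 0" using assms(4) by (simp add: D_def Mplus_iff)
  have "1 - (ratio_t Y)\<^sup>2 = D / (rad Y)\<^sup>2"
    using r by (simp add: D_def abs_ratio_t(2)[OF assms(4), symmetric] power_divide diff_divide_distrib)
  then have s: "sqrt (1 - (ratio_t Y)\<^sup>2) = sqrt D / rad Y" using r by (simp add: real_sqrt_divide)
  have "D powr (- (real n / 2)) = inverse (sqrt D ^ n)"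
    using D by (simp add: powr_minus powr_half_sqrt[symmetric] powr_powr flip: powr_realpow)
  moreover have "legP l (int n) (ratio_t Y) = leg_coeff l (int n) * (sqrt D / rad Y) ^ n * poly (leg l n) (ratio_t Y)"
    using legP_closed[of l "int n" "ratio_t Y"] abs_ratio_t(1)[OF assms(4)] assms(3) s by simp
  moreover have "inverse \<rho> * inverse (v ^ n) * (K * (v / \<rho>) ^ n * y) = K * (inverse \<rho> * inverse (\<rho> ^ n)) * y"
    if "v \<noteq> 0" "\<rho> \<noteq> 0" for v \<rho> K y :: real
    using that by (simp add: power_divide field_simps)
  moreover have "sqrt D \<noteq> 0" "rad Y \<noteq> 0" using D r by simp_all
  ultimately have "inverse (rad Y) * D powr (- (real n / 2)) * legP l (int n) (ratio_t Y) =
      leg_coeff l (int n) * (inverse (rad Y) * inverse (rad Y ^ n)) * poly (leg l n) (ratio_t Y)"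
    by metis
  also have "inverse (rad Y) * inverse (rad Y ^ n) = rad Y powi (- 1 - int n)"
    using r by (simp add: power_int_diff power_int_minus divide_inverse)
  finally have 1: "inverse (rad Y) * D powr (- (real n / 2)) * legP l (int n) (ratio_t Y) =
      leg_coeff l (int n) * rad Y powi (- 1 - int n) * poly (leg l n) (ratio_t Y)" .
  have 2: "rad Y powi (- 1 - int n - int (nat \<bar>m\<bar>)) = rad Y powi (- 1 - int n) * rad Y powi (- int (nat \<bar>m\<bar>))"
    using r power_int_add[of "rad Y" "- 1 - int n" "- int (nat \<bar>m\<bar>)"] by simp
  have "f_minus l m n Y = of_real (f_coeff l n * (inverse (rad Y) * D powr (- (real n / 2)) * legP l (int n) (ratio_t Y))) *
      Ylm l m (theta Y) (phi Y)"
    by (simp only: f_minus_def D_def abs_ratio_t(2)[OF assms(4)] mult.assoc)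
  then show ?thesis
    unfolding 1 2 separated_def fam_coeff_def Ylm_cartesian[OF assms(1,2) r] by (simp add: ac_simps)
qed

lemma f_plus_eq:
  assumes "Y \<in> Mplus"
  shows "f_plus l m n Y = of_real (N Y ^ n) * f_minus l m n Y"
proof -
  have D: "N Y > 0" and Y: "Y \<in> Mink" using assms by (simp_all add: Mplus_def)
  have "N Y powr (real n / 2) = N Y ^ n * N Y powr (- (real n / 2))"
    using D by (simp add: powr_add[symmetric] powr_realpow[symmetric])
  then show ?thesis
    by (simp add: f_plus_def f_minus_def N_eq[OF Y, symmetric] mult_ac)
qed

text \<open>Here a factor \<open>N ^ n\<close> remains. It is \<open>r ^ (2 * n) * (1 - t\<^sup>2 / r\<^sup>2) ^ n\<close>, and the reflection formula absorbs
the second factor into the polynomial: the solution is separated for the index \<open>- n\<close>.\<close>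

lemma f_plus_separated:
  assumes "- int l \<le> m" "m \<le> int l" "n \<le> l" "Y \<in> Mplus"
  shows "f_plus l m n Y = fam_coeff l m n * of_real ((-1) ^ n * fact (l + n) / fact (l - n)) *
    separated (- 1 + int n - int (nat \<bar>m\<bar>)) (rodrigues l (l - n)) (leg l (nat \<bar>m\<bar>)) (sgn_dir m) (nat \<bar>m\<bar>) Y"
proof -
  have r: "rad Y > 0" using assms(4) by (rule rad_pos)
  have Y: "Y \<in> Mink" using assms(4) by (simp add: Mplus_def)
  let ?k = "nat \<bar>m\<bar>"
  have "N Y = (rad Y)\<^sup>2 * (1 - (ratio_t Y)\<^sup>2)"
    using r by (simp add: N_eq[OF Y] abs_ratio_t(2)[OF assms(4), symmetric] field_simps)
  then have "N Y ^ n * rad Y powi (- 1 - int n - int ?k) * poly (leg l n) (ratio_t Y) =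
    (rad Y ^ n * rad Y ^ n * rad Y powi (- 1 - int n - int ?k)) * ((1 - (ratio_t Y)\<^sup>2) ^ n * poly (leg l n) (ratio_t Y))"
    by (simp add: power_mult_distrib power2_eq_square mult_ac)
  also have "rad Y ^ n * rad Y ^ n * rad Y powi (- 1 - int n - int ?k) = rad Y powi (- 1 + int n - int ?k)"
    using r by (simp add: power_int_diff power_int_minus power_int_add field_simps del: int_nat_eq)
  also have "(1 - (ratio_t Y)\<^sup>2) ^ n * poly (leg l n) (ratio_t Y) =
     (-1) ^ n * fact (l + n) / fact (l - n) * poly (rodrigues l (l - n)) (ratio_t Y)"
    by (simp add: rodrigues_reflect[OF assms(3)] leg_def flip: power_add mult_2)
  finally have *: "N Y ^ n * rad Y powi (- 1 - int n - int ?k) * poly (leg l n) (ratio_t Y) =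
      rad Y powi (- 1 + int n - int ?k) * ((-1) ^ n * fact (l + n) / fact (l - n) * poly (rodrigues l (l - n)) (ratio_t Y))" .
  show ?thesis
    unfolding f_plus_eq[OF assms(4)] f_minus_separated[OF assms] separated_def
    using arg_cong[OF *, of "\<lambda>v. fam_coeff l m n * of_real v *
      (of_real (poly (leg l ?k) (ratio_3 Y)) * zcoord (sgn_dir m) Y ^ ?k)"]
    by (simp add: mult_ac)
qed

lemma leg_ode_pderiv: "(1 - x\<^sup>2) * poly (pderiv (pderiv (leg l k))) x = 2 * (real k + 1) * x * poly (pderiv (leg l k)) x
      - (real l - real k) * (real l + real k + 1) * poly (leg l k) x"
  by (simp add: pderiv_leg leg_ode)

lemma solves_wave_on_scaled:
  assumes "regular g" "\<And>Y. Y \<in> Mplus \<Longrightarrow> f Y = c * g Y" "\<And>Y. Y \<in> Mplus \<Longrightarrow> box31 g Y = 0"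
  shows "solves_wave_on Mplus f"
proof -
  have reg: "regular (\<lambda>Y. c * g Y)" by (intro regular.mult regular.const assms(1))
  have "regular f" by (rule regular.cong[OF reg assms(2)])
  moreover have "box31 f Y = 0" if Y: "Y \<in> Mplus" for Y
  proof -
    have pp: "pd E (pd E f) Y = c * pd E (pd E g) Y" if E: "E \<in> Mink" for E
    proof -
      have pf: "pd E f Y' = c * pd E g Y'" if "Y' \<in> Mplus" for Y'
        using pd_cong[OF that E assms(2)] pd_mult[OF E that regular.const assms(1)]
        by (simp add: pd_const)
      show ?thesis
        using pd_cong[OF Y E pf] pd_mult[OF E Y regular.const regular_pd[OF assms(1) E]]
        by (simp add: pd_const)
    qed
    have "box31 f Y = c * box31 g Y"
      by (simp add: box31_def pp basis_Mink algebra_simps)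
    then show ?thesis using assms(3)[OF Y] by simp
  qed
  ultimately show ?thesis unfolding solves_wave_on_def using regular_Ck by blast
qed

lemma degt_scaled:
  assumes "\<And>Y. Y \<in> Mplus \<Longrightarrow> f Y = c * separated e q p \<sigma> k Y" "e = - 1 - j - int k" "Y \<in> Mplus"
  shows "degt f Y = - of_int j * f Y"
proof -
  have pf: "pd E f Y = c * pd E (separated e q p \<sigma> k) Y" if E: "E \<in> Mink" for E
    using pd_cong[OF assms(3) E assms(1)] pd_mult[OF E assms(3) regular.const regular_separated, of c]
    by (simp add: pd_const)
  have "degt f Y = c * degt (separated e q p \<sigma> k) Y"
    by (simp add: degt_def pf basis_Mink assms(1,3) algebra_simps)
  then show ?thesis by (simp add: degt_separated[OF assms(3,2)] assms(1,3))
qed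

context
  fixes l n :: nat and m :: int
  assumes lm: "- int l \<le> m" "m \<le> int l" and nl: "n \<le> l"
begin

lemma f_minus_solves: "solves_wave_on Mplus (f_minus l m n)"
proof (rule solves_wave_on_scaled[OF regular_separated f_minus_separated[OF lm nl]])
  fix Y assume "Y \<in> Mplus"
  then show "box31 (separated (- 1 - int n - int (nat \<bar>m\<bar>)) (leg l n) (leg l (nat \<bar>m\<bar>)) (sgn_dir m) (nat \<bar>m\<bar>)) Y = 0"
    by (rule box31_separated[where j = "int n" and l = l]) (simp_all add: leg_ode_pderiv sgn_dir_def)
qed assumption

lemma f_plus_solves: "solves_wave_on Mplus (f_plus l m n)"
proof (rule solves_wave_on_scaled[OF regular_separated f_plus_separated[OF lm nl]])
  fix Y assume "Y \<in> Mplus"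
  then show "box31 (separated (- 1 + int n - int (nat \<bar>m\<bar>)) (rodrigues l (l - n)) (leg l (nat \<bar>m\<bar>)) (sgn_dir m) (nat \<bar>m\<bar>)) Y = 0"
  proof (rule box31_separated[where j = "- int n" and l = l])
    fix x
    show "(1 - x\<^sup>2) * poly (pderiv (pderiv (rodrigues l (l - n)))) x = 2 * (of_int (- int n) + 1) * x * poly (pderiv (rodrigues l (l - n))) x
      - (real l - of_int (- int n)) * (real l + of_int (- int n) + 1) * poly (rodrigues l (l - n)) x"
      using rodrigues_ode[of x l "l - n"] nl by (simp add: pderiv_rodrigues of_nat_diff algebra_simps)
  qed (simp_all add: leg_ode_pderiv sgn_dir_def)
qed assumption

lemma degt_f_minus: "Y \<in> Mplus \<Longrightarrow> degt (f_minus l m n) Y = - of_nat n * f_minus l m n Y"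
  using degt_scaled[OF f_minus_separated[OF lm nl], where j = "int n"] by simp

lemma degt_f_plus: "Y \<in> Mplus \<Longrightarrow> degt (f_plus l m n) Y = of_nat n * f_plus l m n Y"
  using degt_scaled[OF f_plus_separated[OF lm nl], where j = "- int n"] by simp

end

lemma regular_f_minus:
  assumes "- int l \<le> m" "m \<le> int l" "n \<le> l"
  shows "regular (f_minus l m n)"
  by (rule regular.cong[OF regular.mult[OF regular.const regular_separated] f_minus_separated[OF assms]])

section \<open>Homogeneity, parity and the involutions\<close>

lemma rad_scaleR: "rad (s *\<^sub>R Y) = \<bar>s\<bar> * rad Y"
proof -
  have "(s * x1 Y)\<^sup>2 + (s * x2 Y)\<^sup>2 + (s * x3 Y)\<^sup>2 = s\<^sup>2 * ((x1 Y)\<^sup>2 + (x2 Y)\<^sup>2 + (x3 Y)\<^sup>2)"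
    by (simp add: algebra_simps power_mult_distrib)
  then show ?thesis by (simp add: rad_def real_sqrt_mult)
qed

lemma Mplus_scaleR: "Y \<in> Mplus \<Longrightarrow> s \<noteq> 0 \<Longrightarrow> s *\<^sub>R Y \<in> Mplus"
  by (simp add: Mplus_iff Mink_scaleR rad_scaleR power_mult_distrib)

lemma N_scaleR: "Y \<in> Mplus \<Longrightarrow> s \<noteq> 0 \<Longrightarrow> N (s *\<^sub>R Y) = s\<^sup>2 * N Y"
  by (simp add: Mplus_def N_eq Mink_scaleR rad_scaleR power_mult_distrib right_diff_distrib)

lemma zcoord_scaleR: "zcoord \<sigma> (s *\<^sub>R Y) = of_real s * zcoord \<sigma> Y"
  by (simp add: zcoord_def algebra_simps)

lemma f_minus_homogeneous:
  assumes "- int l \<le> m" "m \<le> int l" "n \<le> l" "Y \<in> Mplus" "s > 0"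
  shows "f_minus l m n (s *\<^sub>R Y) = of_real (s powi (- 1 - int n)) * f_minus l m n Y"
proof -
  have r: "rad Y > 0" using assms(4) by (rule rad_pos)
  let ?k = "nat \<bar>m\<bar>"
  have "ratio_t (s *\<^sub>R Y) = ratio_t Y" "ratio_3 (s *\<^sub>R Y) = ratio_3 Y"
    using assms(5) r by (simp_all add: ratio_t_def ratio_3_def rad_scaleR field_simps)
  moreover have "(s * rad Y) powi (- 1 - int n - int ?k) * s ^ ?k = s powi (- 1 - int n) * rad Y powi (- 1 - int n - int ?k)"
  proof -
    have "(s * rad Y) powi (- 1 - int n - int k) * s ^ k = s powi (- 1 - int n) * rad Y powi (- 1 - int n - int k)" for k
      using assms(5) r by (simp add: power_int_mult_distrib power_int_diff)
    then show ?thesis .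
  qed
  from arg_cong[OF this, of complex_of_real]
  have "complex_of_real ((s * rad Y) powi (- 1 - int n - int ?k)) * of_real s ^ ?k = of_real (s powi (- 1 - int n)) * of_real (rad Y powi (- 1 - int n - int ?k))"
    by simp
  ultimately show ?thesis
    using assms by (simp add: f_minus_separated Mplus_scaleR separated_def rad_scaleR zcoord_scaleR power_mult_distrib mult_ac)
qed

text \<open>The reflection of space; it is the adjugate matrix on \<open>Mink\<close> (see \<open>matrix_inv_Mplus\<close>).\<close>

definition reflect :: "cmat \<Rightarrow> cmat" where
  "reflect Y = mink (tc Y) (- x1 Y) (- x2 Y) (- x3 Y)"

lemma reflect_simps [simp]:
  "tc (reflect Y) = tc Y" "x1 (reflect Y) = - x1 Y" "x2 (reflect Y) = - x2 Y" "x3 (reflect Y) = - x3 Y"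
  "rad (reflect Y) = rad Y"
  by (simp_all add: reflect_def rad_def)

lemma reflect_Mplus: "Y \<in> Mplus \<Longrightarrow> reflect Y \<in> Mplus"
  unfolding Mplus_iff by (simp add: Mink_def) (auto simp: reflect_def)

text \<open>The polynomial in \<open>x3 / r\<close> has the parity of \<open>l + \<bar>m\<bar>\<close> and \<open>zcoord ^ \<bar>m\<bar>\<close> has the parity of \<open>\<bar>m\<bar>\<close>.\<close>

lemma f_minus_reflect:
  assumes "- int l \<le> m" "m \<le> int l" "n \<le> l" "Y \<in> Mplus"
  shows "f_minus l m n (reflect Y) = (-1) ^ l * f_minus l m n Y"
proof -
  let ?k = "nat \<bar>m\<bar>"
  have "ratio_t (reflect Y) = ratio_t Y" "ratio_3 (reflect Y) = - ratio_3 Y"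
    by (simp_all add: ratio_t_def ratio_3_def)
  moreover have "zcoord \<sigma> (reflect Y) = - zcoord \<sigma> Y" for \<sigma> by (simp add: zcoord_def)
  then have "zcoord \<sigma> (reflect Y) ^ ?k = (-1) ^ ?k * zcoord \<sigma> Y ^ ?k" for \<sigma>
    by (metis power_minus)
  moreover have "poly (leg l ?k) (- ratio_3 Y) = (-1) ^ l * (-1) ^ ?k * poly (leg l ?k) (ratio_3 Y)"
    by (simp add: leg_def rodrigues_parity power_add)
  moreover have "(-1) ^ ?k * (-1) ^ ?k = (1::complex)" by (simp flip: power_mult_distrib)
  ultimately show ?thesis
    using assms by (simp add: f_minus_separated reflect_Mplus separated_def mult_ac)
qed

lemma matrix_inv_Mplus:
  assumes "Y \<in> Mplus"
  shows "matrix_inv Y = inverse (N Y) *\<^sub>R reflect Y"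
proof -
  have Y: "Y \<in> Mink" and NY: "N Y > 0" using assms by (simp_all add: Mplus_def)
  then obtain t a b c where Yc: "Y = mink t a b c" by (auto simp: Mink_def)
  have Nc: "N Y = a\<^sup>2 + b\<^sup>2 + c\<^sup>2 - t\<^sup>2"
    by (simp add: N_def Yc det_mink del: of_real_add of_real_diff of_real_power)
  have mult_scale: "A ** (s *\<^sub>R B) = s *\<^sub>R (A ** B)" for A B :: cmat and s
    by (simp add: matrix_matrix_mult_def vec_eq_iff scaleR_sum_right)
  have "Y ** (inverse (N Y) *\<^sub>R reflect Y) = mat 1"
  proof -
    have refl: "reflect Y = mink t (- a) (- b) (- c)" by (simp add: reflect_def Yc)
    have "Y ** reflect Y = (\<chi> i j. if i = j then of_real (N Y) else 0)"
      unfolding Nc refl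
      by (simp add: Yc mink_def matrix_matrix_mult_def vec_eq_iff forall_2 UNIV_2 complex_eq_iff
          power2_eq_square algebra_simps)
    then have "Y ** (inverse (N Y) *\<^sub>R reflect Y) = inverse (N Y) *\<^sub>R (\<chi> i j. if i = j then of_real (N Y) else 0)"
      by (metis mult_scale)
    also have "\<dots> = mat 1"
      using NY by (simp add: vec_eq_iff mat_def forall_2) (simp add: scaleR_conv_of_real flip: of_real_mult)
    finally show ?thesis .
  qed
  moreover from this have "(inverse (N Y) *\<^sub>R reflect Y) ** Y = mat 1"
    by (metis matrix_left_right_inverse)
  ultimately show ?thesis unfolding matrix_inv_def
    by (intro some_equality) (auto, metis matrix_mul_assoc matrix_mul_lid matrix_mul_rid)
qed

lemma involutions:
  assumes "- int l \<le> m" "m \<le> int l" "n \<le> l" "Y \<in> Mplus"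
  shows "invol1 (f_plus l m n) Y = f_minus l m n Y" "invol1 (f_minus l m n) Y = f_plus l m n Y"
    "invol2 l (f_plus l m n) Y = f_minus l m n Y" "invol2 l (f_minus l m n) Y = f_plus l m n Y"
proof -
  have NY: "N Y > 0" using assms(4) by (simp add: Mplus_def)
  have s: "inverse (N Y) > 0" using NY by simp
  have NR: "N (reflect Y) = N Y"
    using assms(4) reflect_Mplus[OF assms(4)] by (simp add: N_eq Mplus_def)
  have hom: "f_minus l m n (inverse (N Y) *\<^sub>R Z) = of_real (N Y * N Y ^ n) * f_minus l m n Z"
    if "Z \<in> Mplus" for Z
  proof -
    have "inverse (N Y) powi (- 1 - int n) = N Y * N Y ^ n"
      using NY by (simp add: power_int_diff power_int_minus power_inverse field_simps)
    then show ?thesis using f_minus_homogeneous[OF assms(1-3) that s] by simp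
  qed
  have homp: "f_plus l m n (inverse (N Y) *\<^sub>R Z) = of_real (N Y) * f_minus l m n Z"
    if "Z \<in> Mplus" "N Z = N Y" for Z
  proof -
    have "N (inverse (N Y) *\<^sub>R Z) = inverse (N Y)"
      using N_scaleR[OF that(1), of "inverse (N Y)"] NY that by (simp add: power2_eq_square)
    then show ?thesis
      using NY s that by (simp add: f_plus_eq Mplus_scaleR hom power_inverse)
  qed
  show "invol1 (f_plus l m n) Y = f_minus l m n Y" "invol1 (f_minus l m n) Y = f_plus l m n Y"
    using NY homp[OF assms(4)] hom[OF assms(4)] by (simp_all add: invol1_def f_plus_eq[OF assms(4)])
  have "(-1) ^ l * (-1) ^ l = (1::complex)" by (simp flip: power_mult_distrib)
  then show "invol2 l (f_plus l m n) Y = f_minus l m n Y" "invol2 l (f_minus l m n) Y = f_plus l m n Y"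
    using NY homp[OF reflect_Mplus[OF assms(4)] NR] hom[OF reflect_Mplus[OF assms(4)]]
    by (simp_all add: invol2_def matrix_inv_Mplus[OF assms(4)] f_plus_eq[OF assms(4)] f_minus_reflect[OF assms])
qed

section \<open>Integrals over one coordinate\<close>

text \<open>Integrability has to be known beforehand: a primitive with limits gives a convergent improper
integral only.\<close>

lemma integral_FTC_UNIV:
  fixes f F :: "real \<Rightarrow> real"
  assumes F: "\<And>x. (F has_real_derivative f x) (at x)" and f: "\<And>x. isCont f x"
    and int: "integrable lborel f"
    and A: "(F \<longlongrightarrow> A) at_bot" and B: "(F \<longlongrightarrow> B) at_top"
  shows "has_bochner_integral lborel f (B - A)"
proof -
  have "(LBINT x=-\<infinity>..\<infinity>. f x) = B - A"
  proof (rule interval_integral_FTC_integrable)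
    show "set_integrable lborel (einterval (- \<infinity>) \<infinity>) f"
      using int by (simp add: set_integrable_def)
    show "((F \<circ> real_of_ereal) \<longlongrightarrow> A) (at_right (- \<infinity>))" "((F \<circ> real_of_ereal) \<longlongrightarrow> B) (at_left \<infinity>)"
      using A B by (simp_all add: ereal_tendsto_simps)
  qed (use F f in \<open>simp_all add: has_real_derivative_iff_has_vector_derivative\<close>)
  then show ?thesis using int
    by (simp add: has_bochner_integral_iff interval_lebesgue_integral_def set_lebesgue_integral_def)
qed

lemma integrable_FTC_UNIV:
  fixes f F :: "real \<Rightarrow> real"
  assumes F: "\<And>x. (F has_real_derivative f x) (at x)" and f: "\<And>x. isCont f x"
    and nn: "\<And>x. f x \<ge> 0"
    and A: "(F \<longlongrightarrow> A) at_bot" and B: "(F \<longlongrightarrow> B) at_top"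
  shows "integrable lborel f"
proof -
  have "set_integrable lborel (einterval (- \<infinity>) \<infinity>) f"
  proof (rule interval_integral_FTC_nonneg)
    show "((F \<circ> real_of_ereal) \<longlongrightarrow> A) (at_right (- \<infinity>))" "((F \<circ> real_of_ereal) \<longlongrightarrow> B) (at_left \<infinity>)"
      using A B by (simp_all add: ereal_tendsto_simps)
  qed (use F f nn in simp_all)
  then show ?thesis by (simp add: set_integrable_def)
qed

lemma integrable_sech: "integrable lborel (\<lambda>\<eta>::real. inverse (cosh \<eta>))"
proof (rule integrable_FTC_UNIV[where F = "\<lambda>\<eta>. arctan (sinh \<eta>)"])
  fix \<eta> :: real
  have "1 + (sinh \<eta>)\<^sup>2 = (cosh \<eta>)\<^sup>2" by (simp add: cosh_square_eq)
  then show "((\<lambda>\<eta>. arctan (sinh \<eta>)) has_real_derivative inverse (cosh \<eta>)) (at \<eta>)"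
    by (auto intro!: derivative_eq_intros simp: power2_eq_square field_simps)
  show "isCont (\<lambda>\<eta>. inverse (cosh \<eta>)) \<eta>" by (auto intro!: continuous_intros)
  show "((\<lambda>\<eta>::real. arctan (sinh \<eta>)) \<longlongrightarrow> - (pi / 2)) at_bot"
    by (rule filterlim_compose[OF tendsto_arctan_at_bot sinh_real_at_bot])
  show "((\<lambda>\<eta>::real. arctan (sinh \<eta>)) \<longlongrightarrow> pi / 2) at_top"
    by (rule filterlim_compose[OF tendsto_arctan_at_top sinh_real_at_top])
qed simp

lemma poly_tanh_bounded: "\<exists>M::real. \<forall>\<eta>. \<bar>poly p (tanh \<eta>)\<bar> \<le> M"
proof -
  have "compact (poly p ` {-1..1::real})"
    by (intro compact_continuous_image continuous_intros) simp
  then obtain M where "\<And>x. x \<in> {-1..1} \<Longrightarrow> \<bar>poly p x\<bar> \<le> M"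
    unfolding bounded_iff by (metis compact_imp_bounded bounded_iff imageI real_norm_def)
  moreover have "tanh \<eta> \<in> {-1..1}" for \<eta> :: real
    using tanh_real_bounds[of \<eta>] by auto
  ultimately show ?thesis by blast
qed

lemma tanh_sech: "1 - (tanh \<eta>)\<^sup>2 = (inverse (cosh (\<eta>::real)))\<^sup>2"
proof -
  have "1 - (s / c)\<^sup>2 = (inverse c)\<^sup>2" if "c\<^sup>2 = s\<^sup>2 + 1" "c \<noteq> 0" for s c :: real
  proof -
    have "s\<^sup>2 = c\<^sup>2 - 1" using that by simp
    then show ?thesis using that(2)
      by (simp only: power_divide power_inverse) (simp add: diff_divide_distrib inverse_eq_divide)
  qed
  from this[OF cosh_square_eq] show ?thesis by (simp add: tanh_def)
qed

lemma DERIV_tanh_real: "(tanh has_real_derivative 1 - (tanh \<eta>)\<^sup>2) (at \<eta>)"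
  by (auto intro!: derivative_eq_intros)

lemma isCont_sech_poly: "isCont (\<lambda>\<eta>::real. inverse (cosh \<eta>) ^ k * poly p (tanh \<eta>)) \<eta>"
  by (intro continuous_intros isCont_tanh continuous_ident) simp_all

text \<open>Since \<open>tanh\<close> is bounded by 1, the polynomial is bounded and the function is dominated by a multiple
of \<open>1 / cosh\<close>, whose primitive \<open>arctan \<circ> sinh\<close> is bounded.\<close>

lemma integrable_sech_poly:
  fixes p :: "real poly"
  assumes "k \<ge> 1"
  shows "integrable lborel (\<lambda>\<eta>. inverse (cosh \<eta>) ^ k * poly p (tanh \<eta>))"
proof -
  obtain M where M: "\<And>\<eta>. \<bar>poly p (tanh \<eta>)\<bar> \<le> M" using poly_tanh_bounded[of p] by blast
  show ?thesis
  proof (rule Bochner_Integration.integrable_bound)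
    show "integrable lborel (\<lambda>\<eta>. M * inverse (cosh \<eta>))" by (intro integrable_mult_right integrable_sech)
    show "(\<lambda>\<eta>. inverse (cosh \<eta>) ^ k * poly p (tanh \<eta>)) \<in> borel_measurable lborel"
      by (simp, intro borel_measurable_continuous_onI continuous_at_imp_continuous_on ballI isCont_sech_poly)
    show "AE \<eta> in lborel. norm (inverse (cosh \<eta>) ^ k * poly p (tanh \<eta>)) \<le> norm (M * inverse (cosh \<eta>))"
    proof (rule AE_I2)
      fix \<eta> :: real
      have c: "0 < inverse (cosh \<eta>)" "inverse (cosh \<eta>) \<le> 1"
        by (simp_all add: cosh_real_ge_1 inverse_le_1_iff)
      have "inverse (cosh \<eta>) ^ k \<le> inverse (cosh \<eta>)"
        using power_decreasing[OF assms, of "inverse (cosh \<eta>)"] c by simp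
      then have "inverse (cosh \<eta>) ^ k * \<bar>poly p (tanh \<eta>)\<bar> \<le> inverse (cosh \<eta>) * M"
        using M[of \<eta>] c by (intro mult_mono) simp_all
      moreover have "M \<ge> 0" using M[of \<eta>] by linarith
      ultimately show "norm (inverse (cosh \<eta>) ^ k * poly p (tanh \<eta>)) \<le> norm (M * inverse (cosh \<eta>))"
        by (simp add: abs_mult mult.commute power_abs)
    qed
  qed
qed

text \<open>The substitution \<open>x = tanh \<eta>\<close>, for which \<open>dx = d\<eta> / cosh\<^sup>2 \<eta>\<close>.\<close>

lemma integral_sech_poly:
  "has_bochner_integral lborel (\<lambda>\<eta>. inverse (cosh \<eta>) ^ 2 * poly p (tanh \<eta>)) (polyint p)"
  unfolding polyint_def
proof (rule integral_FTC_UNIV[where F = "\<lambda>\<eta>. poly (antideriv p) (tanh \<eta>)"])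
  fix \<eta> :: real
  have "((\<lambda>\<eta>. poly (antideriv p) (tanh \<eta>)) has_real_derivative poly (pderiv (antideriv p)) (tanh \<eta>) * (1 - (tanh \<eta>)\<^sup>2)) (at \<eta>)"
    by (rule DERIV_chain2[OF poly_DERIV DERIV_tanh_real])
  then show "((\<lambda>\<eta>. poly (antideriv p) (tanh \<eta>)) has_real_derivative inverse (cosh \<eta>) ^ 2 * poly p (tanh \<eta>)) (at \<eta>)"
    by (simp add: pderiv_antideriv tanh_sech mult.commute)
next
  show "((\<lambda>\<eta>. poly (antideriv p) (tanh \<eta>)) \<longlongrightarrow> poly (antideriv p) (- 1)) at_bot"
    by (intro tendsto_poly tanh_real_at_bot)
  show "((\<lambda>\<eta>. poly (antideriv p) (tanh \<eta>)) \<longlongrightarrow> poly (antideriv p) 1) at_top"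
    by (intro tendsto_poly tanh_real_at_top)
qed (rule isCont_sech_poly integrable_sech_poly one_le_numeral)+

text \<open>With \<open>f\<^sub>n = sech ^ n * leg l n (tanh)\<close> the differential equation becomes
\<open>f\<^sub>n'' = (n\<^sup>2 - l (l + 1) sech\<^sup>2) f\<^sub>n\<close>. So the Wronskian \<open>f\<^sub>n' f\<^sub>k - f\<^sub>n f\<^sub>k'\<close> is a primitive of \<open>(n\<^sup>2 - k\<^sup>2) f\<^sub>n f\<^sub>k\<close>,
and it tends to 0 at both ends, because at most one of \<open>n\<close>, \<open>k\<close> is 0.\<close>

lemma radial_orthogonal:
  fixes n k l :: nat
  assumes "n \<noteq> k"
  shows "has_bochner_integral lborel
    (\<lambda>\<eta>. inverse (cosh \<eta>) ^ (n + k) * poly (leg l n * leg l k) (tanh \<eta>)) 0"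
proof -
  define c :: "real \<Rightarrow> real" where "c \<eta> = inverse (cosh \<eta>)" for \<eta>
  \<comment> \<open>The Wronskian of \<open>f\<^sub>n\<close> and \<open>f\<^sub>k\<close>, with the derivatives carried out.\<close>
  define W where "W \<eta> = c \<eta> ^ (n + k) * poly (smult (real k - real n) ([:0, 1:] * leg l n * leg l k)
      + wpoly * (leg l (Suc n) * leg l k - leg l n * leg l (Suc k))) (tanh \<eta>)" for \<eta>
  have "has_bochner_integral lborel (\<lambda>\<eta>. ((real n)\<^sup>2 - (real k)\<^sup>2) *
      (c \<eta> ^ (n + k) * poly (leg l n * leg l k) (tanh \<eta>))) (0 - 0)"
  proof (rule integral_FTC_UNIV[where F = W])
    fix \<eta> :: real
    define x where "x = tanh \<eta>"
    have dc: "(c has_real_derivative - x * c \<eta>) (at \<eta>)"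
      unfolding c_def[abs_def] x_def by (auto intro!: derivative_eq_intros simp: tanh_def field_simps)
    have dp: "((\<lambda>\<eta>. poly p (tanh \<eta>)) has_real_derivative poly (pderiv p) x * (1 - x\<^sup>2)) (at \<eta>)" for p
      unfolding x_def by (rule DERIV_chain2[OF poly_DERIV DERIV_tanh_real])
    have dcp: "((\<lambda>\<eta>. c \<eta> ^ j) has_real_derivative - real j * x * c \<eta> ^ j) (at \<eta>)" for j
    proof (cases j)
      case (Suc i)
      show ?thesis by (rule DERIV_cong[OF DERIV_power[OF dc]]) (simp add: Suc algebra_simps)
    qed simp
    define w y z y1 z1 y2 z2 where "w = 1 - x\<^sup>2"
      and "y = poly (leg l n) x" and "z = poly (leg l k) x"
      and "y1 = poly (leg l (Suc n)) x" and "z1 = poly (leg l (Suc k)) x"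
      and "y2 = poly (leg l (Suc (Suc n))) x" and "z2 = poly (leg l (Suc (Suc k))) x"
    have ody: "w * y2 = 2 * (real n + 1) * x * y1 - (real l - real n) * (real l + real n + 1) * y"
      unfolding w_def y_def y1_def y2_def by (rule leg_ode)
    have odz: "w * z2 = 2 * (real k + 1) * x * z1 - (real l - real k) * (real l + real k + 1) * z"
      unfolding w_def z_def z1_def z2_def by (rule leg_ode)
    have pw: "poly wpoly x = w" "poly (pderiv wpoly) x = - 2 * x"
      by (simp_all add: w_def wpoly_def power2_eq_square pderiv_pCons)
    have "(W has_real_derivative
      (c \<eta> ^ (n + k) * (poly (pderiv (smult (real k - real n) ([:0, 1:] * leg l n * leg l k)
      + wpoly * (leg l (Suc n) * leg l k - leg l n * leg l (Suc k)))) x * w)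
       + (- real (n + k) * x * c \<eta> ^ (n + k)) * poly (smult (real k - real n) ([:0, 1:] * leg l n * leg l k)
      + wpoly * (leg l (Suc n) * leg l k - leg l n * leg l (Suc k))) x)) (at \<eta>)"
      unfolding W_def[abs_def] w_def
      by (rule DERIV_cong[OF DERIV_mult[OF dcp dp]], unfold x_def) (simp only: ac_simps)
    also have "poly (pderiv (smult (real k - real n) ([:0, 1:] * leg l n * leg l k)
      + wpoly * (leg l (Suc n) * leg l k - leg l n * leg l (Suc k)))) x =
      (real k - real n) * (y * z + x * y1 * z + x * y * z1) - 2 * x * (y1 * z - y * z1)
      + (w * y2 * z - y * (w * z2))"
      by (simp add: pderiv_mult pderiv_add pderiv_diff pderiv_smult pderiv_leg pderiv_pCons pw
          y_def z_def y1_def z1_def y2_def z2_def algebra_simps)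
    also have "poly (smult (real k - real n) ([:0, 1:] * leg l n * leg l k)
      + wpoly * (leg l (Suc n) * leg l k - leg l n * leg l (Suc k))) x =
      (real k - real n) * (x * y * z) + w * (y1 * z - y * z1)"
      by (simp add: pw y_def z_def y1_def z1_def)
    also have "c \<eta> ^ (n + k) * (((real k - real n) * (y * z + x * y1 * z + x * y * z1) - 2 * x * (y1 * z - y * z1)
      + (w * y2 * z - y * (w * z2))) * w) + (- real (n + k) * x * c \<eta> ^ (n + k)) *
        ((real k - real n) * (x * y * z) + w * (y1 * z - y * z1))
      = ((real n)\<^sup>2 - (real k)\<^sup>2) * (x\<^sup>2 + w) * (c \<eta> ^ (n + k) * (y * z))"
      unfolding ody odz by (simp add: algebra_simps power2_eq_square)
    finally show "(W has_real_derivative ((real n)\<^sup>2 - (real k)\<^sup>2) *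
      (c \<eta> ^ (n + k) * poly (leg l n * leg l k) (tanh \<eta>))) (at \<eta>)"
      by (simp add: w_def y_def z_def x_def)
  next
    fix \<eta> :: real
    show "isCont (\<lambda>\<eta>. ((real n)\<^sup>2 - (real k)\<^sup>2) * (c \<eta> ^ (n + k) * poly (leg l n * leg l k) (tanh \<eta>))) \<eta>"
      unfolding c_def by (intro continuous_mult continuous_const isCont_sech_poly)
  next
    show "integrable lborel (\<lambda>\<eta>. ((real n)\<^sup>2 - (real k)\<^sup>2) * (c \<eta> ^ (n + k) * poly (leg l n * leg l k) (tanh \<eta>)))"
      unfolding c_def by (intro integrable_mult_right integrable_sech_poly) (use assms in linarith)
  next
    have nk: "n + k > 0" using assms by linarith
    have c0: "(c \<longlongrightarrow> 0) at_bot" "(c \<longlongrightarrow> 0) at_top"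
      unfolding c_def[abs_def]
      by (auto intro!: tendsto_inverse_0_at_top cosh_real_at_bot cosh_real_at_top)
    have "((\<lambda>\<eta>. c \<eta> ^ (n + k) * poly p (tanh \<eta>)) \<longlongrightarrow> 0 ^ (n + k) * poly p (- 1)) at_bot" for p
      by (intro tendsto_mult tendsto_power c0 tendsto_poly tanh_real_at_bot)
    then show "(W \<longlongrightarrow> 0) at_bot" unfolding W_def[abs_def] by (simp only: zero_power[OF nk] mult_zero_left)
    have "((\<lambda>\<eta>. c \<eta> ^ (n + k) * poly p (tanh \<eta>)) \<longlongrightarrow> 0 ^ (n + k) * poly p 1) at_top" for p
      by (intro tendsto_mult tendsto_power c0 tendsto_poly tanh_real_at_top)
    then show "(W \<longlongrightarrow> 0) at_top" unfolding W_def[abs_def] by (simp only: zero_power[OF nk] mult_zero_left)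
  qed
  moreover have nz: "(real n)\<^sup>2 - (real k)\<^sup>2 \<noteq> 0" using assms by simp
  ultimately have "has_bochner_integral lborel (\<lambda>\<eta>. inverse ((real n)\<^sup>2 - (real k)\<^sup>2) * (((real n)\<^sup>2 - (real k)\<^sup>2) *
      (c \<eta> ^ (n + k) * poly (leg l n * leg l k) (tanh \<eta>)))) (inverse ((real n)\<^sup>2 - (real k)\<^sup>2) * (0 - 0))"
    by (intro has_bochner_integral_mult_right)
  then show ?thesis using nz by (simp add: c_def flip: mult.assoc)
qed

lemma has_bochner_integral_FTC_Ioo:
  fixes f F :: "real \<Rightarrow> 'a::euclidean_space"
  assumes "a \<le> b" "\<And>x. (F has_vector_derivative f x) (at x)" "continuous_on {a..b} f"
  shows "has_bochner_integral lborel (\<lambda>x. indicator {a<..<b} x *\<^sub>R f x) (F b - F a)"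
proof -
  have "has_bochner_integral lborel (\<lambda>x. indicator {a..b} x *\<^sub>R f x) (F b - F a)"
    using assms by (intro has_bochner_integral_FTC_Icc) (auto intro: has_vector_derivative_at_within)
  moreover have "AE x in lborel. indicator {a..b} x *\<^sub>R f x = indicator {a<..<b} x *\<^sub>R f x"
    using AE_lborel_singleton[of a] AE_lborel_singleton[of b]
    by eventually_elim (auto simp: indicator_def)
  moreover have "(\<lambda>x. indicator {a<..<b} x *\<^sub>R f x) \<in> borel_measurable lborel"
  proof -
    have "continuous_on {a<..<b} f" by (rule continuous_on_subset[OF assms(3)]) auto
    then show ?thesis using borel_measurable_continuous_on_indicator[of "{a<..<b}" f] by simp
  qed
  ultimately show ?thesis
    by (subst has_bochner_integral_cong_AE[symmetric]) (auto dest: has_bochner_integral_integrable borel_measurable_has_bochner_integral)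
qed

lemma integral_cos_poly:
  "has_bochner_integral lborel (\<lambda>\<theta>. indicator {0<..<pi} \<theta> *\<^sub>R (poly p (cos \<theta>) * sin \<theta>)) (polyint p)"
proof -
  have "has_bochner_integral lborel (\<lambda>\<theta>. indicator {0<..<pi} \<theta> *\<^sub>R (poly p (cos \<theta>) * sin \<theta>))
     (- poly (antideriv p) (cos pi) - (- poly (antideriv p) (cos 0)))"
  proof (rule has_bochner_integral_FTC_Ioo)
    fix \<theta> :: real
    have "((\<lambda>\<theta>. - poly (antideriv p) (cos \<theta>)) has_real_derivative - (poly (pderiv (antideriv p)) (cos \<theta>) * (- sin \<theta>))) (at \<theta>)"
      by (intro DERIV_minus DERIV_chain2[OF poly_DERIV] DERIV_cos)
    then show "((\<lambda>\<theta>. - poly (antideriv p) (cos \<theta>)) has_vector_derivative poly p (cos \<theta>) * sin \<theta>) (at \<theta>)"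
      by (simp add: pderiv_antideriv has_real_derivative_iff_has_vector_derivative)
  qed (auto intro!: continuous_intros)
  then show ?thesis by (simp add: polyint_def)
qed

lemma integrable_Ioo_continuous:
  fixes f :: "real \<Rightarrow> 'a::euclidean_space"
  assumes "continuous_on UNIV f"
  shows "integrable lborel (\<lambda>x. indicator {a<..<b} x *\<^sub>R f x)"
proof -
  have "set_integrable lborel {a..b} f"
    by (intro borel_integrable_atLeastAtMost' continuous_on_subset[OF assms]) simp
  then have "set_integrable lborel {a<..<b} f"
    by (rule set_integrable_subset) auto
  then show ?thesis by (simp add: set_integrable_def)
qed

lemma integral_exp:
  "has_bochner_integral lborel (\<lambda>\<phi>. indicator {- pi<..<pi} \<phi> *\<^sub>R exp (\<i> * of_int m * of_real \<phi>))
     (if m = 0 then 2 * of_real pi else 0)"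
proof (cases "m = 0")
  case True
  have "has_bochner_integral lborel (\<lambda>\<phi>. indicator {- pi<..<pi} \<phi> *\<^sub>R (1::complex)) (of_real pi - of_real (- pi))"
    by (intro has_bochner_integral_FTC_Ioo)
       (auto intro!: derivative_eq_intros has_vector_derivative_real_field)
  then show ?thesis using True by simp
next
  case False
  define c where "c = \<i> * complex_of_int m"
  have c: "c \<noteq> 0" using False by (simp add: c_def)
  have "has_bochner_integral lborel (\<lambda>\<phi>. indicator {- pi<..<pi} \<phi> *\<^sub>R exp (c * of_real \<phi>))
      (exp (c * of_real pi) / c - exp (c * of_real (- pi)) / c)"
  proof (rule has_bochner_integral_FTC_Ioo)
    fix \<phi> :: real
    have "((\<lambda>z. exp (c * z) / c) has_field_derivative exp (c * of_real \<phi>)) (at (of_real \<phi>))"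
      using c by (auto intro!: derivative_eq_intros)
    then show "((\<lambda>\<phi>. exp (c * of_real \<phi>) / c) has_vector_derivative exp (c * of_real \<phi>)) (at \<phi>)"
      by (rule has_vector_derivative_real_field)
  qed (auto intro!: continuous_intros)
  moreover have "exp (c * of_real pi) = exp (c * of_real (- pi))"
  proof -
    have "c * of_real pi = c * of_real (- pi) + (2 * of_int m * pi) * \<i>" by (simp add: c_def)
    then show ?thesis by (metis exp_eq of_int_mult of_int_numeral)
  qed
  ultimately show ?thesis using False by (simp add: c_def)
qed

section \<open>Integration over the hyperboloid\<close>

text \<open>Fubini's theorem for a product of three functions of one coordinate each, through the description of
Lebesgue measure as a product measure indexed by the basis vectors.\<close>

lemma integral_product_3:
  fixes A B C :: "real \<Rightarrow> complex"
  assumes A: "has_bochner_integral lborel A a" and B: "has_bochner_integral lborel B b"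
    and C: "has_bochner_integral lborel C c"
  shows "has_bochner_integral lborel (\<lambda>u::real^3. A (u$1) * B (u$2) * C (u$3)) (a * b * c)"
proof -
  interpret product_sigma_finite "\<lambda>_::real^3. lborel :: real measure" by standard
  define f where "f v = (if v = axis 1 1 then A else if v = axis 2 1 then B else C)" for v :: "real^3"
  have Bas: "(Basis :: (real^3) set) = {axis 1 1, axis 2 1, axis 3 1}"
    unfolding Basis_vec_def by (auto simp: UNIV_3)
  have ne: "axis 1 (1::real) \<noteq> (axis 2 1 :: real^3)" "axis 1 (1::real) \<noteq> (axis 3 1 :: real^3)"
    "axis 2 (1::real) \<noteq> (axis 3 1 :: real^3)"
    by (simp_all add: axis_eq_axis)
  have int: "integrable lborel (f v)" for v
    using A B C by (auto simp: f_def dest: has_bochner_integral_integrable has_bochner_integral_iff[THEN iffD1])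
  have pr: "(\<Prod>v\<in>Basis. f v (x v)) = A (x (axis 1 1)) * B (x (axis 2 1)) * C (x (axis 3 1))" for x
    unfolding Bas using ne by (simp add: f_def mult.assoc)
  have nth: "(\<Sum>v\<in>Basis. x v *\<^sub>R v) $ i = x (axis i 1)" for x :: "real^3 \<Rightarrow> real" and i
  proof -
    have "(\<Sum>v\<in>Basis. x v *\<^sub>R v) $ i = (\<Sum>v\<in>Basis. x v *\<^sub>R v) \<bullet> axis i 1" by (simp add: inner_axis)
    also have "\<dots> = x (axis i 1)" by (rule inner_sum_left_Basis) (simp add: axis_in_Basis_iff)
    finally show ?thesis .
  qed
  have meas: "(\<lambda>u::real^3. A (u$1) * B (u$2) * C (u$3)) \<in> borel_measurable borel"
  proof -
    have n: "(\<lambda>u::real^3. u $ i) \<in> borel_measurable borel" for i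
      by (intro borel_measurable_continuous_onI continuous_intros)
    have "A \<in> borel_measurable borel" "B \<in> borel_measurable borel" "C \<in> borel_measurable borel"
      using A B C by (auto dest: borel_measurable_has_bochner_integral)
    then show ?thesis using n by (intro borel_measurable_times measurable_compose[OF n])
  qed
  have ms: "(\<lambda>f. \<Sum>b\<in>Basis. f b *\<^sub>R b) \<in> (\<Pi>\<^sub>M b\<in>(Basis::(real^3) set). lborel) \<rightarrow>\<^sub>M borel" by measurable
  have I: "integrable (\<Pi>\<^sub>M v\<in>Basis. lborel) (\<lambda>x. \<Prod>v\<in>Basis. f v (x v))"
    by (intro product_integrable_prod int) simp
  have V: "(LINT x|(\<Pi>\<^sub>M v\<in>Basis. lborel). (\<Prod>v\<in>Basis. f v (x v))) = (\<Prod>v\<in>Basis. integral\<^sup>L lborel (f v))"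
    by (intro product_integral_prod int) simp
  have "(\<Prod>v\<in>Basis. integral\<^sup>L lborel (f v)) = a * b * c"
    unfolding Bas using ne A B C by (simp add: f_def mult.assoc has_bochner_integral_iff)
  then have "has_bochner_integral (\<Pi>\<^sub>M v\<in>Basis. lborel) (\<lambda>x. A (x (axis 1 1 :: real^3)) * B (x (axis 2 1)) * C (x (axis 3 1))) (a * b * c)"
    using I V unfolding pr by (simp add: has_bochner_integral_iff)
  then show ?thesis
    unfolding has_bochner_integral_iff
    by (subst (1 2) lborel_eq) (simp only: integrable_distr_eq[OF ms meas] integral_distr[OF ms meas] nth)
qed

lemma mink_expand: "mink t a b c = t *\<^sub>R e_t + a *\<^sub>R e_1 + b *\<^sub>R e_2 + c *\<^sub>R e_3"
  by (simp add: e_t_def e_1_def e_2_def e_3_def mink_def vec_eq_iff forall_2 complex_eq_iff)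

lemma coords_add [simp]:
  "tc (X + Y) = tc X + tc Y" "x1 (X + Y) = x1 X + x1 Y"
  "x2 (X + Y) = x2 X + x2 Y" "x3 (X + Y) = x3 X + x3 Y"
  by (simp_all add: tc_def x1_def x2_def x3_def algebra_simps add_divide_distrib diff_divide_distrib)

text \<open>The derivative of \<open>H_param\<close> at \<open>u\<close>, see \<open>H_param_has_derivative\<close>.\<close>

definition H_deriv :: "real^3 \<Rightarrow> real^3 \<Rightarrow> cmat" where
  "H_deriv u v = mink (cosh (u$1) * v$1)
     (sinh (u$1) * v$1 * sin (u$2) * cos (u$3) + cosh (u$1) * (cos (u$2) * v$2) * cos (u$3)
       - cosh (u$1) * sin (u$2) * (sin (u$3) * v$3))
     (sinh (u$1) * v$1 * sin (u$2) * sin (u$3) + cosh (u$1) * (cos (u$2) * v$2) * sin (u$3)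
       + cosh (u$1) * sin (u$2) * (cos (u$3) * v$3))
     (sinh (u$1) * v$1 * cos (u$2) - cosh (u$1) * (sin (u$2) * v$2))"

lemma H_param_has_derivative: "(H_param has_derivative H_deriv u) (at u)"
proof -
  have n: "((\<lambda>u::real^3. u $ i) has_derivative (\<lambda>v. v $ i)) (at u)" for i
    by (rule bounded_linear.has_derivative[OF bounded_linear_vec_nth has_derivative_ident])
  have sh: "((\<lambda>u::real^3. sinh (u $ i)) has_derivative (\<lambda>v. v $ i * cosh (u $ i))) (at u)"
    "((\<lambda>u::real^3. cosh (u $ i)) has_derivative (\<lambda>v. v $ i * sinh (u $ i))) (at u)" for i
    by (rule DERIV_compose_FDERIV[OF _ n], auto intro!: derivative_eq_intros)+
  show ?thesis
    unfolding H_param_def[abs_def] H_deriv_def[abs_def] mink_expand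
    by (rule derivative_eq_intros n sh refl)+ (simp add: fun_eq_iff algebra_simps)
qed

text \<open>The three tangent vectors are orthogonal, with squared lengths \<open>cosh\<^sup>2 \<eta> + sinh\<^sup>2 \<eta>\<close>, \<open>cosh\<^sup>2 \<eta>\<close> and
\<open>cosh\<^sup>2 \<eta> sin\<^sup>2 \<theta>\<close>.\<close>

lemma det_gram_H_param:
  "det (gram H_param u) = ((sinh (u$1))\<^sup>2 + (cosh (u$1))\<^sup>2) * (cosh (u$1))^4 * (sin (u$2))\<^sup>2"
proof -
  have fd: "frechet_derivative H_param (at u) = H_deriv u"
    using frechet_derivative_at[OF H_param_has_derivative] by simp
  define A B s c p q where "A = sinh (u$1)" and "B = cosh (u$1)" and "s = sin (u$2)" and "c = cos (u$2)"
    and "p = sin (u$3)" and "q = cos (u$3)"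
  have sc: "s\<^sup>2 + c\<^sup>2 = 1" and pq: "p\<^sup>2 + q\<^sup>2 = 1" by (simp_all add: s_def c_def p_def q_def)
  have g: "gram H_param u $ i $ j = minner (H_deriv u (axis i 1)) (H_deriv u (axis j 1))" for i j
    by (simp add: gram_def fd)
  have ax: "axis i (1::real) $ j = (if i = j then 1 else 0)" for i j :: 3
    by (auto simp: axis_def)
  have "gram H_param u $ 1 $ 1 = B\<^sup>2 + A\<^sup>2" "gram H_param u $ 2 $ 2 = B\<^sup>2" "gram H_param u $ 3 $ 3 = B\<^sup>2 * s\<^sup>2"
    "gram H_param u $ 1 $ 2 = 0" "gram H_param u $ 2 $ 1 = 0" "gram H_param u $ 1 $ 3 = 0"
    "gram H_param u $ 3 $ 1 = 0" "gram H_param u $ 2 $ 3 = 0" "gram H_param u $ 3 $ 2 = 0"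
    unfolding g minner_def H_deriv_def coords_mink ax A_def[symmetric] B_def[symmetric] s_def[symmetric]
      c_def[symmetric] p_def[symmetric] q_def[symmetric]
    using sc pq by (simp_all, algebra+)
  then show ?thesis
    by (simp add: det_3 A_def[symmetric] B_def[symmetric] s_def[symmetric] power2_eq_square power4_eq_xxxx)
qed

lemma H_param_coords:
  "tc (H_param u) = sinh (u$1)" "rad (H_param u) = cosh (u$1)"
  "mnorm (H_param u) = sqrt ((sinh (u$1))\<^sup>2 + (cosh (u$1))\<^sup>2)"
proof -
  have "(cosh (u$1) * sin (u$2) * cos (u$3))\<^sup>2 + (cosh (u$1) * sin (u$2) * sin (u$3))\<^sup>2 + (cosh (u$1) * cos (u$2))\<^sup>2
    = (cosh (u$1))\<^sup>2"
    using sin_cos_squared_add[of "u$2"] sin_cos_squared_add[of "u$3"] by algebra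
  then show r: "rad (H_param u) = cosh (u$1)" by (simp add: rad_def H_param_def)
  show "tc (H_param u) = sinh (u$1)" by (simp add: H_param_def)
  then show "mnorm (H_param u) = sqrt ((sinh (u$1))\<^sup>2 + (cosh (u$1))\<^sup>2)" by (simp add: mnorm_def r)
qed

lemma H_param_Htilde: "H_param u \<in> Htilde"
proof -
  have "H_param u \<in> Mink" by (auto simp: H_param_def Mink_def)
  then show ?thesis by (simp add: Htilde_def N_eq H_param_coords cosh_square_eq)
qed

lemma Htilde_Mplus: "Htilde \<subseteq> Mplus"
  by (auto simp: Htilde_def Mplus_def)

lemma H_param_angles:
  assumes "u \<in> H_dom"
  shows "theta (H_param u) = u$2" "phi (H_param u) = u$3"
proof -
  have u: "0 < u$2" "u$2 < pi" "- pi < u$3" "u$3 < pi" using assms by (simp_all add: H_dom_def)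
  show "theta (H_param u) = u$2"
    using u by (simp add: theta_def H_param_coords) (simp add: H_param_def arccos_cos)
  have "Complex (x1 (H_param u)) (x2 (H_param u)) = of_real (cosh (u$1) * sin (u$2)) * cis (u$3)"
    by (simp add: H_param_def complex_eq_iff)
  moreover have "cosh (u$1) * sin (u$2) > 0" using u by (simp add: sin_gt_zero)
  ultimately show "phi (H_param u) = u$3"
    using u by (simp add: phi_def Arg_times_of_real Arg_cis del: of_real_mult)
qed

lemma H_param_measurable: "H_param \<in> borel_measurable borel"
proof -
  have "isCont H_param u" for u by (rule has_derivative_continuous[OF H_param_has_derivative])
  then show ?thesis by (intro borel_measurable_continuous_onI) (simp add: continuous_at_imp_continuous_on)
qed

lemma Htilde_borel: "Htilde \<in> sets borel"
proof -
  have "mink (tc Y) (x1 Y) (x2 Y) (x3 Y) = Y \<longleftrightarrow> Y \<in> Mink" for Y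
    using mink_coords[of Y] unfolding Mink_def by (metis (mono_tags, lifting) mem_Collect_eq)
  then have "Htilde = {Y. mink (tc Y) (x1 Y) (x2 Y) (x3 Y) = Y} \<inter> {Y. (rad Y)\<^sup>2 - (tc Y)\<^sup>2 = 1}"
    by (auto simp: Htilde_def N_eq)
  moreover have "closed ({Y. mink (tc Y) (x1 Y) (x2 Y) (x3 Y) = Y} \<inter> {Y. (rad Y)\<^sup>2 - (tc Y)\<^sup>2 = 1})"
    unfolding mink_expand by (intro closed_Int closed_Collect_eq continuous_intros continuous_coords)
  ultimately have "closed Htilde" by (simp only:)
  then show ?thesis by (rule borel_closed)
qed

lemma H_dom_eq: "H_dom = {u. u$2 \<in> {0<..<pi} \<and> u$3 \<in> {- pi<..<pi}}"
  by (auto simp: H_dom_def)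

lemma H_dom_borel: "H_dom \<in> sets borel"
proof -
  have "open {u::real^3. 0 < u$2}" "open {u::real^3. u$2 < pi}" "open {u::real^3. - pi < u$3}" "open {u::real^3. u$3 < pi}"
    by (intro open_Collect_less continuous_intros)+
  then have "open ({u::real^3. 0 < u$2} \<inter> {u. u$2 < pi} \<inter> ({u. - pi < u$3} \<inter> {u. u$3 < pi}))"
    by (intro open_Int)
  also have "{u::real^3. 0 < u$2} \<inter> {u. u$2 < pi} \<inter> ({u. - pi < u$3} \<inter> {u. u$3 < pi}) = H_dom"
    by (auto simp: H_dom_def)
  finally show ?thesis by simp
qed

text \<open>Unfolds \<open>dS\<close> as an image of a measure with density. The integrand enters through its values on \<open>Htilde\<close>
only, and there continuity makes it measurable; about \<open>pd\<close> elsewhere nothing is known.\<close>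

lemma surface_integral:
  fixes h :: "cmat \<Rightarrow> complex"
  assumes h: "continuous_on Htilde h"
    and I: "has_bochner_integral lborel
      (\<lambda>u. indicator H_dom u *\<^sub>R (sqrt (det (gram H_param u)) *\<^sub>R h (H_param u))) v"
  shows "set_integrable dS Htilde h" "(LINT Y:Htilde|dS. h Y) = v"
proof -
  define g where "g Y = indicator Htilde Y *\<^sub>R h Y" for Y
  define J where "J u = sqrt (det (gram H_param u))" for u
  have gm: "g \<in> borel_measurable borel"
    unfolding g_def[abs_def] by (rule borel_measurable_continuous_on_indicator[OF Htilde_borel h])
  let ?R = "restrict_space lborel H_dom :: (real^3) measure"
  have Om: "H_dom \<inter> space lborel \<in> sets lborel" using H_dom_borel by simp
  have Rm: "f \<in> measurable ?R M" if "f \<in> measurable borel M" for f and M :: "'c measure"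
    using that by (intro measurable_restrict_space1) simp
  have Jc: "J \<in> borel_measurable borel"
    unfolding J_def[abs_def] det_gram_H_param
    by (intro borel_measurable_continuous_onI continuous_intros)
  have Pm: "H_param \<in> measurable (density ?R (\<lambda>u. ennreal (J u))) borel"
    using Rm[OF H_param_measurable] by simp
  have gP: "(\<lambda>u. g (H_param u)) \<in> borel_measurable ?R"
    using measurable_compose[OF Rm[OF H_param_measurable] gm] .
  have dS: "dS = distr (density ?R (\<lambda>u. ennreal (J u))) borel H_param"
    by (simp add: dS_def surface_measure_def J_def)
  have gH: "g (H_param u) = h (H_param u)" for u
    using H_param_Htilde[of u] by (simp add: g_def)
  have nn: "AE u in ?R. 0 \<le> J u" by (simp add: J_def det_gram_H_param)
  have I': "has_bochner_integral lborel (\<lambda>u. indicator H_dom u *\<^sub>R (J u *\<^sub>R g (H_param u))) v"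
    using I by (simp add: gH J_def)
  have "integrable dS g"
    using I' unfolding dS integrable_distr_eq[OF Pm gm] integrable_density[OF gP Rm[OF Jc] nn]
      integrable_restrict_space[OF Om] has_bochner_integral_iff by simp
  then show "set_integrable dS Htilde h" by (simp add: set_integrable_def g_def[abs_def])
  have "integral\<^sup>L dS g = v"
    using I' unfolding dS integral_distr[OF Pm gm] integral_density[OF gP Rm[OF Jc] nn]
      integral_restrict_space[OF Om] has_bochner_integral_iff by simp
  then show "(LINT Y:Htilde|dS. h Y) = v" by (simp add: set_lebesgue_integral_def g_def[abs_def])
qed

section \<open>Orthogonality relations\<close>

text \<open>On \<open>Htilde\<close> one has \<open>N = 1\<close>, \<open>r = cosh \<eta>\<close>, \<open>t / r = tanh \<eta>\<close> and \<open>1 - (t / r)\<^sup>2 = sech\<^sup>2 \<eta>\<close>.\<close>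

lemma f_minus_H_param:
  assumes "- int l \<le> m" "m \<le> int l" "n \<le> l" "u \<in> H_dom"
  shows "f_minus l m n (H_param u) =
    of_real (f_coeff l n * leg_coeff l (int n) * (inverse (cosh (u$1)) ^ Suc n * poly (leg l n) (tanh (u$1)))) *
    (ylm_coeff l m * of_real (sin (u$2) ^ nat \<bar>m\<bar> * poly (leg l (nat \<bar>m\<bar>)) (cos (u$2)))) *
    exp (- \<i> * of_int m * of_real (u$3))"
proof -
  have th: "0 \<le> u$2" "u$2 \<le> pi" using assms(4) by (simp_all add: H_dom_def)
  have t: "sinh (u$1) / cosh (u$1) = tanh (u$1)" by (simp add: tanh_def)
  have "sqrt (1 - (tanh (u$1))\<^sup>2) = inverse (cosh (u$1))" by (simp add: tanh_sech)
  moreover have "\<bar>tanh (u$1)\<bar> \<le> 1" using tanh_real_bounds[of "u$1"] by auto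
  ultimately have P: "legP l (int n) (tanh (u$1)) = leg_coeff l (int n) * inverse (cosh (u$1)) ^ n * poly (leg l n) (tanh (u$1))"
    using legP_closed[of l "int n" "tanh (u$1)"] assms(3) by simp
  show ?thesis
    unfolding f_minus_def H_param_angles[OF assms(4)] H_param_coords t P Ylm_closed[OF assms(1,2) th]
    by (simp add: cosh_square_eq mult_ac)
qed

text \<open>The factors \<open>1 / r\<close> of the two solutions cancel the factor \<open>cosh\<^sup>2 \<eta>\<close> of the surface density.\<close>

definition radial_integrand :: "nat \<Rightarrow> nat \<Rightarrow> nat \<Rightarrow> nat \<Rightarrow> real \<Rightarrow> real" where
  "radial_integrand l n l' n' \<eta> = f_coeff l n * leg_coeff l (int n) * (f_coeff l' n' * leg_coeff l' (int n')) *
     (inverse (cosh \<eta>) ^ (n + n') * poly (leg l n * leg l' n') (tanh \<eta>))"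

definition polar_integrand :: "nat \<Rightarrow> int \<Rightarrow> nat \<Rightarrow> int \<Rightarrow> real \<Rightarrow> complex" where
  "polar_integrand l m l' m' \<theta> = indicator {0<..<pi} \<theta> *\<^sub>R (ylm_coeff l m * ylm_coeff l' m' *
     of_real (sin \<theta> ^ (nat \<bar>m\<bar> + nat \<bar>m'\<bar>) * poly (leg l (nat \<bar>m\<bar>) * leg l' (nat \<bar>m'\<bar>)) (cos \<theta>) * sin \<theta>))"

definition azimuth_integrand :: "int \<Rightarrow> int \<Rightarrow> real \<Rightarrow> complex" where
  "azimuth_integrand m m' \<phi> = indicator {- pi<..<pi} \<phi> *\<^sub>R exp (\<i> * of_int (- m - m') * of_real \<phi>)"

lemma product_integrand:
  assumes "- int l \<le> m" "m \<le> int l" "n \<le> l" "- int l' \<le> m'" "m' \<le> int l'" "n' \<le> l'"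
  shows "indicator H_dom u *\<^sub>R (sqrt (det (gram H_param u)) *\<^sub>R
     (f_minus l m n (H_param u) * f_minus l' m' n' (H_param u) / of_real (mnorm (H_param u)))) =
     of_real (radial_integrand l n l' n' (u$1)) * polar_integrand l m l' m' (u$2) * azimuth_integrand m m' (u$3)"
proof (cases "u \<in> H_dom")
  case False
  then show ?thesis by (auto simp: H_dom_eq polar_integrand_def azimuth_integrand_def)
next
  case True
  have ind: "u$2 \<in> {0<..<pi}" "u$3 \<in> {- pi<..<pi}" using True by (simp_all add: H_dom_eq)
  have s: "sin (u$2) > 0" using ind by (simp add: sin_gt_zero)
  have M: "mnorm (H_param u) > 0" unfolding H_param_coords by (simp add: add_nonneg_pos)
  have "sqrt (det (gram H_param u)) = mnorm (H_param u) * ((cosh (u$1))\<^sup>2 * sin (u$2))"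
  proof -
    have "(cosh (u$1))^4 * (sin (u$2))\<^sup>2 = ((cosh (u$1))\<^sup>2 * sin (u$2))\<^sup>2"
      by (simp add: power_mult_distrib flip: power_mult)
    then show ?thesis using s
      by (simp add: det_gram_H_param H_param_coords mult.assoc real_sqrt_mult abs_mult)
  qed
  moreover have "(cosh (u$1))\<^sup>2 * (inverse (cosh (u$1)) ^ Suc n * inverse (cosh (u$1)) ^ Suc n') =
      inverse (cosh (u$1)) ^ (n + n')"
    by (simp add: power_add power2_eq_square field_simps)
  from arg_cong[OF this, of complex_of_real]
  have ch: "complex_of_real ((cosh (u$1))\<^sup>2) * (of_real (inverse (cosh (u$1)) ^ Suc n) * of_real (inverse (cosh (u$1)) ^ Suc n')) =
      of_real (inverse (cosh (u$1)) ^ (n + n'))"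
    by (simp only: of_real_mult)
  have ex: "exp (- \<i> * of_int m * of_real (u$3)) * exp (- \<i> * of_int m' * of_real (u$3)) =
      exp (\<i> * of_int (- m - m') * of_real (u$3))"
    by (simp add: exp_add[symmetric] algebra_simps)
  ultimately show ?thesis
    using M True ind
    unfolding f_minus_H_param[OF assms(1-3) True] f_minus_H_param[OF assms(4-6) True]
      radial_integrand_def polar_integrand_def azimuth_integrand_def ex[symmetric]
    apply (simp only: indicator_simps scaleR_conv_of_real of_real_1 mult_1_left of_real_mult poly_mult power_add ch[symmetric, unfolded power_add of_real_mult])
    by (simp add: field_simps)
qed

lemma integral_azimuth:
  "has_bochner_integral lborel (azimuth_integrand m (- m')) (if m = m' then 2 * of_real pi else 0)"
  using integral_exp[of "m' - m"] by (auto simp: azimuth_integrand_def[abs_def])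

lemma integrable_polar: "integrable lborel (polar_integrand l m l' m')"
  unfolding polar_integrand_def[abs_def]
  by (intro integrable_Ioo_continuous continuous_intros)

text \<open>The square roots in \<open>Ylm l m\<close> and \<open>Ylm l (- m)\<close> are inverse to each other, as are the powers of
\<open>- \<i>\<close>. The sign \<open>(-1) ^ m\<close> comes from the reflection formula, which is applied to one of the two factors.\<close>

lemma polar_constant:
  assumes "- int l \<le> m" "m \<le> int l"
  shows "ylm_coeff l m * ylm_coeff l (- m) * of_real (assoc_int l l (nat \<bar>m\<bar>)) = of_real (2 * (-1) powi m / real (2 * l + 1))"
proof -
  define k where "k = nat \<bar>m\<bar>"
  have kl: "k \<le> l" using assms by (simp add: k_def)
  define a b :: real where "a = fact (nat (int l - m))" and "b = fact (nat (int l + m))"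
  have ab: "a > 0" "b > 0" by (simp_all add: a_def b_def)
  have "sqrt (a / b) * sqrt (b / a) = 1"
    using ab by (simp flip: real_sqrt_mult)
  moreover have "(- \<i>) powi m * (- \<i>) powi (- m) = 1" by (simp add: power_int_minus)
  ultimately have y: "ylm_coeff l m * ylm_coeff l (- m) = of_real (leg_coeff l m * leg_coeff l (- m))"
    unfolding ylm_coeff_def a_def b_def
    by (simp add: mult_ac) (simp only: mult.assoc[symmetric] of_real_mult[symmetric], simp)
  have s2: "(-1::real) ^ nat (int l + m) * (-1) ^ nat (int l - m) = 1"
  proof -
    have "nat (int l + m) + nat (int l - m) = 2 * l" using assms by linarith
    then show ?thesis by (simp add: power_mult flip: power_add)
  qed
  have sk: "(-1::real) ^ k = (-1) powi m"
    by (cases "m \<ge> 0") (auto simp: k_def power_int_def)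
  have "leg_coeff l m * leg_coeff l (- m) = (-1) ^ k * fact (l - k) / fact (l + k) / (2 ^ l * fact l)\<^sup>2"
  proof (cases "m = 0")
    case True
    then show ?thesis by (simp add: leg_coeff_def k_def power2_eq_square flip: power_add mult_2)
  next
    case False
    then show ?thesis using s2
      by (cases "m < 0") (simp_all add: leg_coeff_def k_def power2_eq_square field_simps)
  qed
  then have "leg_coeff l m * leg_coeff l (- m) * assoc_int l l k = 2 * (-1) powi m / real (2 * l + 1)"
  proof -
    have "e * a / b / c * (c * 2 / R * b / a) = 2 * e / R" if "a \<noteq> 0" "b \<noteq> 0" "c \<noteq> 0" for e a b c R :: real
      using that by simp
    from this[of "fact (l - k)" "fact (l + k)" "(2 ^ l * fact l)\<^sup>2"] show ?thesis
      using \<open>leg_coeff l m * leg_coeff l (- m) = _\<close> unfolding assoc_int_norm[OF kl] sk[symmetric] by simp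
  qed
  then show ?thesis unfolding y k_def by (metis of_real_mult)
qed

lemma integral_polar:
  assumes "- int l \<le> m" "m \<le> int l"
  shows "has_bochner_integral lborel (polar_integrand l m l' (- m))
    (if l = l' then of_real (2 * (-1) powi m / real (2 * l + 1)) else 0)"
proof -
  let ?k = "nat \<bar>m\<bar>"
  have eq: "poly (wpoly ^ ?k * leg l ?k * leg l' ?k) (cos \<theta>) = sin \<theta> ^ (?k + ?k) * poly (leg l ?k * leg l' ?k) (cos \<theta>)" for \<theta>
    by (simp add: poly_power poly_wpoly sin_squared_eq[symmetric] flip: power_mult mult_2)
  have "has_bochner_integral lborel
    (\<lambda>\<theta>. indicator {0<..<pi} \<theta> *\<^sub>R (sin \<theta> ^ (?k + ?k) * poly (leg l ?k * leg l' ?k) (cos \<theta>) * sin \<theta>)) (assoc_int l l' ?k)"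
    using integral_cos_poly[of "wpoly ^ ?k * leg l ?k * leg l' ?k"] unfolding eq assoc_int_def .
  from has_bochner_integral_mult_right[OF has_bochner_integral_of_real[OF this], of "ylm_coeff l m * ylm_coeff l' (- m)"]
  have "has_bochner_integral lborel (polar_integrand l m l' (- m)) (ylm_coeff l m * ylm_coeff l' (- m) * of_real (assoc_int l l' ?k))"
    by (simp add: polar_integrand_def[abs_def] scaleR_conv_of_real mult_ac)
  then show ?thesis
    using assms by (cases "l = l'") (auto simp: assoc_int_orth polar_constant)
qed

lemma integrable_radial:
  assumes "n \<ge> 1"
  shows "integrable lborel (radial_integrand l n l' n')"
  unfolding radial_integrand_def[abs_def]
  by (intro integrable_mult_right integrable_sech_poly) (use assms in simp)

lemma integral_radial:
  assumes "1 \<le> n" "n \<le> l" "n' \<le> l"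
  shows "has_bochner_integral lborel (radial_integrand l n l n') (if n = n' then real (2 * l + 1) / real n else 0)"
proof (cases "n = n'")
  case False
  from has_bochner_integral_mult_right[OF radial_orthogonal[OF False], of "f_coeff l n * leg_coeff l (int n) * (f_coeff l n' * leg_coeff l (int n'))" l]
  show ?thesis using False by (simp add: radial_integrand_def[abs_def])
next
  case True
  obtain j where j: "n = Suc j" using assms by (cases n) auto
  have "inverse (cosh \<eta>) ^ 2 * poly (wpoly ^ j * leg l n * leg l n) (tanh \<eta>) =
      inverse (cosh \<eta>) ^ (n + n) * poly (leg l n * leg l n) (tanh \<eta>)" for \<eta> :: real
    unfolding poly_mult poly_power poly_wpoly tanh_sech j
    by (simp add: power2_eq_square power_mult_distrib power_add)
  then have "has_bochner_integral lborel (\<lambda>\<eta>. inverse (cosh \<eta>) ^ (n + n) * poly (leg l n * leg l n) (tanh \<eta>))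
      (polyint (wpoly ^ (n - 1) * leg l n * leg l n))"
    using integral_sech_poly[of "wpoly ^ j * leg l n * leg l n"] by (simp only: j diff_Suc_1)
  from has_bochner_integral_mult_right[OF this, of "f_coeff l n * leg_coeff l (int n) * (f_coeff l n * leg_coeff l (int n))"]
  have "has_bochner_integral lborel (radial_integrand l n l n) (f_coeff l n * leg_coeff l (int n) * (f_coeff l n * leg_coeff l (int n)) *
      ((2 ^ l * fact l)\<^sup>2 * fact (l + n) / (real n * fact (l - n))))"
    unfolding radial_integrand_def[abs_def] radial_int_norm[OF assms(2,1)] .
  moreover have "f_coeff l n * leg_coeff l (int n) * (f_coeff l n * leg_coeff l (int n)) *
      ((2 ^ l * fact l)\<^sup>2 * fact (l + n) / (real n * fact (l - n))) = real (2 * l + 1) / real n"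
  proof -
    have "f_coeff l n * f_coeff l n = real (2 * l + 1) * fact (l - n) / fact (l + n)"
      unfolding f_coeff_def by (rule real_sqrt_mult_self[THEN trans]) simp
    moreover have "leg_coeff l (int n) * leg_coeff l (int n) * (2 ^ l * fact l)\<^sup>2 = 1"
    proof -
      have "(-1::real) ^ (l + n) * (-1) ^ (l + n) = 1" by (simp flip: power_mult_distrib)
      moreover have "(e / d) * (e / d) * d\<^sup>2 = 1" if "e * e = 1" "d \<noteq> 0" for e d :: real
        using that by (simp add: power2_eq_square)
      moreover have "leg_coeff l (int n) = (-1) ^ (l + n) / (2 ^ l * fact l)"
        by (simp add: leg_coeff_def nat_add_distrib)
      ultimately show ?thesis by (simp add: power2_eq_square)
    qed
    moreover have "f * K * (f * K) * (S * b / (c * a)) = r / c"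
      if "f * f = r * a / b" "K * K * S = 1" "a \<noteq> 0" "b \<noteq> 0" for f K S a b c r :: real
    proof -
      have "f * K * (f * K) * (S * b / (c * a)) = (f * f) * (K * K * S) * b / (c * a)" by (simp add: mult_ac)
      then show ?thesis using that by simp
    qed
    ultimately show ?thesis by simp
  qed
  ultimately show ?thesis using True by simp
qed

text \<open>Both first arguments of the pairing in the theorem are covered: \<open>s\<close> is 1 for \<open>f_plus\<close> and \<open>- 1\<close> for
\<open>f_minus\<close>.\<close>

lemma pairing_f_minus:
  assumes lm: "- int l \<le> m" "m \<le> int l" "n \<le> l" and lm': "- int l' \<le> m'" "m' \<le> int l'" "n' \<le> l'"
    and f: "\<And>Y. Y \<in> Htilde \<Longrightarrow> degt f Y = s * of_nat n * f_minus l m n Y"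
    and g: "\<And>Y. Y \<in> Htilde \<Longrightarrow> g Y = f_minus l' (- m') n' Y"
  shows "pairing_converges f g \<and> pairing f g = s * ((-1) powi m * (2 / (of_real pi * \<i>)) *
     of_bool (l = l') * of_bool (m = m') * of_bool (n = n') * (1 - of_bool (n = 0)))"
proof -
  define h where "h Y = s * of_nat n * (f_minus l m n Y * f_minus l' (- m') n' Y / of_real (mnorm Y))" for Y
  have hY: "pair_integrand f g Y = h Y" if "Y \<in> Htilde" for Y
    using that by (simp add: pair_integrand_def h_def f g)
  have lm'': "- int l' \<le> - m'" "- m' \<le> int l'" using lm' by simp_all
  have mn: "mnorm Y \<noteq> 0" if "Y \<in> Htilde" for Y
  proof -
    have "rad Y > 0" using that Htilde_Mplus rad_pos by blast
    then have "(tc Y)\<^sup>2 + (rad Y)\<^sup>2 > 0" by (simp add: add_nonneg_pos)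
    then have "mnorm Y > 0" unfolding mnorm_def by (rule real_sqrt_gt_zero)
    then show ?thesis by simp
  qed
  have cont: "continuous_on Htilde h"
  proof -
    have "continuous_on Htilde (f_minus l m n)" "continuous_on Htilde (f_minus l' (- m') n')"
      using regular_continuous_on[OF regular_f_minus] lm lm'' lm'(3) continuous_on_subset[OF _ Htilde_Mplus] by blast+
    moreover have "continuous_on Htilde mnorm"
      unfolding mnorm_def[abs_def]
      by (intro continuous_intros continuous_on_subset[OF continuous_coords(1)] continuous_on_subset[OF continuous_coords(5)]) simp_all
    ultimately show ?thesis unfolding h_def[abs_def] using mn
      by (intro continuous_intros) auto
  qed
  \<comment> \<open>The value of the integral: the claimed pairing without its normalisation.\<close>
  define V where "V = (2 * of_real (pi\<^sup>2) * \<i>) * (s * ((-1) powi m * (2 / (of_real pi * \<i>)) *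
     of_bool (l = l') * of_bool (m = m') * of_bool (n = n') * (1 - of_bool (n = 0))))"
  have "has_bochner_integral lborel
      (\<lambda>u. indicator H_dom u *\<^sub>R (sqrt (det (gram H_param u)) *\<^sub>R h (H_param u))) V"
  \<comment> \<open>For \<open>n = 0\<close> the integral over \<open>\<eta>\<close> may diverge, but \<open>degt\<close> annihilates the function.\<close>
  proof (cases "n = 0")
    case True
    then show ?thesis by (simp add: h_def V_def has_bochner_integral_zero)
  next
    case False
    then have n: "n \<ge> 1" by simp
    have eq: "indicator H_dom u *\<^sub>R (sqrt (det (gram H_param u)) *\<^sub>R h (H_param u)) = s * of_nat n *
       (of_real (radial_integrand l n l' n' (u$1)) * polar_integrand l m l' (- m') (u$2) * azimuth_integrand m (- m') (u$3))" for u
      unfolding product_integrand[OF lm lm'' lm'(3), symmetric] h_def by (simp add: scaleR_conv_of_real)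
    obtain r where r: "has_bochner_integral lborel (\<lambda>\<eta>. complex_of_real (radial_integrand l n l' n' \<eta>)) (of_real r)"
      and r': "l = l' \<Longrightarrow> r = (if n = n' then real (2 * l + 1) / real n else 0)"
    proof (cases "l = l'")
      case True
      have "has_bochner_integral lborel (radial_integrand l n l' n')
          (if n = n' then real (2 * l + 1) / real n else 0)"
        using integral_radial[OF n lm(3), of n'] lm'(3) True by simp
      from has_bochner_integral_of_real[OF this] show ?thesis by (rule that) (rule refl)
    next
      case False
      from has_bochner_integral_of_real[OF has_bochner_integral_integrable[OF integrable_radial[OF n]]]
      show ?thesis by (rule that) (use False in simp)
    qed
    obtain p where p: "has_bochner_integral lborel (polar_integrand l m l' (- m')) p"
      and p': "m = m' \<Longrightarrow> p = (if l = l' then of_real (2 * (-1) powi m / real (2 * l + 1)) else 0)"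
    proof (cases "m = m'")
      case True
      then show ?thesis using that integral_polar[OF lm(1,2), of l'] by blast
    next
      case False
      then show ?thesis using that has_bochner_integral_integrable[OF integrable_polar] by blast
    qed
    have "has_bochner_integral lborel (\<lambda>u::real^3. s * of_nat n *
       (of_real (radial_integrand l n l' n' (u$1)) * polar_integrand l m l' (- m') (u$2) * azimuth_integrand m (- m') (u$3)))
       (s * of_nat n * (of_real r * p * (if m = m' then 2 * of_real pi else 0)))"
      by (intro has_bochner_integral_mult_right integral_product_3 r p integral_azimuth)
    moreover have "s * of_nat n * (of_real r * p * (if m = m' then 2 * of_real pi else 0)) = V"
    proof (cases "l = l' \<and> m = m' \<and> n = n'")
      case True
      have L: "complex_of_nat (2 * l + 1) \<noteq> 0" by (metis Suc_eq_plus1 of_nat_neq_0)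
      have "of_nat n * (complex_of_real r * p) = 2 * (-1) powi m"
      proof -
        have "real n * r = real (2 * l + 1)" using r' True False by simp
        from arg_cong[OF this, of complex_of_real] have "of_nat n * complex_of_real r = of_nat (2 * l + 1)"
          by (simp only: of_real_mult of_real_of_nat_eq)
        moreover have "p = 2 * (-1) powi m / of_nat (2 * l + 1)" using p' True by (simp add: of_real_power_int)
        ultimately show ?thesis using L by (simp only: mult.assoc[symmetric]) simp
      qed
      then have "s * of_nat n * (of_real r * p * (2 * of_real pi)) = s * (2 * (-1) powi m) * (2 * of_real pi)"
        by (simp add: mult_ac)
      moreover have "s * (2 * X) * (2 * P) = (2 * P\<^sup>2 * \<i>) * (s * (X * (2 / (P * \<i>))))" if "P \<noteq> 0" for X P :: complex
        using that by (simp add: power2_eq_square)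
      from this[of "of_real pi" "(-1) powi m"]
      have "V = s * (2 * (-1) powi m) * (2 * of_real pi)" using True n by (simp add: V_def)
      ultimately show ?thesis using True by simp
    next
      case False
      then have "V = 0" unfolding V_def by (cases "l = l'"; cases "m = m'") simp_all
      moreover have "of_real r * p * (if m = m' then 2 * of_real pi else 0) = 0"
      proof (cases "m = m'")
        case m: True
        show ?thesis
        proof (cases "l = l'")
          case True
          then have "r = 0" using r' False m by simp
          then show ?thesis by simp
        next
          case l: False
          then have "p = 0" using p' m by simp
          then show ?thesis by simp
        qed
      qed simp
      ultimately show ?thesis by simp
    qed
    ultimately show ?thesis unfolding eq by simp
  qed
  note S = surface_integral[OF cont this]
  have eqf: "(\<lambda>Y. indicator Htilde Y *\<^sub>R h Y) = (\<lambda>Y. indicator Htilde Y *\<^sub>R pair_integrand f g Y)"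
    by (auto simp: fun_eq_iff indicator_def hY)
  have "set_integrable dS Htilde (pair_integrand f g)"
    using S(1) unfolding set_integrable_def eqf .
  moreover have "(LINT Y:Htilde|dS. pair_integrand f g Y) = V"
    using S(2) unfolding set_lebesgue_integral_def eqf .
  moreover have "1 / (2 * of_real (pi\<^sup>2) * \<i>) * ((2 * of_real (pi\<^sup>2) * \<i>) * W) = W" for W :: complex
    by simp
  ultimately show ?thesis
    unfolding pairing_converges_def pairing_def V_def by (simp only: simp_thms)
qed

lemma f_plus_Htilde: "Y \<in> Htilde \<Longrightarrow> f_plus l m n Y = f_minus l m n Y"
  using f_plus_eq[of Y l m n] Htilde_Mplus by (auto simp: Htilde_def)

theorem theorem68:
  fixes l n :: nat and m :: int
  assumes "- int l \<le> m" and "m \<le> int l" and "n \<le> l"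
  shows "solves_wave_on Mplus (f_plus l m n) \<and> solves_wave_on Mplus (f_minus l m n) \<and>
    (\<forall>(l'::nat) (m'::int) (n'::nat). - int l' \<le> m' \<and> m' \<le> int l' \<and> n' \<le> l' \<longrightarrow>
      (\<forall>g \<in> {f_plus l' (- m') n', f_minus l' (- m') n'}.
        pairing_converges (f_plus l m n) g \<and> pairing_converges (f_minus l m n) g \<and>
        pairing (f_plus l m n) g = - pairing (f_minus l m n) g \<and>
        - pairing (f_minus l m n) g =
          (-1) powi m * (2 / (of_real pi * \<i>)) * of_bool (l = l') * of_bool (m = m') *
          of_bool (n = n') * (1 - of_bool (n = 0)))) \<and>
    (\<forall>Y\<in>Mplus.
      invol1 (f_plus l m n) Y = f_minus l m n Y \<and> invol1 (f_minus l m n) Y = f_plus l m n Y \<and>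
      invol2 l (f_plus l m n) Y = f_minus l m n Y \<and> invol2 l (f_minus l m n) Y = f_plus l m n Y)"
proof (intro conjI allI impI ballI)
  show "solves_wave_on Mplus (f_plus l m n)" "solves_wave_on Mplus (f_minus l m n)"
    using assms by (rule f_plus_solves, rule f_minus_solves)
next
  fix l' n' :: nat and m' :: int and g
  assume lm': "- int l' \<le> m' \<and> m' \<le> int l' \<and> n' \<le> l'" and "g \<in> {f_plus l' (- m') n', f_minus l' (- m') n'}"
  then have g: "g Y = f_minus l' (- m') n' Y" if "Y \<in> Htilde" for Y
    using f_plus_Htilde[OF that] by auto
  let ?c = "(-1) powi m * (2 / (of_real pi * \<i>)) * of_bool (l = l') * of_bool (m = m') *
          of_bool (n = n') * (1 - of_bool (n = 0))"
  have p: "pairing_converges (f_plus l m n) g \<and> pairing (f_plus l m n) g = 1 * ?c"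
    using lm' by (intro pairing_f_minus assms g)
      (auto simp: degt_f_plus[OF assms] f_plus_Htilde subsetD[OF Htilde_Mplus])
  have m: "pairing_converges (f_minus l m n) g \<and> pairing (f_minus l m n) g = (- 1) * ?c"
    using lm' by (intro pairing_f_minus assms g)
      (auto simp: degt_f_minus[OF assms] subsetD[OF Htilde_Mplus])
  show "pairing_converges (f_plus l m n) g" "pairing_converges (f_minus l m n) g"
    "pairing (f_plus l m n) g = - pairing (f_minus l m n) g" "- pairing (f_minus l m n) g = ?c"
    using p m by simp_all
next
  fix Y assume "Y \<in> Mplus"
  then show "invol1 (f_plus l m n) Y = f_minus l m n Y" "invol1 (f_minus l m n) Y = f_plus l m n Y"
    "invol2 l (f_plus l m n) Y = f_minus l m n Y" "invol2 l (f_minus l m n) Y = f_plus l m n Y"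
    using involutions[OF assms] by simp_all
qed

end
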